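(* There is a universal constant $C>0$ such that the following holds. Let $\nu\in\mathbb{R}^{d_0}$ be a real isotropic random vector whose entries are independent, absolutely continuous random variables with densities uniformly bounded by $M$. Then for each tensor order $\ell$ the associated Khatri–Rao test matrix $\Omega\in\mathbb{R}^{d_0^\ell\times k}$ is an $(r,\alpha)$-OSI with injectivity $\alpha = (CM)^{-2\ell}$ at some embedding dimension $k=O(r)$ (universal constant in $O(\cdot)$). The same holds with $M=1$ when $\nu$ is isotropic and log-concave, or when $\nu$ is the real spherical distribution (uniform on $\{x\in\mathbb{R}^{d_0}:\|x\|_2=\sqrt{d_0}\}$).
   Context: Isotropic means $\mathbb{E}[\nu\nu^{\top}]=I$. The Khatri–Rao test matrix is $\Omega = k^{-1/2}[\omega_1,\dots,\omega_k]$ with $\omega_j=\omega_j^{(1)}\otimes\cdots\otimes\omega_j^{(\ell)}\in\mathbb{R}^{d_0^\ell}$, all $\omega_j^{(i)}$ iid copies of $\nu$, $\otimes$ the Kronecker product. A random matrix $\Omega\in\mathbb{R}^{d\times k}$ is an $(r,\alpha)$-OSI ($k\ge r$, $\alpha\in(0,1]$) if (1) $\mathbb{E}\|\Omega^{\top}x\|_2^2=\|x\|_2^2$ for all $x$; and (2) for each fixed $r$-dimensional subspace $V\subseteq\mathbb{R}^d$, with probability at least $19/20$, $\alpha\|x\|_2^2\le\|\Omega^{\top}x\|_2^2$ for all $x\in V$. *)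

theory Defs
  imports "HOL-Probability.Probability" "Jordan_Normal_Form.VS_Connect"
begin

unbundle no vec_syntax
unbundle no inner_syntax
hide_const (open) Finite_Cartesian_Product.vec

text \<open>
  The dimensions depend on variables that are quantified inside the theorem (the constants have to
  be uniform in them), so vectors and matrices are those of \<^theory>\<open>Jordan_Normal_Form.Matrix\<close>.
  All indices start at 0.
\<close>

definition sq_norm2 :: "real vec \<Rightarrow> real" where
  "sq_norm2 v = v \<bullet> v"

definition kron_vec :: "real vec \<Rightarrow> real vec \<Rightarrow> real vec" where
  "kron_vec u v = vec (dim_vec u * dim_vec v) (\<lambda>n. u $ (n div dim_vec v) * v $ (n mod dim_vec v))"

definition kron_list :: "real vec list \<Rightarrow> real vec" where
  "kron_list us = foldr kron_vec us (vec 1 (\<lambda>_. 1))"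


section \<open>Oblivious subspace injections\<close>

definition random_matrix :: "'w measure \<Rightarrow> nat \<Rightarrow> nat \<Rightarrow> ('w \<Rightarrow> real mat) \<Rightarrow> bool" where
  "random_matrix P d k \<Omega> \<longleftrightarrow>
     prob_space P \<and>
     (\<forall>w\<in>space P. \<Omega> w \<in> carrier_mat d k) \<and>
     (\<forall>i<d. \<forall>j<k. (\<lambda>w. \<Omega> w $$ (i, j)) \<in> borel_measurable P)"

definition subspace_of_dim :: "nat \<Rightarrow> nat \<Rightarrow> real vec set \<Rightarrow> bool" where
  "subspace_of_dim d r V \<longleftrightarrow>
     VectorSpace.subspace class_ring V (module_vec TYPE(real) d) \<and>
     vectorspace.dim class_ring (module_vec TYPE(real) d\<lparr>carrier := V\<rparr>) = r"

text \<open>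
  \<^const>\<open>lebesgue_integral\<close> and \<^const>\<open>measure\<close> return 0 on non-integrable functions and
  on non-measurable sets, so integrability is required explicitly, while the bound \<open>19/20\<close>
  entails that the event is measurable.
\<close>

definition OSI :: "'w measure \<Rightarrow> nat \<Rightarrow> nat \<Rightarrow> ('w \<Rightarrow> real mat) \<Rightarrow> nat \<Rightarrow> real \<Rightarrow> bool" where
  "OSI P d k \<Omega> r \<alpha> \<longleftrightarrow>
     random_matrix P d k \<Omega> \<and> r \<le> k \<and> 0 < \<alpha> \<and> \<alpha> \<le> 1 \<and>
     (\<forall>x\<in>carrier_vec d.
        integrable P (\<lambda>w. sq_norm2 ((\<Omega> w)\<^sup>T *\<^sub>v x)) \<and>
        (LINT w|P. sq_norm2 ((\<Omega> w)\<^sup>T *\<^sub>v x)) = sq_norm2 x) \<and>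
     (\<forall>V. subspace_of_dim d r V \<longrightarrow>
        measure P {w \<in> space P. \<forall>x\<in>V. \<alpha> * sq_norm2 x \<le> sq_norm2 ((\<Omega> w)\<^sup>T *\<^sub>v x)} \<ge> 19 / 20)"


section \<open>Random vectors\<close>

text \<open>
  A random vector in \<open>\<real>\<^sup>n\<close> is given by its law, a probability measure on the product space of
  functions \<open>{..<n} \<rightarrow> \<real>\<close>; under this law the \<open>i\<close>-th entry is the coordinate map \<open>\<lambda>x. x i\<close>.
\<close>

definition vector_law :: "nat \<Rightarrow> (nat \<Rightarrow> real) measure \<Rightarrow> bool" where
  "vector_law n \<nu> \<longleftrightarrow> prob_space \<nu> \<and> sets \<nu> = sets (PiM {..<n} (\<lambda>_. borel))"

definition isotropic :: "nat \<Rightarrow> (nat \<Rightarrow> real) measure \<Rightarrow> bool" where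
  "isotropic n \<nu> \<longleftrightarrow>
     (\<forall>i<n. \<forall>j<n. integrable \<nu> (\<lambda>x. x i * x j) \<and>
        (LINT x|\<nu>. x i * x j) = (if i = j then 1 else 0))"

definition indep_bounded_densities :: "nat \<Rightarrow> real \<Rightarrow> (nat \<Rightarrow> real) measure \<Rightarrow> bool" where
  "indep_bounded_densities n M \<nu> \<longleftrightarrow>
     prob_space.indep_vars \<nu> (\<lambda>_. borel) (\<lambda>i x. x i) {..<n} \<and>
     (\<forall>i<n. \<exists>f :: real \<Rightarrow> real.
        (\<forall>t. 0 \<le> f t \<and> f t \<le> M) \<and> distributed \<nu> lborel (\<lambda>x. x i) (\<lambda>t. ennreal (f t)))"

text \<open>
  Log-concave means: absolutely continuous with a log-concave density. The case \<open>t \<in> {0, 1}\<close> of the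
  defining inequality is trivial and is left out because \<open>0 powr 0 = 0\<close>.
\<close>

definition log_concave :: "nat \<Rightarrow> (nat \<Rightarrow> real) measure \<Rightarrow> bool" where
  "log_concave n \<nu> \<longleftrightarrow>
     (\<exists>f :: (nat \<Rightarrow> real) \<Rightarrow> real.
        f \<in> borel_measurable (PiM {..<n} (\<lambda>_. lborel)) \<and>
        (\<forall>x. 0 \<le> f x) \<and>
        (\<forall>x \<in> {..<n} \<rightarrow>\<^sub>E UNIV. \<forall>y \<in> {..<n} \<rightarrow>\<^sub>E UNIV. \<forall>t \<in> {0<..<1}.
           f x powr (1 - t) * f y powr t \<le> f (\<lambda>i\<in>{..<n}. (1 - t) * x i + t * y i)) \<and>
        \<nu> = density (PiM {..<n} (\<lambda>_. lborel)) (\<lambda>x. ennreal (f x)))"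

text \<open>
  The uniform distribution on the sphere of radius \<open>sqrt n\<close> is the rotation-invariant Borel
  probability measure on that sphere. For \<open>n = 1\<close> it is the Rademacher distribution, since the
  orthogonal matrices include \<open>-1\<close>.
\<close>

definition uniform_on_sphere :: "nat \<Rightarrow> (nat \<Rightarrow> real) measure \<Rightarrow> bool" where
  "uniform_on_sphere n \<nu> \<longleftrightarrow>
     vector_law n \<nu> \<and>
     (AE x in \<nu>. sq_norm2 (vec n x) = real n) \<and>
     (\<forall>Q\<in>carrier_mat n n. Q\<^sup>T * Q = 1\<^sub>m n \<longrightarrow>
        distr \<nu> \<nu> (\<lambda>x. \<lambda>i\<in>{..<n}. (Q *\<^sub>v vec n x) $ i) = \<nu>)"


section \<open>Khatri--Rao test matrices\<close>

text \<open>
  The sample space carries the independent copies of \<open>\<nu>\<close>: the coordinate \<open>\<omega> (j, i)\<close> is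
  the \<open>i\<close>-th Kronecker factor of the \<open>j\<close>-th column.
\<close>

definition KR_space :: "nat \<Rightarrow> nat \<Rightarrow> (nat \<Rightarrow> real) measure \<Rightarrow> (nat \<times> nat \<Rightarrow> nat \<Rightarrow> real) measure" where
  "KR_space l k \<nu> = PiM ({..<k} \<times> {..<l}) (\<lambda>_. \<nu>)"

definition KR_matrix :: "nat \<Rightarrow> nat \<Rightarrow> nat \<Rightarrow> (nat \<times> nat \<Rightarrow> nat \<Rightarrow> real) \<Rightarrow> real mat" where
  "KR_matrix n l k \<omega> =
     (1 / sqrt (real k)) \<cdot>\<^sub>m
       mat_of_cols (n ^ l) (map (\<lambda>j. kron_list (map (\<lambda>i. vec n (\<omega> (j, i))) [0..<l])) [0..<k])"

definition KR_injective :: "real \<Rightarrow> nat \<Rightarrow> nat \<Rightarrow> (nat \<Rightarrow> real) measure \<Rightarrow> nat \<Rightarrow> real \<Rightarrow> bool" where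
  "KR_injective K n l \<nu> r \<alpha> \<longleftrightarrow>
     (\<exists>k. real k \<le> K * real r \<and> OSI (KR_space l k \<nu>) (n ^ l) k (KR_matrix n l k) r \<alpha>)"

end

theory Submission
  imports Defs "Jordan_Normal_Form.Determinant" "Jordan_Normal_Form.Gram_Schmidt"
begin

text \<open>
  In all three cases the linear functionals of \<open>\<nu>\<close> satisfy
  \<open>P (\<bar>u \<bullet> \<nu>\<bar> \<le> s) \<le> sqrt (A s)\<close> for all unit vectors \<open>u\<close>: for independent coordinates by
  integrating the product of the characteristic functions, for log-concave laws by the
  Prekopa--Leindler inequality applied to half-spaces, and on the sphere by comparison with a Gaussian
  vector. This bounds the moments of order \<open>- 1 / 4\<close>, which by convexity multiply along the Kronecker
  factors; hence \<open>(\<omega> \<bullet> x)\<^sup>2\<close> is smaller than \<open>(C A)\<close> to the power \<open>- 2 l\<close> only with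
  a small constant probability, for every unit vector \<open>x\<close> and every order \<open>l\<close>.

  Uniformity over an \<open>r\<close>-dimensional subspace comes from a union bound over vertices. If injectivity fails
  at some unit vector, that vector lies in the polytope cut out by the slabs of more than half of the columns
  and by a box. Pushing it to a vertex does not decrease its norm, and the vertex is determined by
  \<open>r\<close> of the constraints, so that it is independent of the remaining columns. With \<open>k = 4 r\<close> there are at
  most \<open>2 ^ (14 r)\<close> choices, each of probability at most \<open>2 ^ (- 19 r)\<close>.
\<close>

section \<open>Characteristic functions of laws with bounded density\<close>

text \<open>A net on the unit sphere of the subspace would need an upper bound for the test matrix
  there, and products of \<open>l\<close> factors have tails too heavy for that. Vertices need only
  lower bounds for single vectors. The box is added because slabs alone may leave a direction
  unbounded. At least \<open>2 * r\<close> of the \<open>4 * r\<close> columns respond weakly to a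
  bad vector and a vertex uses at most \<open>r\<close> of them, so \<open>r\<close> columns
  independent of the vertex remain. The number of choices has exponent \<open>3 * k + 2 * r\<close>:
  the active constraints, their signs, the remaining columns.

  Small ball probabilities do not multiply along Kronecker factors, since iterating them costs
  logarithms; negative moments do, with one constant per factor. This gives \<alpha> its form. The
  square root in the small ball bound is the price of the Gaussian comparison on the sphere; it
  admits moments of every order above -1/2, and -1/4 leaves a convergent dyadic sum.\<close>

lemma gaussian_mean_eq_char:
  assumes "real_distribution \<mu>"
  shows "complex_of_real (\<integral>x. exp (- (a * x)\<^sup>2 / 2) \<partial>\<mu>) =
    (CLINT t|std_normal_distribution. char \<mu> (a * t))"
proof -
  interpret N: real_distribution std_normal_distribution by (rule real_dist_normal_dist)
  interpret M: real_distribution \<mu> by fact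
  interpret P: pair_prob_space std_normal_distribution \<mu> ..
  have "complex_of_real (exp (- (a * x)\<^sup>2 / 2)) = (CLINT t|std_normal_distribution. iexp (a * t * x))" for x
    using fun_cong[OF char_std_normal_distribution, of "a * x", symmetric]
    by (simp add: char_def mult_ac)
  then have "complex_of_real (\<integral>x. exp (- (a * x)\<^sup>2 / 2) \<partial>\<mu>) =
      (CLINT x|\<mu>. CLINT t|std_normal_distribution. iexp (a * t * x))"
    by (simp flip: integral_complex_of_real)
  also have "\<dots> = (CLINT t|std_normal_distribution. CLINT x|\<mu>. iexp (a * t * x))"
    by (rule P.Fubini_integral) (auto intro!: P.integrable_const_bound[where B=1])
  finally show ?thesis by (simp add: char_def)
qed

text \<open>Esseen's inequality with a Gaussian kernel: a bump of width \<open>s\<close> is at least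
  1/2 on the interval, and its mean is a Gaussian average of the characteristic function. The
  resulting factor 2 is absorbed because the standard normal density is at most 1/2.\<close>

lemma emeasure_abs_le_char:
  assumes "real_distribution \<mu>" and s: "0 < s"
  shows "emeasure \<mu> {x. \<bar>x\<bar> \<le> s} \<le> ennreal s * (\<integral>\<^sup>+t. ennreal (cmod (char \<mu> t)) \<partial>lborel)"
proof -
  interpret N: real_distribution std_normal_distribution by (rule real_dist_normal_dist)
  interpret M: real_distribution \<mu> by fact
  define a where "a = 1 / s"
  have a: "a > 0" using s by (simp add: a_def)
  let ?g = "\<lambda>x. exp (- (a * x)\<^sup>2 / 2)"
  have int_g: "integrable \<mu> ?g"
    by (rule M.integrable_const_bound[where B=1]) (auto)
  have int_c: "integrable std_normal_distribution (\<lambda>t. cmod (char \<mu> (a * t)))"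
    by (rule N.integrable_const_bound[where B=1]) (auto intro: M.cmod_char_le_1)
  have nonneg: "0 \<le> (\<integral>x. ?g x \<partial>\<mu>)" by (intro integral_nonneg_AE) auto
  have "(\<integral>x. ?g x \<partial>\<mu>) = cmod (CLINT t|std_normal_distribution. char \<mu> (a * t))"
    by (subst gaussian_mean_eq_char[OF assms(1), symmetric]) (use nonneg in auto)
  also have "\<dots> \<le> (LINT t|std_normal_distribution. cmod (char \<mu> (a * t)))"
    by (rule integral_norm_bound)
  finally have 1: "ennreal (\<integral>x. ?g x \<partial>\<mu>) \<le> (\<integral>\<^sup>+t. cmod (char \<mu> (a * t)) \<partial>std_normal_distribution)"
    by (subst nn_integral_eq_integral[OF int_c]) (auto intro: ennreal_leI)
  have e2: "exp (1/2::real) \<le> 2"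
  proof -
    have "exp (1/2::real) ^ 2 \<le> 2 ^ 2"
      using exp_le by (simp flip: exp_of_nat_mult)
    then show ?thesis by (rule power2_le_imp_le) simp
  qed
  have "(2::real)\<^sup>2 \<le> 2 * pi" using pi_ge_two by simp
  then have s2: "2 \<le> sqrt (2 * pi)" by (rule real_le_rsqrt)
  have "indicator {x. \<bar>x\<bar> \<le> s} x \<le> ennreal 2 * ennreal (?g x)" for x
  proof (cases "\<bar>x\<bar> \<le> s")
    case True
    then have "\<bar>a * x\<bar> \<le> 1" using s by (simp add: a_def abs_mult)
    then have "(a * x)\<^sup>2 \<le> 1" by (simp add: abs_square_le_1)
    then have "exp (-(1/2)) \<le> ?g x" by simp
    moreover have "1 \<le> 2 * exp (-(1/2::real))" using e2 by (simp add: exp_minus field_simps)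
    ultimately have "1 \<le> 2 * ?g x" by linarith
    then have "1 \<le> ennreal (2 * ?g x)" by (subst ennreal_1[symmetric], intro ennreal_leI)
    then show ?thesis using True by (simp add: ennreal_mult')
  qed simp
  then have "(\<integral>\<^sup>+x. indicator {x. \<bar>x\<bar> \<le> s} x \<partial>\<mu>) \<le> (\<integral>\<^sup>+x. ennreal 2 * ennreal (?g x) \<partial>\<mu>)"
    by (rule nn_integral_mono)
  also have "\<dots> = ennreal 2 * ennreal (\<integral>x. ?g x \<partial>\<mu>)"
    by (subst nn_integral_cmult) (auto simp del: ennreal_numeral simp: nn_integral_eq_integral[OF int_g, simplified])
  also have "\<dots> \<le> ennreal 2 * (\<integral>\<^sup>+t. cmod (char \<mu> (a * t)) \<partial>std_normal_distribution)"
    by (intro mult_left_mono 1) simp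
  also have "\<dots> = (\<integral>\<^sup>+t. ennreal 2 * (ennreal (std_normal_density t) * cmod (char \<mu> (a * t))) \<partial>lborel)"
    by (subst nn_integral_density) (auto intro!: nn_integral_cmult[symmetric])
  also have "\<dots> \<le> (\<integral>\<^sup>+t. ennreal (cmod (char \<mu> (a * t))) \<partial>lborel)"
  proof (rule nn_integral_mono)
    fix t :: real
    have "2 * std_normal_density t \<le> 1"
    proof -
      have "exp (- t\<^sup>2 / 2) \<le> 1" by simp
      then have "2 * exp (- t\<^sup>2 / 2) \<le> sqrt (2 * pi)" using s2 by linarith
      then show ?thesis by (simp add: std_normal_density_def field_simps)
    qed
    then have "2 * std_normal_density t * cmod (char \<mu> (a * t)) \<le> 1 * cmod (char \<mu> (a * t))"
      by (intro mult_right_mono) auto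
    from ennreal_leI[OF this]
    show "ennreal 2 * (ennreal (std_normal_density t) * ennreal (cmod (char \<mu> (a * t)))) \<le> ennreal (cmod (char \<mu> (a * t)))"
      by (simp add: ennreal_mult' mult.assoc)
  qed
  also have "\<dots> = ennreal s * (\<integral>\<^sup>+t. ennreal (cmod (char \<mu> t)) \<partial>lborel)"
    using a s nn_integral_real_affine[of "\<lambda>t. ennreal (cmod (char \<mu> t))" a 0]
    by (simp add: a_def mult.assoc[symmetric] ennreal_mult'[symmetric])
  finally show ?thesis by simp
qed

section \<open>Symmetrization and the growth of \<open>1 - |char|^2\<close>\<close>

definition symmetrization :: "real measure \<Rightarrow> real measure" where
  "symmetrization \<mu> = distr (\<mu> \<Otimes>\<^sub>M \<mu>) borel (\<lambda>(x, y). x - y)"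

lemma real_distribution_symmetrization:
  assumes "real_distribution \<mu>"
  shows "real_distribution (symmetrization \<mu>)"
proof -
  interpret M: real_distribution \<mu> by fact
  interpret P: pair_prob_space \<mu> \<mu> ..
  show ?thesis unfolding symmetrization_def by (rule P.real_distribution_distr) simp
qed

text \<open>The difference of two independent copies has a real nonnegative characteristic function,
  so the modulus can be studied through cosines, without phases.\<close>

lemma char_symmetrization:
  assumes "real_distribution \<mu>"
  shows "char (symmetrization \<mu>) t = complex_of_real ((cmod (char \<mu> t))\<^sup>2)"
proof -
  interpret M: real_distribution \<mu> by fact
  interpret P: pair_prob_space \<mu> \<mu> ..
  have "char (symmetrization \<mu>) t = (CLINT z|\<mu> \<Otimes>\<^sub>M \<mu>. iexp (t * (fst z - snd z)))"
    unfolding char_def symmetrization_def by (subst integral_distr) (auto simp: case_prod_beta)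
  also have "\<dots> = (CLINT z|\<mu> \<Otimes>\<^sub>M \<mu>. (\<lambda>(x, y). iexp (t * (x - y))) z)"
    by (simp add: case_prod_beta)
  also have "\<dots> = (CLINT x|\<mu>. CLINT y|\<mu>. iexp (t * (x - y)))"
    by (subst P.integral_fst)
       (auto intro!: P.integrable_const_bound[where B=1] simp: case_prod_beta)
  also have "\<dots> = (CLINT x|\<mu>. CLINT y|\<mu>. iexp (t * x) * cnj (iexp (t * y)))"
    by (simp add: exp_cnj exp_add[symmetric] algebra_simps)
  also have "\<dots> = char \<mu> t * cnj (char \<mu> t)"
    unfolding char_def by simp
  finally show ?thesis by (simp only: complex_norm_square)
qed

lemma cmod_char_sq_eq:
  assumes "real_distribution \<mu>"
  shows "(cmod (char \<mu> t))\<^sup>2 = (\<integral>y. cos (t * y) \<partial>symmetrization \<mu>)"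
proof -
  interpret S: real_distribution "symmetrization \<mu>" by (rule real_distribution_symmetrization) fact
  have "Re (char (symmetrization \<mu>) t) = (\<integral>y. Re (iexp (t * y)) \<partial>symmetrization \<mu>)"
    unfolding char_def
    by (subst integral_Re[symmetric]) (auto intro!: S.integrable_const_bound[where B=1])
  then show ?thesis by (simp add: char_symmetrization[OF assms] Re_exp)
qed

lemma abs_sin_mult_le: "\<bar>sin (real k * x)\<bar> \<le> real k * \<bar>sin x\<bar>"
proof (induction k)
  case (Suc k)
  have "\<bar>sin (real (Suc k) * x)\<bar> = \<bar>sin (real k * x) * cos x + cos (real k * x) * sin x\<bar>"
    by (simp only: sin_add[symmetric]) (simp add: algebra_simps)
  also have "\<dots> \<le> \<bar>sin (real k * x)\<bar> * \<bar>cos x\<bar> + \<bar>cos (real k * x)\<bar> * \<bar>sin x\<bar>"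
    by (simp add: abs_mult[symmetric])
  also have "\<dots> \<le> \<bar>sin (real k * x)\<bar> * 1 + 1 * \<bar>sin x\<bar>"
    by (intro add_mono mult_mono) auto
  finally show ?case using Suc by (simp add: algebra_simps)
qed simp

text \<open>By the half-angle formula both sides are squared sines, for which multiplying the angle
  by \<open>k\<close> costs at most the factor \<open>k\<close>.\<close>

lemma one_minus_cos_mult_le: "1 - cos (real k * x) \<le> (real k)\<^sup>2 * (1 - cos x)"
proof -
  have half: "1 - cos y = 2 * (sin (y / 2))\<^sup>2" for y :: real
    using cos_double_sin[of "y / 2"] by simp
  have "(sin (real k * (x / 2)))\<^sup>2 \<le> (real k * \<bar>sin (x / 2)\<bar>)\<^sup>2"
    using power_mono[OF abs_sin_mult_le[of k "x / 2"], of 2] by simp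
  then show ?thesis by (simp add: half power_mult_distrib)
qed

text \<open>If the modulus is close to 1 at \<open>t\<close>, it is still away from 0 at
  \<open>k * t\<close> for moderate \<open>k\<close>. Dilation thus carries sets where the modulus
  is nearly 1 into the set where its square is at least 1/2.\<close>

lemma one_minus_cmod_char_sq_mult_le:
  assumes "real_distribution \<mu>"
  shows "1 - (cmod (char \<mu> (real k * t)))\<^sup>2 \<le> (real k)\<^sup>2 * (1 - (cmod (char \<mu> t))\<^sup>2)"
proof -
  interpret S: real_distribution "symmetrization \<mu>" by (rule real_distribution_symmetrization) fact
  have int: "integrable (symmetrization \<mu>) (\<lambda>y. cos (c * y))" for c
    by (rule S.integrable_const_bound[where B=1]) auto
  have eq: "1 - (cmod (char \<mu> c))\<^sup>2 = (\<integral>y. 1 - cos (c * y) \<partial>symmetrization \<mu>)" for c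
    using S.prob_space by (simp add: cmod_char_sq_eq[OF assms] int)
  have "(\<integral>y. 1 - cos (real k * t * y) \<partial>symmetrization \<mu>) \<le>
      (\<integral>y. (real k)\<^sup>2 * (1 - cos (t * y)) \<partial>symmetrization \<mu>)"
    using one_minus_cos_mult_le[of k "t * _"]
    using int[of "real k * t"] by (intro integral_mono) (auto simp: int mult.assoc)
  then show ?thesis by (simp add: eq)
qed

text \<open>Absolute continuity with density at most \<open>M\<close>, phrased as domination by
  \<open>M\<close> times Lebesgue measure: the form in which integrals over one coordinate are
  estimated, with no density to carry along.\<close>

definition bounded_law :: "real \<Rightarrow> real measure \<Rightarrow> bool" where
  "bounded_law M \<mu> \<longleftrightarrow> real_distribution \<mu> \<and> 0 \<le> M \<and>
     (\<forall>g \<in> borel_measurable borel. (\<integral>\<^sup>+x. g x \<partial>\<mu>) \<le> ennreal M * (\<integral>\<^sup>+x. g x \<partial>lborel))"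

lemma bounded_lawI_density:
  assumes "prob_space (density lborel (\<lambda>x. ennreal (f x)))"
    and f: "\<And>x. 0 \<le> f x" "\<And>x. f x \<le> M"
    and [measurable]: "(\<lambda>x. ennreal (f x)) \<in> borel_measurable borel"
  shows "bounded_law M (density lborel (\<lambda>x. ennreal (f x)))"
  unfolding bounded_law_def
proof (intro conjI ballI)
  show "real_distribution (density lborel (\<lambda>x. ennreal (f x)))"
    using assms(1) by (simp add: real_distribution_def real_distribution_axioms_def)
  show "0 \<le> M" using f[of 0] by linarith
  fix g :: "real \<Rightarrow> ennreal" assume [measurable]: "g \<in> borel_measurable borel"
  have "(\<integral>\<^sup>+x. g x \<partial>density lborel (\<lambda>x. ennreal (f x))) = (\<integral>\<^sup>+x. ennreal (f x) * g x \<partial>lborel)"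
    by (subst nn_integral_density) auto
  also have "\<dots> \<le> (\<integral>\<^sup>+x. ennreal M * g x \<partial>lborel)"
    using f by (intro nn_integral_mono mult_right_mono ennreal_leI) auto
  also have "\<dots> = ennreal M * (\<integral>\<^sup>+x. g x \<partial>lborel)" by (rule nn_integral_cmult) simp
  finally show "(\<integral>\<^sup>+x. g x \<partial>density lborel (\<lambda>x. ennreal (f x))) \<le> ennreal M * (\<integral>\<^sup>+x. g x \<partial>lborel)" .
qed

lemma nn_integral_gaussian:
  assumes "0 < a"
  shows "(\<integral>\<^sup>+x. ennreal (exp (- (a * (x - y))\<^sup>2 / 2)) \<partial>lborel) = ennreal (sqrt (2 * pi) / a)"
proof -
  have "(\<integral>\<^sup>+x. ennreal (exp (- (a * (x - y))\<^sup>2 / 2)) \<partial>lborel)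
     = (\<integral>\<^sup>+x. ennreal (sqrt (2 * pi) / a) * ennreal (normal_density y (1 / a) x) \<partial>lborel)"
  proof (intro nn_integral_cong)
    fix x
    have "(x - y)\<^sup>2 / (2 * (1 / a)\<^sup>2) = (a * (x - y))\<^sup>2 / 2"
      by (simp add: power_mult_distrib power_divide)
    moreover have "sqrt (2 * pi * (1 / a)\<^sup>2) = sqrt (2 * pi) / a"
      using assms by (simp add: real_sqrt_mult power_divide real_sqrt_divide)
    ultimately have eq: "exp (- (a * (x - y))\<^sup>2 / 2) = sqrt (2 * pi) / a * normal_density y (1 / a) x"
      using assms by (simp add: normal_density_def minus_divide_left[symmetric])
    show "ennreal (exp (- (a * (x - y))\<^sup>2 / 2)) = ennreal (sqrt (2 * pi) / a) * ennreal (normal_density y (1 / a) x)"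
      using assms by (subst eq, intro ennreal_mult) auto
  qed
  also have "\<dots> = ennreal (sqrt (2 * pi) / a) * ennreal 1"
    using assms by (subst nn_integral_cmult)
      (auto simp: nn_integral_eq_integral integrable_normal_density integral_normal_density)
  finally show ?thesis by simp
qed

text \<open>One inequality of Plancherel's theorem. Weighted by a Gaussian of width
  \<open>a\<close>, the integral becomes the mean of a bump of width \<open>1 / a\<close> in the
  difference of two independent copies; the density bound makes the powers of \<open>a\<close>
  cancel.\<close>

lemma plancherel_bound:
  assumes "bounded_law M \<mu>"
  shows "(\<integral>\<^sup>+t. ennreal ((cmod (char \<mu> t))\<^sup>2) \<partial>lborel) \<le> ennreal (2 * pi * M)"
proof -
  have rd: "real_distribution \<mu>" and M: "0 \<le> M"
    and bd: "\<And>g. g \<in> borel_measurable borel \<Longrightarrow> (\<integral>\<^sup>+x. g x \<partial>\<mu>) \<le> ennreal M * (\<integral>\<^sup>+x. g x \<partial>lborel)"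
    using assms by (auto simp: bounded_law_def)
  interpret N: real_distribution std_normal_distribution by (rule real_dist_normal_dist)
  interpret M: real_distribution \<mu> by fact
  interpret S: real_distribution "symmetrization \<mu>" by (rule real_distribution_symmetrization) fact
  interpret P: pair_prob_space \<mu> \<mu> ..
  define h where "h t = (cmod (char \<mu> t))\<^sup>2" for t
  have [measurable]: "h \<in> borel_measurable borel" unfolding h_def by measurable
  have h: "0 \<le> h t" "h t \<le> 1" for t
    unfolding h_def using M.cmod_char_le_1[of t] by (auto simp: power_le_one)
  have key: "(\<integral>\<^sup>+t. ennreal (h t * exp (- (t / a)\<^sup>2 / 2)) \<partial>lborel) \<le> ennreal (2 * pi * M)" if a: "a > 0" for a
  proof -
    have int: "integrable std_normal_distribution (\<lambda>t. h (a * t))"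
      by (rule N.integrable_const_bound[where B=1]) (auto simp: h)
    have int2: "integrable (symmetrization \<mu>) (\<lambda>x. exp (- (a * x)\<^sup>2 / 2))"
      by (rule S.integrable_const_bound[where B=1]) auto
    have "complex_of_real (\<integral>x. exp (- (a * x)\<^sup>2 / 2) \<partial>symmetrization \<mu>) =
       complex_of_real (LINT t|std_normal_distribution. h (a * t))"
      by (subst gaussian_mean_eq_char[OF S.real_distribution_axioms])
        (simp only: char_symmetrization[OF rd] h_def[symmetric] integral_complex_of_real)
    then have "(LINT t|std_normal_distribution. h (a * t)) = (\<integral>x. exp (- (a * x)\<^sup>2 / 2) \<partial>symmetrization \<mu>)"
      by (simp only: of_real_eq_iff)
    then have "(\<integral>\<^sup>+t. ennreal (h (a * t)) \<partial>std_normal_distribution) = (\<integral>\<^sup>+x. ennreal (exp (- (a * x)\<^sup>2 / 2)) \<partial>symmetrization \<mu>)"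
      using int int2 by (simp add: nn_integral_eq_integral h)
    also have "\<dots> = (\<integral>\<^sup>+z. ennreal (exp (- (a * (fst z - snd z))\<^sup>2 / 2)) \<partial>(\<mu> \<Otimes>\<^sub>M \<mu>))"
      unfolding symmetrization_def by (subst nn_integral_distr) (auto simp: case_prod_beta)
    also have "\<dots> = (\<integral>\<^sup>+y. \<integral>\<^sup>+x. ennreal (exp (- (a * (x - y))\<^sup>2 / 2)) \<partial>\<mu> \<partial>\<mu>)"
      by (subst P.nn_integral_snd[symmetric]) auto
    also have "\<dots> \<le> (\<integral>\<^sup>+y. ennreal M * ennreal (sqrt (2 * pi) / a) \<partial>\<mu>)"
    proof (rule nn_integral_mono)
      fix y
      have "(\<integral>\<^sup>+x. ennreal (exp (- (a * (x - y))\<^sup>2 / 2)) \<partial>\<mu>) \<le> ennreal M * (\<integral>\<^sup>+x. ennreal (exp (- (a * (x - y))\<^sup>2 / 2)) \<partial>lborel)"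
        by (rule bd) measurable
      then show "(\<integral>\<^sup>+x. ennreal (exp (- (a * (x - y))\<^sup>2 / 2)) \<partial>\<mu>) \<le> ennreal M * ennreal (sqrt (2 * pi) / a)"
        by (simp only: nn_integral_gaussian[OF a])
    qed
    also have "\<dots> = ennreal (M * sqrt (2 * pi) / a)"
      using M a by (simp add: M.emeasure_space_1[simplified] ennreal_mult[symmetric])
    finally have 1: "(\<integral>\<^sup>+t. ennreal (h (a * t)) \<partial>std_normal_distribution) \<le> ennreal (M * sqrt (2 * pi) / a)" .
    have "(\<integral>\<^sup>+t. ennreal (h t * exp (- (t / a)\<^sup>2 / 2)) \<partial>lborel)
        = ennreal a * (\<integral>\<^sup>+t. ennreal (h (a * t) * exp (- t\<^sup>2 / 2)) \<partial>lborel)"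
      using a by (subst nn_integral_real_affine[where c=a and t=0]) auto
    also have "(\<integral>\<^sup>+t. ennreal (h (a * t) * exp (- t\<^sup>2 / 2)) \<partial>lborel)
        = (\<integral>\<^sup>+t. ennreal (sqrt (2 * pi)) * (ennreal (std_normal_density t) * ennreal (h (a * t))) \<partial>lborel)"
      by (intro nn_integral_cong) (simp add: std_normal_density_def h mult_ac flip: ennreal_mult')
    also have "\<dots> = ennreal (sqrt (2 * pi)) * (\<integral>\<^sup>+t. ennreal (h (a * t)) \<partial>std_normal_distribution)"
      by (subst nn_integral_density) (auto intro!: nn_integral_cmult)
    also have "ennreal a * \<dots> \<le> ennreal a * (ennreal (sqrt (2 * pi)) * ennreal (M * sqrt (2 * pi) / a))"
      by (intro mult_left_mono 1) auto
    also have "\<dots> = ennreal (2 * pi * M)"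
      using a M by (simp add: ennreal_mult[symmetric])
    finally show ?thesis .
  qed
  have lim: "(\<lambda>n. ennreal (h t * exp (- (t / real (Suc n))\<^sup>2 / 2))) \<longlonglongrightarrow> ennreal (h t)" for t
  proof -
    have "(\<lambda>n. h t * exp (- (t / real (Suc n))\<^sup>2 / 2)) \<longlonglongrightarrow> h t * exp (- 0\<^sup>2 / 2)"
      by (intro tendsto_intros LIMSEQ_Suc[OF lim_const_over_n]) simp
    then show ?thesis by (intro tendsto_ennrealI) simp
  qed
  \<comment> \<open>The bound is uniform in the width, so Fatou's lemma along the widths
    \<open>Suc n\<close> removes the Gaussian weight.\<close>
  have "(\<integral>\<^sup>+t. ennreal (h t) \<partial>lborel) = (\<integral>\<^sup>+t. liminf (\<lambda>n. ennreal (h t * exp (- (t / real (Suc n))\<^sup>2 / 2))) \<partial>lborel)"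
    by (intro nn_integral_cong lim_imp_Liminf[OF trivial_limit_sequentially lim, symmetric])
  also have "\<dots> \<le> liminf (\<lambda>n. \<integral>\<^sup>+t. ennreal (h t * exp (- (t / real (Suc n))\<^sup>2 / 2)) \<partial>lborel)"
    by (rule nn_integral_liminf) measurable
  also have "\<dots> \<le> ennreal (2 * pi * M)"
  proof -
    have "\<forall>n. (\<integral>\<^sup>+t. ennreal (h t * exp (- (t / real (Suc n))\<^sup>2 / 2)) \<partial>lborel) \<le> ennreal (2 * pi * M)"
      using key by simp
    then show ?thesis by (metis (no_types, lifting) Liminf_const Liminf_mono always_eventually trivial_limit_sequentially)
  qed
  finally show ?thesis by (simp add: h_def)
qed

lemma emeasure_char_level_half:
  assumes "bounded_law M \<mu>"
  shows "emeasure lborel {t. 1 / 2 \<le> (cmod (char \<mu> t))\<^sup>2} \<le> ennreal (4 * pi * M)"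
proof -
  interpret M: real_distribution \<mu> using assms by (simp add: bounded_law_def)
  have "(\<integral>\<^sup>+t. indicator {t. 1 / 2 \<le> (cmod (char \<mu> t))\<^sup>2} t \<partial>lborel)
      \<le> (\<integral>\<^sup>+t. ennreal 2 * ennreal ((cmod (char \<mu> t))\<^sup>2) \<partial>lborel)"
  proof (rule nn_integral_mono)
    fix t
    show "indicator {t. 1 / 2 \<le> (cmod (char \<mu> t))\<^sup>2} t \<le> ennreal 2 * ennreal ((cmod (char \<mu> t))\<^sup>2)"
    proof (cases "1 / 2 \<le> (cmod (char \<mu> t))\<^sup>2")
      case True
      then have "ennreal 1 \<le> ennreal (2 * (cmod (char \<mu> t))\<^sup>2)" by (intro ennreal_leI) simp
      then show ?thesis using True by (simp add: ennreal_mult')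
    qed simp
  qed
  also have "\<dots> = ennreal 2 * (\<integral>\<^sup>+t. ennreal ((cmod (char \<mu> t))\<^sup>2) \<partial>lborel)"
    by (rule nn_integral_cmult) measurable
  also have "\<dots> \<le> ennreal 2 * ennreal (2 * pi * M)"
    by (intro mult_left_mono plancherel_bound assms) simp
  also have "\<dots> = ennreal (4 * pi * M)"
    by (subst ennreal_mult'[symmetric]) (auto simp: mult.assoc)
  finally show ?thesis by simp
qed

lemma emeasure_lborel_scale:
  fixes c :: real
  assumes [measurable]: "A \<in> sets borel" and c: "c > 0"
  shows "emeasure lborel {t. c * t \<in> A} = ennreal (1 / c) * emeasure lborel A"
proof -
  have "emeasure lborel A = (\<integral>\<^sup>+t. indicator A t \<partial>lborel)" by simp
  also have "\<dots> = ennreal c * (\<integral>\<^sup>+t. indicator A (c * t) \<partial>lborel)"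
    using c by (subst nn_integral_real_affine[where c=c and t=0]) auto
  also have "(\<integral>\<^sup>+t. indicator A (c * t) \<partial>lborel) = (\<integral>\<^sup>+t. indicator {t. c * t \<in> A} t \<partial>lborel)"
    by (intro nn_integral_cong) (simp add: indicator_def)
  also have "\<dots> = emeasure lborel {t. c * t \<in> A}" by (rule nn_integral_indicator) measurable
  finally show ?thesis using c by (simp add: mult.assoc[symmetric] ennreal_mult'[symmetric])
qed

text \<open>For small \<kappa>, dilation by an integer of order \<open>1 / sqrt \<kappa>\<close>
  still lands in the set where the square is at least 1/2. That set has measure of order
  \<open>M\<close>, and undoing the dilation gives the factor \<open>sqrt \<kappa>\<close>. The
  second condition in the set takes over once \<kappa> exceeds 1/2.\<close>

lemma emeasure_char_level:
  assumes bl: "bounded_law M \<mu>" and lam: "0 < \<kappa>"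
  shows "emeasure lborel {t. 1 - \<kappa> \<le> (cmod (char \<mu> t))\<^sup>2 \<and> 1 / 2 \<le> (cmod (char \<mu> t))\<^sup>2}
    \<le> ennreal (12 * pi * M * sqrt \<kappa>)"
proof -
  have rd: "real_distribution \<mu>" and M: "0 \<le> M" using bl by (auto simp: bounded_law_def)
  interpret M: real_distribution \<mu> by fact
  let ?h = "\<lambda>t. (cmod (char \<mu> t))\<^sup>2"
  have A: "{t. 1 / 2 \<le> ?h t} \<in> sets borel" by measurable
  have s2: "2 * sqrt 2 \<le> 3"
    by (rule power2_le_imp_le) (auto simp: power_mult_distrib)
  show ?thesis
  proof (cases "\<kappa> \<le> 1 / 2")
    case False
    have "emeasure lborel {t. 1 - \<kappa> \<le> ?h t \<and> 1 / 2 \<le> ?h t} \<le> emeasure lborel {t. 1 / 2 \<le> ?h t}"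
      using A by (intro emeasure_mono) auto
    also have "\<dots> \<le> ennreal (4 * pi * M)" by (rule emeasure_char_level_half) fact
    also have "\<dots> \<le> ennreal (12 * pi * M * sqrt \<kappa>)"
    proof (rule ennreal_leI)
      have "1 / 3 \<le> sqrt \<kappa>" by (rule real_le_rsqrt) (use False in \<open>simp add: power2_eq_square\<close>)
      then have "4 * pi * M * 1 \<le> 4 * pi * M * (3 * sqrt \<kappa>)" using M by (intro mult_left_mono) auto
      then show "4 * pi * M \<le> 12 * pi * M * sqrt \<kappa>" by simp
    qed
    finally show ?thesis .
  next
    case True
    \<comment> \<open>\<open>x\<close> solves \<open>x^2 * \<kappa> = 1 / 2\<close>, and its floor
      is at least \<open>x / 2\<close>. The loss \<open>2 * sqrt 2 <= 3\<close> turns the constant 4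
      into 12.\<close>
    define x where "x = 1 / sqrt (2 * \<kappa>)"
    have x1: "1 \<le> x" using True lam by (simp add: x_def)
    define k where "k = nat \<lfloor>x\<rfloor>"
    have k1: "1 \<le> k" using x1 by (simp add: k_def le_nat_floor)
    have kx: "real k \<le> x" using x1 by (simp add: k_def)
    have "x < real k + 1" using x1 by (simp add: k_def)
    then have k2: "x \<le> 2 * real k" using k1 by simp
    have "(real k)\<^sup>2 \<le> x\<^sup>2" using kx by (intro power_mono) auto
    then have "(real k)\<^sup>2 * \<kappa> \<le> x\<^sup>2 * \<kappa>" using lam by (intro mult_right_mono) auto
    also have "x\<^sup>2 * \<kappa> = 1 / 2" using lam by (simp add: x_def power_divide)
    finally have kl: "(real k)\<^sup>2 * \<kappa> \<le> 1 / 2" .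
    have "{t. 1 - \<kappa> \<le> ?h t \<and> 1 / 2 \<le> ?h t} \<subseteq> {t. real k * t \<in> {t. 1 / 2 \<le> ?h t}}"
    proof safe
      fix t assume "1 - \<kappa> \<le> ?h t"
      then have "(real k)\<^sup>2 * (1 - ?h t) \<le> (real k)\<^sup>2 * \<kappa>" by (intro mult_left_mono) auto
      with one_minus_cmod_char_sq_mult_le[OF rd, of k t] kl
      show "1 / 2 \<le> ?h (real k * t)" by linarith
    qed
    then have "emeasure lborel {t. 1 - \<kappa> \<le> ?h t \<and> 1 / 2 \<le> ?h t}
        \<le> emeasure lborel {t. real k * t \<in> {t. 1 / 2 \<le> ?h t}}"
      by (intro emeasure_mono) measurable
    also have "\<dots> = ennreal (1 / real k) * emeasure lborel {t. 1 / 2 \<le> ?h t}"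
      using k1 by (intro emeasure_lborel_scale A) auto
    also have "\<dots> \<le> ennreal (1 / real k) * ennreal (4 * pi * M)"
      by (intro mult_left_mono emeasure_char_level_half bl) simp
    also have "\<dots> = ennreal (1 / real k * (4 * pi * M))"
      by (rule ennreal_mult'[symmetric]) simp
    also have "\<dots> \<le> ennreal (12 * pi * M * sqrt \<kappa>)"
    proof (rule ennreal_leI)
      have "1 / real k \<le> 2 / x" using k1 k2 x1 by (simp add: field_simps)
      also have "\<dots> = 2 * sqrt 2 * sqrt \<kappa>" by (simp add: x_def real_sqrt_mult)
      also have "\<dots> \<le> 3 * sqrt \<kappa>" using s2 lam by (intro mult_right_mono) auto
      finally have "1 / real k * (4 * pi * M) \<le> 3 * sqrt \<kappa> * (4 * pi * M)"
        using M by (intro mult_right_mono) auto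
      then show "1 / real k * (4 * pi * M) \<le> 12 * pi * M * sqrt \<kappa>" by (simp add: mult_ac)
    qed
    finally show ?thesis .
  qed
qed

section \<open>Integrals of powers of the characteristic function\<close>

lemma ennreal_le_suminf: "f m \<le> (\<Sum>m. f m)" for f :: "nat \<Rightarrow> ennreal"
  using sum_le_suminf[of f "{m}"] by simp

text \<open>Ball's integral inequality up to the constant. Where the squared modulus
  \<open>h\<close> is below 1/2, the power is exponentially small in \<open>q\<close> compared with
  \<open>h\<close>, which is integrable. Elsewhere a point with \<open>q * (1 - h)\<close> between
  \<open>m\<close> and \<open>m + 1\<close> lies in \<open>S m\<close>, of measure of order
  \<open>sqrt ((m + 1) / q)\<close>, while the power there is at most
  \<open>exp (- m)\<close>.\<close>

lemma nn_integral_char_powr_le: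
  assumes bl: "bounded_law M \<mu>" and q: "1 \<le> q"
  shows "(\<integral>\<^sup>+t. ennreal (cmod (char \<mu> t) powr (2 * q)) \<partial>lborel) \<le> ennreal (64 * pi * M / sqrt q)"
proof -
  have rd: "real_distribution \<mu>" and M: "0 \<le> M" using bl by (auto simp: bounded_law_def)
  interpret M: real_distribution \<mu> by fact
  define h where "h t = (cmod (char \<mu> t))\<^sup>2" for t
  have [measurable]: "h \<in> borel_measurable borel" unfolding h_def by measurable
  have h: "0 \<le> h t" "h t \<le> 1" for t
    unfolding h_def using M.cmod_char_le_1[of t] by (auto simp: power_le_one)
  have hq: "cmod (char \<mu> t) powr (2 * q) = h t powr q" for t
  proof (cases "cmod (char \<mu> t) = 0")
    case False
    then have "h t = cmod (char \<mu> t) powr 2" by (simp add: h_def powr_numeral)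
    then show ?thesis by (simp only: powr_powr)
  qed (simp add: h_def)
  define S where "S m = {t. 1 - (real m + 1) / q \<le> h t \<and> 1 / 2 \<le> h t}" for m :: nat
  have [measurable]: "S m \<in> sets borel" for m unfolding S_def by measurable
  let ?c = "2 powr (1 - q)"
  have pt: "ennreal (h t powr q) \<le> ennreal ?c * ennreal (h t)
      + (\<Sum>m. ennreal (exp (- real m)) * indicator (S m) t)" for t
  proof (cases "1 / 2 \<le> h t")
    case False
    have "h t powr q \<le> ?c * h t"
    proof (cases "h t = 0")
      case f: False
      then have pos: "0 < h t" using h[of t] by linarith
      have "h t powr q = h t powr (q - 1) * h t" using pos by (simp add: powr_diff)
      also have "h t powr (q - 1) \<le> (1 / 2) powr (q - 1)"
        using pos False q by (intro powr_mono2) auto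
      also have "(1 / 2) powr (q - 1) = ?c" by (simp add: powr_divide powr_diff)
      finally show ?thesis using pos by simp
    qed simp
    then have "ennreal (h t powr q) \<le> ennreal ?c * ennreal (h t)"
      by (subst ennreal_mult'[symmetric]) (auto intro: ennreal_leI)
    then show ?thesis by (simp add: add_increasing2)
  next
    case True
    define m where "m = nat \<lfloor>q * (1 - h t)\<rfloor>"
    have qh: "0 \<le> q * (1 - h t)" using q h[of t] by simp
    have m: "real m \<le> q * (1 - h t)" "q * (1 - h t) \<le> real m + 1"
      using qh unfolding m_def by linarith+
    have "h t powr q = exp (q * ln (h t))" using True by (simp add: powr_def)
    also have "\<dots> \<le> exp (q * (h t - 1))"
      using True q ln_le_minus_one[of "h t"] by (simp add: mult_left_mono)
    also have "\<dots> \<le> exp (- real m)" using m(1) by (simp add: algebra_simps)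
    finally have "ennreal (h t powr q) \<le> ennreal (exp (- real m))" by (rule ennreal_leI)
    also have "\<dots> = ennreal (exp (- real m)) * indicator (S m) t"
      using True m(2) q by (simp add: S_def field_simps)
    also have "\<dots> \<le> (\<Sum>m. ennreal (exp (- real m)) * indicator (S m) t)"
      by (rule ennreal_le_suminf)
    finally show ?thesis by (simp add: add_increasing)
  qed
  \<comment> \<open>This makes the layer sum geometric with ratio 4/5 and total 5, hence the
    contribution 60 = 12 * 5; the region below 1/2 adds 4 to give 64.\<close>
  have exp_bound: "exp (- real m) * sqrt (real m + 1) \<le> (4 / 5) ^ m" for m :: nat
  proof -
    have e1: "exp (-1::real) \<le> 2 / 5"
      using exp_lower_Taylor_quadratic[of "1::real"] by (simp add: exp_minus field_simps)
    have "exp (- real m) = exp (-1) ^ m" by (simp flip: exp_of_nat_mult)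
    also have "\<dots> \<le> (2 / 5) ^ m" using e1 by (intro power_mono) auto
    finally have a: "exp (- real m) \<le> (2 / 5) ^ m" .
    have "sqrt (real m + 1) \<le> real m + 1"
      by (rule real_le_lsqrt) (auto simp: power2_eq_square)
    also have "\<dots> \<le> 2 ^ m" using of_nat_le_iff[of "Suc m" "2 ^ m", where 'a=real] less_exp[of m] by simp
    finally have "exp (- real m) * sqrt (real m + 1) \<le> (2 / 5) ^ m * 2 ^ m"
      using a by (intro mult_mono) auto
    also have "\<dots> = (4 / 5) ^ m" by (simp flip: power_mult_distrib)
    finally show ?thesis .
  qed
  have lev: "ennreal (exp (- real m)) * emeasure lborel (S m) \<le> ennreal (12 * pi * M / sqrt q) * ennreal ((4 / 5) ^ m)" for m
  proof -
    have "emeasure lborel (S m) \<le> ennreal (12 * pi * M * sqrt ((real m + 1) / q))"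
      unfolding S_def h_def by (rule emeasure_char_level[OF bl]) (use q in auto)
    then have "ennreal (exp (- real m)) * emeasure lborel (S m) \<le> ennreal (exp (- real m)) * ennreal (12 * pi * M * sqrt ((real m + 1) / q))"
      by (intro mult_left_mono) auto
    also have "\<dots> = ennreal (12 * pi * M / sqrt q * (exp (- real m) * sqrt (real m + 1)))"
      by (subst ennreal_mult'[symmetric]) (auto simp: real_sqrt_divide mult_ac)
    also have "\<dots> \<le> ennreal (12 * pi * M / sqrt q * (4 / 5) ^ m)"
      using exp_bound M q by (intro ennreal_leI mult_left_mono) auto
    also have "\<dots> = ennreal (12 * pi * M / sqrt q) * ennreal ((4 / 5) ^ m)"
      using M q by (intro ennreal_mult) auto
    finally show ?thesis .
  qed
  have geo: "(\<Sum>m. ennreal ((4 / 5) ^ m)) = ennreal 5"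
    by (subst suminf_ennreal2) (auto simp: suminf_geometric)
  have "(\<integral>\<^sup>+t. ennreal (cmod (char \<mu> t) powr (2 * q)) \<partial>lborel) \<le>
    (\<integral>\<^sup>+t. ennreal ?c * ennreal (h t) + (\<Sum>m. ennreal (exp (- real m)) * indicator (S m) t) \<partial>lborel)"
    unfolding hq by (intro nn_integral_mono pt)
  also have "\<dots> = ennreal ?c * (\<integral>\<^sup>+t. ennreal (h t) \<partial>lborel) + (\<Sum>m. ennreal (exp (- real m)) * emeasure lborel (S m))"
    by (subst nn_integral_add) (auto simp: nn_integral_cmult nn_integral_suminf)
  also have "\<dots> \<le> ennreal ?c * ennreal (2 * pi * M) + (\<Sum>m. ennreal (12 * pi * M / sqrt q) * ennreal ((4 / 5) ^ m))"
    unfolding h_def by (intro add_mono mult_left_mono plancherel_bound bl suminf_le lev) auto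
  also have "(\<Sum>m. ennreal (12 * pi * M / sqrt q) * ennreal ((4 / 5) ^ m)) = ennreal (12 * pi * M / sqrt q) * ennreal 5"
    by (subst ennreal_suminf_cmult) (simp only: geo)
  also have "ennreal ?c * ennreal (2 * pi * M) + ennreal (12 * pi * M / sqrt q) * ennreal 5
      = ennreal (?c * (2 * pi * M) + 12 * pi * M / sqrt q * 5)"
    using M q by (simp add: ennreal_mult[symmetric] ennreal_plus[symmetric] del: ennreal_plus ennreal_numeral)
  also have "\<dots> \<le> ennreal (64 * pi * M / sqrt q)"
  proof (rule ennreal_leI)
    \<comment> \<open>AM-GM and \<open>2 powr q >= 1 + q * ln 2\<close> give
      \<open>sqrt q <= 2 powr q\<close>, so the exponentially small term is also of order
      \<open>1 / sqrt q\<close>.\<close>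
    have "0 \<le> (sqrt q - 1)\<^sup>2" by simp
    then have "sqrt q \<le> (1 + q) / 2" using q by (simp add: power2_eq_square algebra_simps)
    moreover have "q * (2 / 3) \<le> q * ln 2" using ln2_ge_two_thirds q by (intro mult_left_mono) auto
    moreover have "1 + q * ln 2 \<le> 2 powr q"
      using exp_ge_add_one_self[of "q * ln 2"] by (simp add: powr_def)
    moreover have "(1 + q) / 2 \<le> 1 + q * (2 / 3)" using q by simp
    ultimately have "sqrt q \<le> 2 powr q" by linarith
    then have "?c \<le> 2 / sqrt q" using q by (simp add: powr_diff frac_le)
    then have "?c * (2 * pi * M) \<le> 2 / sqrt q * (2 * pi * M)"
      using M by (intro mult_right_mono) auto
    moreover have "2 / sqrt q * (2 * pi * M) + 12 * pi * M / sqrt q * 5 = 64 * pi * M / sqrt q"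
      by (simp add: add_divide_distrib[symmetric])
    ultimately show "?c * (2 * pi * M) + 12 * pi * M / sqrt q * 5 \<le> 64 * pi * M / sqrt q"
      by linarith
  qed
  finally show ?thesis .
qed

section \<open>Small ball probabilities for independent coordinates\<close>

text \<open>The square root is what the sphere permits by the comparison below; the linear bounds of
  the other two classes are weakened to this common form by \<open>prob_sqrt_bound\<close>.\<close>

definition small_ball :: "nat \<Rightarrow> real \<Rightarrow> (nat \<Rightarrow> real) measure \<Rightarrow> bool" where
  "small_ball n A \<nu> \<longleftrightarrow> (\<forall>u s. (\<Sum>i<n. (u i)\<^sup>2) = 1 \<longrightarrow> 0 < s \<longrightarrow>
     measure \<nu> {x \<in> space \<nu>. \<bar>\<Sum>i<n. u i * x i\<bar> \<le> s} \<le> sqrt (A * s))"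

text \<open>Weighted AM-GM, from the convexity of \<open>exp\<close> at the logarithms. With the
  squared entries of a unit vector as weights it stands in for Hoelder's inequality: all summands
  will integrate to the same bound, so averaging them loses nothing.\<close>

lemma prod_le_weighted_powr_sum:
  fixes a w :: "'i \<Rightarrow> real"
  assumes fin: "finite A" and w: "\<And>i. i \<in> A \<Longrightarrow> 0 < w i" "sum w A = 1"
    and a: "\<And>i. i \<in> A \<Longrightarrow> 0 \<le> a i"
  shows "(\<Prod>i\<in>A. a i) \<le> (\<Sum>i\<in>A. w i * a i powr (1 / w i))"
proof (cases "\<exists>i\<in>A. a i = 0")
  case True
  then have "(\<Prod>i\<in>A. a i) = 0" by (intro prod_zero fin)
  also have "0 \<le> (\<Sum>i\<in>A. w i * a i powr (1 / w i))" using w by (intro sum_nonneg) (auto simp: less_imp_le)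
  finally show ?thesis .
next
  case False
  then have pos: "\<And>i. i \<in> A \<Longrightarrow> 0 < a i" using a by (metis less_eq_real_def)
  have ne: "A \<noteq> {}" using w(2) by auto
  have "(\<Prod>i\<in>A. a i) = exp (\<Sum>i\<in>A. ln (a i))"
    using fin pos by (simp add: exp_sum)
  also have "(\<Sum>i\<in>A. ln (a i)) = (\<Sum>i\<in>A. w i * (ln (a i) / w i))"
    using w by (intro sum.cong) (auto simp: less_imp_neq[symmetric] dest: w(1))
  also have "exp \<dots> \<le> (\<Sum>i\<in>A. w i * exp (ln (a i) / w i))"
    using convex_on_sum[OF fin ne exp_convex w(2), of "\<lambda>i. ln (a i) / w i"] w by (simp add: less_imp_le)
  also have "\<dots> = (\<Sum>i\<in>A. w i * a i powr (1 / w i))"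
    using pos by (intro sum.cong) (auto simp: powr_def dest!: pos)
  finally show ?thesis .
qed

lemma (in prob_space) prob_sqrt_bound:
  assumes "prob A \<le> c"
  shows "prob A \<le> sqrt c"
proof (cases "c \<le> 1")
  case True
  have "0 \<le> c" using assms measure_nonneg[of M A] by linarith
  then have "c\<^sup>2 \<le> c" using True by (simp add: power2_eq_square mult_left_le)
  then have "c \<le> sqrt c" by (rule real_le_rsqrt)
  with assms show ?thesis by linarith
next
  case False
  then have "1 \<le> sqrt c" by simp
  then show ?thesis using prob_le_1[of A] by linarith
qed

section \<open>Laws of the coordinates\<close>

lemma vector_law_measurable_component:
  assumes "vector_law n \<nu>" "i < n"
  shows "(\<lambda>x. x i) \<in> borel_measurable \<nu>"
proof -
  have sets: "sets \<nu> = sets (PiM {..<n} (\<lambda>_. borel))" using assms by (simp add: vector_law_def)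
  show ?thesis unfolding measurable_cong_sets[OF sets refl] using assms(2) by (intro measurable_component_singleton) auto
qed

lemma indep_bounded_laws:
  assumes vl: "vector_law n \<nu>" and ib: "indep_bounded_densities n M \<nu>" and i: "i < n"
  shows "bounded_law M (distr \<nu> borel (\<lambda>x. x i))"
proof -
  interpret prob_space \<nu> using vl by (simp add: vector_law_def)
  have [measurable]: "(\<lambda>x. x i) \<in> borel_measurable \<nu>"
    by (rule vector_law_measurable_component[OF vl i])
  obtain f :: "real \<Rightarrow> real" where f: "\<And>t. 0 \<le> f t" "\<And>t. f t \<le> M"
    and d: "distributed \<nu> lborel (\<lambda>x. x i) (\<lambda>t. ennreal (f t))"
    using ib i unfolding indep_bounded_densities_def by metis
  have eq: "distr \<nu> borel (\<lambda>x. x i) = density lborel (\<lambda>t. ennreal (f t))"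
    using distributed_distr_eq_density[OF d] by (simp cong: distr_cong)
  have m: "(\<lambda>t. ennreal (f t)) \<in> borel_measurable borel"
    using distributed_borel_measurable[OF d] by simp
  have "prob_space (distr \<nu> borel (\<lambda>x. x i))" by (rule prob_space_distr) simp
  then show ?thesis unfolding eq using f m by (intro bounded_lawI_density)
qed

lemma vector_law_space: "vector_law n \<nu> \<Longrightarrow> space \<nu> = {..<n} \<rightarrow>\<^sub>E UNIV"
  unfolding vector_law_def by (auto dest!: sets_eq_imp_space_eq simp: space_PiM)

lemma vector_law_indep_eq_PiM:
  assumes vl: "vector_law n \<nu>" and ib: "indep_bounded_densities n M \<nu>" and n: "0 < n"
  shows "\<nu> = PiM {..<n} (\<lambda>i. distr \<nu> borel (\<lambda>x. x i))"
proof -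
  interpret prob_space \<nu> using vl by (simp add: vector_law_def)
  have sets: "sets (PiM {..<n} (\<lambda>_. borel)) = sets \<nu>" using vl by (simp add: vector_law_def)
  have 1: "distr \<nu> (PiM {..<n} (\<lambda>_. borel)) (\<lambda>x. \<lambda>i\<in>{..<n}. x i) = PiM {..<n} (\<lambda>i. distr \<nu> borel (\<lambda>x. x i))"
  proof (rule iffD1[OF indep_vars_iff_distr_eq_PiM'[of "{..<n}" "\<lambda>i x. x i" "\<lambda>_. borel"]])
    show "indep_vars (\<lambda>_. borel) (\<lambda>i x. x i) {..<n}"
      using ib by (simp only: indep_bounded_densities_def)
    show "i \<in> {..<n} \<Longrightarrow> (\<lambda>x. x i) \<in> borel_measurable \<nu>" for i
      by (rule vector_law_measurable_component[OF vl]) simp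
  qed (use n in auto)
  have 2: "distr \<nu> (PiM {..<n} (\<lambda>_. borel)) (\<lambda>x. \<lambda>i\<in>{..<n}. x i) = distr \<nu> \<nu> (\<lambda>x. x)"
    by (rule distr_cong[OF refl sets]) (auto simp: vector_law_space[OF vl])
  have 3: "distr \<nu> \<nu> (\<lambda>x. x) = \<nu>" by (rule distr_id)
  show ?thesis by (rule trans[OF sym[OF 3] trans[OF sym[OF 2] 1]])
qed

text \<open>If one squared coefficient exceeds 1/2, its exponent in the AM-GM step falls below 2,
  outside the range of \<open>nn_integral_char_powr_le\<close>. Here conditioning suffices: given
  the other coordinates, the event confines this one to an interval of length
  \<open>2 * s / |u i|\<close>, at most \<open>4 * s\<close>.\<close>

lemma small_ball_large_coordinate:
  assumes vl: "vector_law n \<nu>" and ib: "indep_bounded_densities n M \<nu>"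
    and i: "i < n" and u: "1 / 2 < (u i)\<^sup>2" and s: "0 < s"
  shows "measure \<nu> {x \<in> space \<nu>. \<bar>\<Sum>i<n. u i * x i\<bar> \<le> s} \<le> 4 * M * s"
proof -
  interpret N: prob_space \<nu> using vl by (simp add: vector_law_def)
  \<comment> \<open>Extended by a point mass beyond \<open>n\<close>, so that a probability measure
    is attached to every index of \<open>product_prob_space\<close>.\<close>
  define \<mu> where "\<mu> i = (if i < n then distr \<nu> borel (\<lambda>x. x i) else return borel 0)" for i
  have bl: "bounded_law M (\<mu> i)" if "i < n" for i
    using indep_bounded_laws[OF vl ib that] that by (simp add: \<mu>_def)
  have M: "0 \<le> M" using bl[OF i] by (simp add: bounded_law_def)
  have pr: "prob_space (\<mu> j)" for j
    using bl[of j] by (cases "j < n") (auto simp: bounded_law_def real_distribution_def \<mu>_def intro: prob_space_return)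
  have sets_mu [measurable_cong]: "sets (\<mu> j) = sets borel" for j by (simp add: \<mu>_def)
  interpret product_prob_space \<mu> UNIV
    by (intro product_prob_spaceI pr)
  have "PiM {..<n} (\<lambda>i. distr \<nu> borel (\<lambda>x. x i)) = PiM {..<n} \<mu>"
    by (intro PiM_cong) (auto simp: \<mu>_def)
  moreover have "0 < n" using i by simp
  ultimately have "\<nu> = PiM {..<n} \<mu>"
    using vector_law_indep_eq_PiM[OF vl ib] by metis
  define J where "J = {..<n} - {i}"
  have J: "{..<n} = insert i J" "i \<notin> J" "finite J" using i by (auto simp: J_def)
  have eq: "\<nu> = PiM (insert i J) \<mu>" using \<open>\<nu> = PiM {..<n} \<mu>\<close> J(1) by metis
  let ?E = "{x \<in> space \<nu>. \<bar>\<Sum>j<n. u j * x j\<bar> \<le> s}"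
  have meas: "(\<lambda>x. \<Sum>j<n. u j * x j) \<in> borel_measurable (PiM (insert i J) \<mu>)"
    unfolding J(1) by measurable
  have "emeasure \<nu> ?E = (\<integral>\<^sup>+x. indicator ?E x \<partial>\<nu>)"
    by (rule nn_integral_indicator[symmetric]) (use meas in \<open>unfold eq, measurable\<close>)
  also have "\<dots> = (\<integral>\<^sup>+x. indicator {t. \<bar>t\<bar> \<le> s} (\<Sum>j<n. u j * x j) \<partial>\<nu>)"
    by (intro nn_integral_cong) (simp add: indicator_def)
  also have "\<dots> = (\<integral>\<^sup>+x. indicator {t. \<bar>t\<bar> \<le> s} (\<Sum>j<n. u j * x j) \<partial>PiM (insert i J) \<mu>)"
    using eq by metis
  also have "\<dots> = (\<integral>\<^sup>+x. \<integral>\<^sup>+y. indicator {t. \<bar>t\<bar> \<le> s} (\<Sum>j<n. u j * (x(i := y)) j) \<partial>\<mu> i \<partial>PiM J \<mu>)"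
    using meas J by (subst product_nn_integral_insert) auto
  also have "\<dots> \<le> (\<integral>\<^sup>+x. ennreal (4 * M * s) \<partial>PiM J \<mu>)"
  proof (rule nn_integral_mono)
    fix x :: "nat \<Rightarrow> real"
    define R where "R = (\<Sum>j\<in>J. u j * x j)"
    have sum: "(\<Sum>j<n. u j * (x(i := y)) j) = R + u i * y" for y
      using J(2,3) unfolding R_def J(1) by (auto intro!: sum.cong)
    have u0: "u i \<noteq> 0" using u by auto
    have "1 / 2 \<le> \<bar>u i\<bar>"
    proof (rule ccontr)
      assume "\<not> 1 / 2 \<le> \<bar>u i\<bar>"
      then have "\<bar>u i\<bar>\<^sup>2 \<le> (1 / 2)\<^sup>2" by (intro power_mono) auto
      with u show False by (simp add: power2_eq_square)
    qed
    have "(\<integral>\<^sup>+y. indicator {t. \<bar>t\<bar> \<le> s} (\<Sum>j<n. u j * (x(i := y)) j) \<partial>\<mu> i)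
        \<le> ennreal M * (\<integral>\<^sup>+y. indicator {t. \<bar>t\<bar> \<le> s} (R + u i * y) \<partial>lborel)"
      unfolding sum using bl[OF i] by (simp add: bounded_law_def)
    also have "(\<integral>\<^sup>+y. indicator {t. \<bar>t\<bar> \<le> s} (R + u i * y) \<partial>lborel) = ennreal (1 / \<bar>u i\<bar>) * emeasure lborel {- s..s}"
    proof -
      have "(\<integral>\<^sup>+y. indicator {- s..s} y \<partial>lborel) = ennreal \<bar>u i\<bar> * (\<integral>\<^sup>+y. indicator {- s..s} (R + u i * y) \<partial>lborel)"
        by (rule nn_integral_real_affine[OF _ u0]) simp
      moreover have "{- s..s} = {t. \<bar>t\<bar> \<le> s}" by auto
      ultimately show ?thesis using u0
        by (simp add: mult.assoc[symmetric] ennreal_mult'[symmetric] del: emeasure_lborel_Icc_eq)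
    qed
    also have "emeasure lborel {- s..s} = ennreal (2 * s)" using s by simp
    also have "ennreal M * (ennreal (1 / \<bar>u i\<bar>) * ennreal (2 * s)) = ennreal (M * (1 / \<bar>u i\<bar> * (2 * s)))"
      using M s by (simp add: ennreal_mult[symmetric])
    also have "\<dots> \<le> ennreal (4 * M * s)"
    proof (rule ennreal_leI)
      have "1 / \<bar>u i\<bar> \<le> 2" using \<open>1 / 2 \<le> \<bar>u i\<bar>\<close> u0 by (simp add: field_simps)
      then have "M * (1 / \<bar>u i\<bar> * (2 * s)) \<le> M * (2 * (2 * s))"
        using M s by (intro mult_left_mono mult_right_mono) auto
      then show "M * (1 / \<bar>u i\<bar> * (2 * s)) \<le> 4 * M * s" by simp
    qed
    finally show "(\<integral>\<^sup>+y. indicator {t. \<bar>t\<bar> \<le> s} (\<Sum>j<n. u j * (x(i := y)) j) \<partial>\<mu> i) \<le> ennreal (4 * M * s)" .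
  qed
  also have "\<dots> = ennreal (4 * M * s)"
    by (simp add: prob_space.emeasure_space_1[OF prob_space_PiM[OF pr]])
  finally show ?thesis using M s by (simp add: N.emeasure_eq_measure)
qed

text \<open>Ball's argument for sections of the cube. Coordinate \<open>i\<close> receives the
  exponent \<open>1 / w i\<close>; rescaling its integral costs \<open>1 / |u i|\<close>, and the
  decay \<open>1 / sqrt q\<close> returns \<open>sqrt 2 * |u i|\<close>. The cancellation leaves a
  bound free of the dimension and of the direction.\<close>

lemma small_ball_small_coordinates:
  assumes vl: "vector_law n \<nu>" and ib: "indep_bounded_densities n M \<nu>"
    and u: "\<And>i. i < n \<Longrightarrow> (u i)\<^sup>2 \<le> 1 / 2" and u1: "(\<Sum>i<n. (u i)\<^sup>2) = 1" and s: "0 < s"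
  shows "measure \<nu> {x \<in> space \<nu>. \<bar>\<Sum>i<n. u i * x i\<bar> \<le> s} \<le> 300 * M * s"
proof -
  interpret prob_space \<nu> using vl by (simp add: vector_law_def)
  have n: "0 < n" using u1 by (cases n) auto
  define \<mu> where "\<mu> i = distr \<nu> borel (\<lambda>x. x i)" for i
  have bl: "bounded_law M (\<mu> i)" if "i < n" for i
    using indep_bounded_laws[OF vl ib that] by (simp add: \<mu>_def)
  have M: "0 \<le> M" using bl[OF n] by (simp add: bounded_law_def)
  have rd: "real_distribution (\<mu> i)" if "i < n" for i using bl[OF that] by (simp add: bounded_law_def)
  have meas: "i < n \<Longrightarrow> (\<lambda>x. x i) \<in> borel_measurable \<nu>" for i
    by (rule vector_law_measurable_component[OF vl])
  define S where "S x = (\<Sum>i<n. u i * x i)" for x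
  have [measurable]: "S \<in> borel_measurable \<nu>" unfolding S_def using meas by auto
  have rdS: "real_distribution (distr \<nu> borel S)" by (rule real_distribution_distr) simp
  \<comment> \<open>Vanishing coefficients would get the exponent \<open>1 / 0\<close>; their factor
    is the characteristic function at 0, which is 1.\<close>
  define A where "A = {i. i < n \<and> u i \<noteq> 0}"
  have A: "finite A" "A \<subseteq> {..<n}" by (auto simp: A_def)
  define w where "w i = (u i)\<^sup>2" for i
  have wA: "sum w A = 1"
    unfolding u1[symmetric] w_def by (rule sum.mono_neutral_left) (auto simp: A_def)
  have w0: "0 < w i" if "i \<in> A" for i using that by (simp add: A_def w_def)
  have char_scale: "char (distr \<nu> borel (\<lambda>x. u i * x i)) t = char (\<mu> i) (u i * t)" if "i < n" for i t
    unfolding char_def \<mu>_def using meas[OF that] by (subst (1 2) integral_distr) (auto simp: mult_ac)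
  have charS: "cmod (char (distr \<nu> borel S) t) = (\<Prod>i\<in>A. cmod (char (\<mu> i) (u i * t)))" for t
  proof -
    have "indep_vars (\<lambda>_. borel) (\<lambda>i x. u i * x i) {..<n}"
      using ib by (intro indep_vars_compose2[where X="\<lambda>i x. x i" and Y="\<lambda>i y. u i * y"])
        (auto simp: indep_bounded_densities_def)
    then have "char (distr \<nu> borel S) t = (\<Prod>i<n. char (\<mu> i) (u i * t))"
      unfolding S_def by (subst char_distr_sum) (auto simp: char_scale)
    also have "\<dots> = (\<Prod>i\<in>A. char (\<mu> i) (u i * t))"
      using rd by (intro prod.mono_neutral_right) (auto simp: A_def real_distribution.char_zero)
    finally show ?thesis by (simp add: prod_norm)
  qed
  have "(\<integral>\<^sup>+t. ennreal (cmod (char (distr \<nu> borel S) t)) \<partial>lborel)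
      \<le> (\<integral>\<^sup>+t. (\<Sum>i\<in>A. ennreal (w i) * ennreal (cmod (char (\<mu> i) (u i * t)) powr (1 / w i))) \<partial>lborel)"
  proof (rule nn_integral_mono)
    fix t
    have "cmod (char (distr \<nu> borel S) t) \<le> (\<Sum>i\<in>A. w i * cmod (char (\<mu> i) (u i * t)) powr (1 / w i))"
      unfolding charS by (rule prod_le_weighted_powr_sum) (use A wA w0 in auto)
    then have "ennreal (cmod (char (distr \<nu> borel S) t)) \<le> ennreal (\<Sum>i\<in>A. w i * cmod (char (\<mu> i) (u i * t)) powr (1 / w i))"
      by (rule ennreal_leI)
    also have "\<dots> = (\<Sum>i\<in>A. ennreal (w i) * ennreal (cmod (char (\<mu> i) (u i * t)) powr (1 / w i)))"
      using w0 by (subst sum_ennreal[symmetric]) (auto simp: ennreal_mult less_imp_le)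
    finally show "ennreal (cmod (char (distr \<nu> borel S) t)) \<le> \<dots>" .
  qed
  also have "\<dots> = (\<Sum>i\<in>A. ennreal (w i) * (\<integral>\<^sup>+t. ennreal (cmod (char (\<mu> i) (u i * t)) powr (1 / w i)) \<partial>lborel))"
  proof -
    have m: "(\<lambda>t. cmod (char (\<mu> i) (u i * t))) \<in> borel_measurable borel" if "i \<in> A" for i
    proof -
      interpret R: real_distribution "\<mu> i" using rd A that by auto
      show ?thesis by measurable
    qed
    show ?thesis using m by (subst nn_integral_sum) (auto intro!: sum.cong nn_integral_cmult)
  qed
  also have "\<dots> \<le> (\<Sum>i\<in>A. ennreal (w i) * ennreal (64 * pi * M * sqrt 2))"
  proof (intro sum_mono mult_left_mono)
    fix i assume i: "i \<in> A"
    then have ui: "u i \<noteq> 0" and iN: "i < n" by (auto simp: A_def)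
    interpret R: real_distribution "\<mu> i" by (rule rd[OF iN])
    \<comment> \<open>Squared coefficients of at most 1/2 mean exactly
      \<open>q >= 1\<close>.\<close>
    define q where "q = 1 / (2 * w i)"
    have q: "1 \<le> q" using u[OF iN] w0[OF i] by (simp add: q_def w_def field_simps)
    have "(\<integral>\<^sup>+t. ennreal (cmod (char (\<mu> i) t) powr (1 / w i)) \<partial>lborel)
        = ennreal \<bar>u i\<bar> * (\<integral>\<^sup>+t. ennreal (cmod (char (\<mu> i) (0 + u i * t)) powr (1 / w i)) \<partial>lborel)"
      by (rule nn_integral_real_affine[OF _ ui]) simp
    then have "(\<integral>\<^sup>+t. ennreal (cmod (char (\<mu> i) (u i * t)) powr (1 / w i)) \<partial>lborel)
        = ennreal (1 / \<bar>u i\<bar>) * (\<integral>\<^sup>+t. ennreal (cmod (char (\<mu> i) t) powr (2 * q)) \<partial>lborel)"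
      using ui by (simp add: q_def mult.assoc[symmetric] ennreal_mult'[symmetric])
    also have "\<dots> \<le> ennreal (1 / \<bar>u i\<bar>) * ennreal (64 * pi * M / sqrt q)"
      by (intro mult_left_mono nn_integral_char_powr_le bl iN q) simp
    also have "\<dots> = ennreal (64 * pi * M * sqrt 2)"
      using ui by (simp add: ennreal_mult'[symmetric] q_def w_def real_sqrt_divide real_sqrt_mult mult_ac)
    finally show "(\<integral>\<^sup>+t. ennreal (cmod (char (\<mu> i) (u i * t)) powr (1 / w i)) \<partial>lborel) \<le> ennreal (64 * pi * M * sqrt 2)" .
  qed simp
  also have "\<dots> = ennreal (64 * pi * M * sqrt 2)"
    using wA w0 by (simp add: sum_distrib_right[symmetric] sum_ennreal less_imp_le)
  finally have int: "(\<integral>\<^sup>+t. ennreal (cmod (char (distr \<nu> borel S) t)) \<partial>lborel) \<le> ennreal (64 * pi * M * sqrt 2)" .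
  have "emeasure \<nu> {x \<in> space \<nu>. \<bar>S x\<bar> \<le> s} = emeasure (distr \<nu> borel S) {x. \<bar>x\<bar> \<le> s}"
    by (subst emeasure_distr) (auto intro!: arg_cong2[where f=emeasure])
  also have "\<dots> \<le> ennreal s * ennreal (64 * pi * M * sqrt 2)"
    using emeasure_abs_le_char[OF rdS s] int by (meson mult_left_mono order_trans zero_le)
  also have "\<dots> = ennreal (64 * pi * sqrt 2 * (M * s))"
    using s by (simp add: ennreal_mult'[symmetric] mult_ac)
  \<comment> \<open>\<open>64 * pi * sqrt 2\<close> is about 284.3.\<close>
  also have "\<dots> \<le> ennreal (300 * (M * s))"
  proof (intro ennreal_leI mult_right_mono)
    have "pi \<le> 3.1416" using pi_approx by simp
    moreover have "sqrt 2 \<le> 1.4143" by (rule real_le_lsqrt) (auto simp: power2_eq_square)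
    ultimately have "pi * sqrt 2 \<le> 3.1416 * 1.4143" by (intro mult_mono) auto
    then show "64 * pi * sqrt 2 \<le> 300" by simp
  qed (use M s in auto)
  finally show ?thesis using M s unfolding S_def by (simp add: emeasure_eq_measure mult.assoc)
qed

lemma indep_bounded_densities_small_ball_linear:
  assumes "vector_law n \<nu>" "indep_bounded_densities n M \<nu>" and u1: "(\<Sum>i<n. (u i)\<^sup>2) = 1" and s: "0 < s"
  shows "measure \<nu> {x \<in> space \<nu>. \<bar>\<Sum>i<n. u i * x i\<bar> \<le> s} \<le> 300 * M * s"
proof (cases "\<forall>i<n. (u i)\<^sup>2 \<le> 1 / 2")
  case True
  then show ?thesis using small_ball_small_coordinates[OF assms(1,2) _ u1 s] by auto
next
  case False
  then obtain i where i: "i < n" "1 / 2 < (u i)\<^sup>2" by (auto simp: not_le)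
  have "0 \<le> M" using indep_bounded_laws[OF assms(1,2) i(1)] by (simp add: bounded_law_def)
  then have "4 * M * s \<le> 300 * M * s" using s by (intro mult_right_mono) auto
  then show ?thesis using small_ball_large_coordinate[where u=u and i=i, OF assms(1,2) i s] by linarith
qed

lemma indep_bounded_densities_small_ball:
  assumes "vector_law n \<nu>" "indep_bounded_densities n M \<nu>"
  shows "small_ball n (300 * M) \<nu>"
proof -
  interpret prob_space \<nu> using assms by (simp add: vector_law_def)
  show ?thesis
    unfolding small_ball_def using indep_bounded_densities_small_ball_linear[OF assms] prob_sqrt_bound by blast
qed

section \<open>The Prekopa--Leindler inequality for midpoints\<close>

text \<open>Brunn-Minkowski on the line translates one set by the largest point of the other. A
  Borel set may be unbounded or lack a maximum, so points of \<open>A\<close> are used whose lower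
  cuts exhaust its measure.\<close>

lemma ex_exhausting_upper_points:
  fixes A :: "real set"
  assumes ne: "A \<noteq> {}" and [measurable]: "A \<in> sets borel"
  shows "\<exists>k. (\<forall>i. k i \<in> A) \<and> (\<lambda>i::nat. emeasure lborel (A \<inter> {..k i})) \<longlonglongrightarrow> emeasure lborel A"
proof -
  have "\<exists>k. incseq k \<and> (\<forall>i. k i \<in> A) \<and> (\<forall>x\<in>A. \<exists>i::nat. x \<le> k i)"
  proof (cases "\<exists>m\<in>A. \<forall>x\<in>A. x \<le> m")
    case True
    then obtain m where "m \<in> A" "\<forall>x\<in>A. x \<le> m" by auto
    then show ?thesis by (intro exI[of _ "\<lambda>_. m"]) (auto simp: incseq_def)
  next
    case noMax: False
    have "\<exists>q. (\<forall>i::nat. q i \<in> A) \<and> (\<forall>x\<in>A. \<exists>i. x \<le> q i)"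
    proof (cases "bdd_above A")
      case True
      have "\<exists>y\<in>A. Sup A - 1 / real (Suc i) < y" for i
        by (rule less_cSupD[OF ne]) auto
      then obtain q where q: "\<And>i. q i \<in> A" "\<And>i. Sup A - 1 / real (Suc i) < q i" by metis
      have "\<exists>i. x \<le> q i" if "x \<in> A" for x
      proof -
        have "\<exists>y\<in>A. x < y" using noMax that by (auto simp: not_le)
        then obtain y where "y \<in> A" "x < y" by blast
        then have "x < Sup A" using cSup_upper[OF _ True] by (meson order_less_le_trans)
        then obtain i where "inverse (real (Suc i)) < Sup A - x"
          using reals_Archimedean[of "Sup A - x"] by auto
        then show ?thesis using q(2)[of i] by (intro exI[of _ i]) (simp add: inverse_eq_divide)
      qed
      then show ?thesis using q(1) by auto
    next
      case False
      then have "\<exists>y\<in>A. real i < y" for i by (auto simp: bdd_above_def not_le)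
      then obtain q where q: "\<And>i. q i \<in> A" "\<And>i. real i < q i" by metis
      have "\<exists>i. x \<le> q i" for x
        using real_arch_simple[of x] q(2) by (meson less_imp_le order_trans)
      then show ?thesis using q(1) by auto
    qed
    then obtain q where q: "\<And>i::nat. q i \<in> A" "\<And>x. x \<in> A \<Longrightarrow> \<exists>i. x \<le> q i" by blast
    \<comment> \<open>Running maxima stay in \<open>A\<close> and make the cuts increase, as
      continuity from below requires.\<close>
    define k where "k i = Max (q ` {..i})" for i
    have "k i \<in> q ` {..i}" for i unfolding k_def by (rule Max_in) auto
    moreover have "q ` {..i} \<subseteq> A" for i using q(1) by auto
    ultimately have "k i \<in> A" for i by blast
    moreover have "incseq k" unfolding k_def incseq_def by (auto intro!: Max_mono)
    moreover have "q i \<le> k i" for i unfolding k_def by (rule Max_ge) auto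
    ultimately show ?thesis using q(2) by (intro exI[of _ k]) (meson order_trans)
  qed
  then obtain k where k: "incseq k" "\<And>i. k i \<in> A" "\<And>x. x \<in> A \<Longrightarrow> \<exists>i::nat. x \<le> k i" by blast
  have "(\<lambda>i. emeasure lborel (A \<inter> {..k i})) \<longlonglongrightarrow> emeasure lborel (\<Union>i. A \<inter> {..k i})"
    using k(1) by (intro Lim_emeasure_incseq) (auto simp: incseq_def intro: order_trans)
  also have "(\<Union>i. A \<inter> {..k i}) = A" using k(3) by auto
  finally show ?thesis using k(2) by blast
qed

lemma emeasure_lborel_uminus:
  fixes A :: "real set"
  assumes [measurable]: "A \<in> sets borel"
  shows "emeasure lborel {x. - x \<in> A} = emeasure lborel A"
proof -
  have "emeasure lborel A = (\<integral>\<^sup>+x. indicator A (0 + (-1) * x) \<partial>lborel)"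
    using nn_integral_real_affine[of "indicator A" "-1" 0] by simp
  also have "\<dots> = (\<integral>\<^sup>+x. indicator {x. - x \<in> A} x \<partial>lborel)"
    by (intro nn_integral_cong) (simp add: indicator_def)
  also have "\<dots> = emeasure lborel {x. - x \<in> A}" by (rule nn_integral_indicator) measurable
  finally show ?thesis by simp
qed

lemma ex_exhausting_lower_points:
  fixes A :: "real set"
  assumes ne: "A \<noteq> {}" and [measurable]: "A \<in> sets borel"
  shows "\<exists>k. (\<forall>i. k i \<in> A) \<and> (\<lambda>i::nat. emeasure lborel (A \<inter> {k i..})) \<longlonglongrightarrow> emeasure lborel A"
proof -
  let ?B = "{x. - x \<in> A}"
  have B: "?B \<in> sets borel" by measurable
  have "?B \<noteq> {}" using ne by (metis (mono_tags, lifting) Collect_empty_eq equals0I minus_minus)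
  from ex_exhausting_upper_points[OF this B] obtain k where
    k: "\<And>i. k i \<in> ?B" "(\<lambda>i. emeasure lborel (?B \<inter> {..k i})) \<longlonglongrightarrow> emeasure lborel ?B" by blast
  have "emeasure lborel (?B \<inter> {..k i}) = emeasure lborel (A \<inter> {- k i..})" for i
  proof -
    have "?B \<inter> {..k i} = {x. - x \<in> A \<inter> {- k i..}}" by auto
    then show ?thesis by (simp only:) (rule emeasure_lborel_uminus, measurable)
  qed
  then show ?thesis using k emeasure_lborel_uminus[of A] by (intro exI[of _ "\<lambda>i. - k i"]) auto
qed

lemma emeasure_lborel_affine_image:
  fixes A :: "real set"
  assumes [measurable]: "A \<in> sets borel"
  shows "emeasure lborel {x. 2 * x - c \<in> A} = ennreal (1 / 2) * emeasure lborel A"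
proof -
  have "emeasure lborel A = ennreal 2 * (\<integral>\<^sup>+x. indicator A (- c + 2 * x) \<partial>lborel)"
    using nn_integral_real_affine[of "indicator A" 2 "- c"] by simp
  also have "(\<integral>\<^sup>+x. indicator A (- c + 2 * x) \<partial>lborel) = (\<integral>\<^sup>+x. indicator {x. 2 * x - c \<in> A} x \<partial>lborel)"
    by (intro nn_integral_cong) (simp add: indicator_def)
  also have "\<dots> = emeasure lborel {x. 2 * x - c \<in> A}" by (rule nn_integral_indicator) measurable
  finally have eq: "emeasure lborel A = ennreal 2 * emeasure lborel {x. 2 * x - c \<in> A}" .
  show ?thesis unfolding eq by (subst mult.assoc[symmetric], subst ennreal_mult'[symmetric]) auto
qed

text \<open>For points \<open>k\<close> of \<open>A\<close> and \<open>l\<close> of \<open>B\<close>, the set of midpoints contains translates of halved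
  copies of \<open>A \<inter> {..k}\<close> and \<open>B \<inter> {l..}\<close> that meet in at most one point.\<close>

lemma brunn_minkowski_midpoint_real:
  fixes A B C :: "real set"
  assumes A: "A \<noteq> {}" "A \<in> sets borel" and B: "B \<noteq> {}" "B \<in> sets borel" and C: "C \<in> sets borel"
    and mid: "\<And>a b. a \<in> A \<Longrightarrow> b \<in> B \<Longrightarrow> (a + b) / 2 \<in> C"
  shows "ennreal (1 / 2) * (emeasure lborel A + emeasure lborel B) \<le> emeasure lborel C"
proof -
  note [measurable] = A(2) B(2) C
  obtain k where k: "\<And>i. k i \<in> A" "(\<lambda>i::nat. emeasure lborel (A \<inter> {..k i})) \<longlonglongrightarrow> emeasure lborel A"
    using ex_exhausting_upper_points[OF A] by blast
  obtain l where l: "\<And>i. l i \<in> B" "(\<lambda>i::nat. emeasure lborel (B \<inter> {l i..})) \<longlonglongrightarrow> emeasure lborel B"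
    using ex_exhausting_lower_points[OF B] by blast
  have le: "ennreal (1 / 2) * (emeasure lborel (A \<inter> {..k i}) + emeasure lborel (B \<inter> {l i..})) \<le> emeasure lborel C" for i
  proof -
    let ?P = "{x. 2 * x - l i \<in> A \<inter> {..k i}}" and ?Q = "{x. 2 * x - k i \<in> B \<inter> {l i..}}"
    have [measurable]: "?P \<in> sets borel" "?Q \<in> sets borel" by measurable
    have sub: "?P \<union> ?Q \<subseteq> C"
    proof
      fix x assume "x \<in> ?P \<union> ?Q"
      then consider "2 * x - l i \<in> A" | "2 * x - k i \<in> B" by auto
      then show "x \<in> C"
        using mid[of "2 * x - l i" "l i"] mid[of "k i" "2 * x - k i"] k(1) l(1) by cases auto
    qed
    have "?P \<inter> ?Q \<subseteq> {(k i + l i) / 2}" by auto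
    then have "emeasure lborel (?P \<inter> ?Q) \<le> emeasure lborel {(k i + l i) / 2}"
      by (intro emeasure_mono) auto
    then have null: "emeasure lborel (?P \<inter> ?Q) = 0" by simp
    have "ennreal (1 / 2) * (emeasure lborel (A \<inter> {..k i}) + emeasure lborel (B \<inter> {l i..})) = emeasure lborel ?P + emeasure lborel ?Q"
      by (subst (1 2) emeasure_lborel_affine_image) (auto simp: distrib_left)
    also have "\<dots> = emeasure lborel (?P \<union> ?Q) + emeasure lborel (?P \<inter> ?Q)"
      by (rule emeasure_Un_Int) auto
    also have "\<dots> \<le> emeasure lborel C" unfolding null using sub by (auto intro!: emeasure_mono)
    finally show ?thesis .
  qed
  have "(\<lambda>i. ennreal (1 / 2) * (emeasure lborel (A \<inter> {..k i}) + emeasure lborel (B \<inter> {l i..}))) \<longlonglongrightarrow>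
      ennreal (1 / 2) * (emeasure lborel A + emeasure lborel B)"
    using k(2) l(2) by (intro tendsto_mult_ennreal tendsto_add tendsto_const) auto
  then show ?thesis by (rule LIMSEQ_le_const2) (use le in blast)
qed

text \<open>Levels are counted in units of the bound \<open>a\<close>, so that functions with
  different suprema can be compared at the same parameter \<open>t\<close> in (0, 1).\<close>

lemma nn_integral_layer_cake:
  fixes f :: "real \<Rightarrow> ennreal"
  assumes [measurable]: "f \<in> borel_measurable borel" and a: "0 < a" and le: "\<And>x. f x \<le> ennreal a"
  shows "(\<integral>\<^sup>+x. f x \<partial>lborel) = ennreal a * (\<integral>\<^sup>+t. indicator {0<..<1} t * emeasure lborel {x. ennreal (t * a) < f x} \<partial>lborel)"
proof -
  have layer: "f x = ennreal a * (\<integral>\<^sup>+t. indicator {0<..<1} t * indicator {x. ennreal (t * a) < f x} x \<partial>lborel)" for x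
  proof -
    obtain r where r: "f x = ennreal r" "0 \<le> r" using le[of x] by (cases "f x") (auto simp: top_unique)
    have ra: "r \<le> a" using le[of x] r a by (simp add: ennreal_le_iff)
    have "t < 1" if "a * t < r" for t
      using that ra a by (metis mult_less_cancel_left_pos mult.right_neutral order_less_le_trans)
    then have "indicator {0<..<1} t * indicator {x. ennreal (t * a) < f x} x = (indicator {0<..<r/a} t :: ennreal)" for t
      using a ra r by (auto simp: indicator_def ennreal_less_iff field_simps)
    then have "(\<integral>\<^sup>+t. indicator {0<..<1} t * indicator {x. ennreal (t * a) < f x} x \<partial>lborel) = emeasure lborel {0<..<r/a}"
      by simp
    also have "\<dots> = ennreal (r / a)" using r a by simp
    finally show ?thesis using r a by (simp add: ennreal_mult'[symmetric])
  qed
  have "(\<integral>\<^sup>+x. f x \<partial>lborel) = (\<integral>\<^sup>+x. ennreal a * (\<integral>\<^sup>+t. indicator {0<..<1} t * indicator {x. ennreal (t * a) < f x} x \<partial>lborel) \<partial>lborel)"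
    by (intro nn_integral_cong) (rule layer)
  also have "\<dots> = ennreal a * (\<integral>\<^sup>+x. \<integral>\<^sup>+t. indicator {0<..<1} t * indicator {x. ennreal (t * a) < f x} x \<partial>lborel \<partial>lborel)"
    by (rule nn_integral_cmult) measurable
  also have "(\<integral>\<^sup>+x. \<integral>\<^sup>+t. indicator {0<..<1} t * indicator {x. ennreal (t * a) < f x} x \<partial>lborel \<partial>lborel)
      = (\<integral>\<^sup>+t. \<integral>\<^sup>+x. indicator {0<..<1} t * indicator {x. ennreal (t * a) < f x} x \<partial>lborel \<partial>lborel)"
    by (rule lborel_pair.Fubini') measurable
  also have "\<dots> = (\<integral>\<^sup>+t. indicator {0<..<1} t * emeasure lborel {x. ennreal (t * a) < f x} \<partial>lborel)"
    by (intro nn_integral_cong) (simp add: nn_integral_cmult)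
  finally show ?thesis .
qed

section \<open>The functional inequality, on the line and in products\<close>

lemma ennreal_four_mult_le_square: "4 * (x * y) \<le> (x + y)\<^sup>2" for x y :: ennreal
proof (cases "x = \<top> \<or> y = \<top>")
  case True
  then have "(x + y)\<^sup>2 = \<top>" by (auto simp: power2_eq_square)
  then show ?thesis by simp
next
  case False
  then obtain a b where ab: "x = ennreal a" "y = ennreal b" "0 \<le> a" "0 \<le> b"
    by (metis ennreal_cases infinity_ennreal_def)
  have "4 * (a * b) \<le> (a + b)\<^sup>2" using sum_squares_ge_zero[of "a - b" 0] by (simp add: power2_eq_square algebra_simps)
  then have "ennreal (4 * (a * b)) \<le> ennreal ((a + b)\<^sup>2)" by (rule ennreal_leI)
  then show ?thesis using ab by (simp add: ennreal_mult ennreal_power flip: ennreal_plus)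
qed

text \<open>With \<open>a\<close> and \<open>b\<close> the exact suprema, both level sets are
  nonempty for \<open>t < 1\<close>, as Brunn-Minkowski requires, and their midpoints lie in the
  level set of \<open>H\<close> at \<open>t * sqrt (a * b)\<close>. Integration over
  \<open>t\<close> bounds the arithmetic mean of the normalized integrals; AM-GM passes to their
  product.\<close>

lemma prekopa_leindler_real_bounded:
  fixes F G H :: "real \<Rightarrow> ennreal"
  assumes [measurable]: "F \<in> borel_measurable borel" "G \<in> borel_measurable borel" "H \<in> borel_measurable borel"
    and le: "\<And>x y. F x * G y \<le> (H ((x + y) / 2))\<^sup>2"
    and bdd: "\<And>x. F x \<le> ennreal c" "\<And>x. G x \<le> ennreal c"
  shows "(\<integral>\<^sup>+x. F x \<partial>lborel) * (\<integral>\<^sup>+x. G x \<partial>lborel) \<le> (\<integral>\<^sup>+x. H x \<partial>lborel)\<^sup>2"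
proof -
  define a where "a = enn2real (SUP x. F x)"
  define b where "b = enn2real (SUP x. G x)"
  have Sa: "(SUP x. F x) = ennreal a"
    unfolding a_def using bdd(1) by (intro ennreal_enn2real[symmetric]) (metis SUP_least ennreal_less_top le_less_trans)
  have Sb: "(SUP x. G x) = ennreal b"
    unfolding b_def using bdd(2) by (intro ennreal_enn2real[symmetric]) (metis SUP_least ennreal_less_top le_less_trans)
  have a0: "0 \<le> a" and b0: "0 \<le> b" by (auto simp: a_def b_def)
  have Fa: "F x \<le> ennreal a" for x unfolding Sa[symmetric] by (rule SUP_upper) simp
  have Gb: "G x \<le> ennreal b" for x unfolding Sb[symmetric] by (rule SUP_upper) simp
  show ?thesis
  proof (cases "a = 0 \<or> b = 0")
    case True
    then have "(\<forall>x. F x = 0) \<or> (\<forall>x. G x = 0)" using Fa Gb by auto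
    then show ?thesis by auto
  next
    case False
    then have a: "0 < a" and b: "0 < b" using a0 b0 by auto
    define s where "s = sqrt (a * b)"
    have s: "0 < s" "s\<^sup>2 = a * b" using a b by (auto simp: s_def)
    \<comment> \<open>Cutting \<open>H\<close> at \<open>s\<close> makes the layer-cake formula
      applicable with the same range of \<open>t\<close>; the midpoints survive because their levels
      \<open>t * s\<close> stay below \<open>s\<close>.\<close>
    define H' where "H' x = min (H x) (ennreal s)" for x
    have [measurable]: "H' \<in> borel_measurable borel" unfolding H'_def by measurable
    have H's: "H' x \<le> ennreal s" for x by (simp add: H'_def)
    let ?A = "\<lambda>t. {x. ennreal (t * a) < F x}" and ?B = "\<lambda>t. {x. ennreal (t * b) < G x}"
      and ?C = "\<lambda>t. {x. ennreal (t * s) < H' x}"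
    have lev: "ennreal (1 / 2) * (emeasure lborel (?A t) + emeasure lborel (?B t)) \<le> emeasure lborel (?C t)"
      if t: "0 < t" "t < 1" for t
    proof (rule brunn_minkowski_midpoint_real)
      have "ennreal (t * a) < (SUP x. F x)" unfolding Sa using t a by (simp add: ennreal_less_iff)
      then show "?A t \<noteq> {}" by (auto simp: less_SUP_iff)
      have "ennreal (t * b) < (SUP x. G x)" unfolding Sb using t b by (simp add: ennreal_less_iff)
      then show "?B t \<noteq> {}" by (auto simp: less_SUP_iff)
      show "?A t \<in> sets borel" "?B t \<in> sets borel" "?C t \<in> sets borel" by measurable
      fix x y assume xy: "x \<in> ?A t" "y \<in> ?B t"
      have "ennreal ((t * s)\<^sup>2) = ennreal (t * a) * ennreal (t * b)"
        using t a b s by (subst ennreal_mult[symmetric]) (auto simp: power_mult_distrib power2_eq_square mult_ac)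
      also have "\<dots> < F x * ennreal (t * b)" using xy t b by (intro ennreal_mult_strict_right_mono) auto
      also have "\<dots> \<le> F x * G y" using xy by (intro mult_left_mono) auto
      also have "\<dots> \<le> (H ((x + y) / 2))\<^sup>2" by (rule le)
      finally have "ennreal (t * s) ^ 2 < (H ((x + y) / 2))\<^sup>2" using t s by (simp add: ennreal_power)
      then have "ennreal (t * s) < H ((x + y) / 2)" by (meson not_le power_mono zero_le)
      moreover have "ennreal (t * s) < ennreal s" using t s by (simp add: ennreal_less_iff)
      ultimately show "(x + y) / 2 \<in> ?C t" by (simp add: H'_def)
    qed
    define IA where "IA = (\<integral>\<^sup>+t. indicator {0<..<1} t * emeasure lborel (?A t) \<partial>lborel)"
    define IB where "IB = (\<integral>\<^sup>+t. indicator {0<..<1} t * emeasure lborel (?B t) \<partial>lborel)"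
    define IC where "IC = (\<integral>\<^sup>+t. indicator {0<..<1} t * emeasure lborel (?C t) \<partial>lborel)"
    have mA: "(\<lambda>t. emeasure lborel {x. ennreal (t * e) < f x}) \<in> borel_measurable borel"
      if [measurable]: "f \<in> borel_measurable borel" for f :: "real \<Rightarrow> ennreal" and e :: real
    proof -
      have "(\<lambda>t. emeasure lborel (Pair t -` {p \<in> space (borel \<Otimes>\<^sub>M lborel). ennreal (fst p * e) < f (snd p)})) \<in> borel_measurable borel"
        by (rule lborel.measurable_emeasure_Pair) measurable
      then show ?thesis by (simp add: space_pair_measure vimage_def)
    qed
    have "ennreal (1 / 2) * (IA + IB) = (\<integral>\<^sup>+t. indicator {0<..<1} t * (ennreal (1 / 2) * (emeasure lborel (?A t) + emeasure lborel (?B t))) \<partial>lborel)"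
      unfolding IA_def IB_def using mA
      by (subst nn_integral_add[symmetric]) (auto simp: nn_integral_cmult[symmetric] algebra_simps intro!: nn_integral_cong)
    also have "\<dots> \<le> IC"
      unfolding IC_def using lev by (intro nn_integral_mono) (auto simp: indicator_def)
    finally have "ennreal (1 / 2) * (IA + IB) \<le> IC" .
    then have "(ennreal (1 / 2) * (IA + IB))\<^sup>2 \<le> IC\<^sup>2" by (rule power_mono) simp
    moreover have "(ennreal (1 / 2) * (IA + IB))\<^sup>2 = ennreal (1 / 4) * (IA + IB)\<^sup>2"
      unfolding power_mult_distrib by (subst ennreal_power) (auto simp: power2_eq_square)
    moreover have "ennreal (1 / 4) * (4 * (IA * IB)) \<le> ennreal (1 / 4) * (IA + IB)\<^sup>2"
      by (intro mult_left_mono ennreal_four_mult_le_square) simp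
    moreover have "ennreal (1 / 4) * (4 * (IA * IB)) = IA * IB"
    proof -
      have "ennreal (1 / 4) * 4 = ennreal (1 / 4 * 4)" by (subst ennreal_mult') auto
      then show ?thesis by (simp add: mult.assoc[symmetric])
    qed
    ultimately have main: "IA * IB \<le> IC\<^sup>2" by (metis order_trans)
    have "(\<integral>\<^sup>+x. F x \<partial>lborel) * (\<integral>\<^sup>+x. G x \<partial>lborel) = (ennreal a * IA) * (ennreal b * IB)"
      unfolding IA_def IB_def
      by (subst nn_integral_layer_cake[OF _ a Fa], simp, subst nn_integral_layer_cake[OF _ b Gb], simp_all)
    also have "\<dots> = ennreal (s\<^sup>2) * (IA * IB)" using a b s by (simp add: ennreal_mult mult_ac)
    also have "\<dots> \<le> ennreal (s\<^sup>2) * IC\<^sup>2" by (intro mult_left_mono main) simp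
    also have "\<dots> = (ennreal s * IC)\<^sup>2" using s by (simp add: power_mult_distrib ennreal_power)
    also have "ennreal s * IC = (\<integral>\<^sup>+x. H' x \<partial>lborel)"
      unfolding IC_def by (rule nn_integral_layer_cake[OF _ s(1) H's, symmetric]) measurable
    also have "(\<integral>\<^sup>+x. H' x \<partial>lborel) \<le> (\<integral>\<^sup>+x. H x \<partial>lborel)"
      by (intro nn_integral_mono) (simp add: H'_def)
    finally show ?thesis by (simp add: power_mono)
  qed
qed

text \<open>Truncation at \<open>n\<close> reduces to the bounded case, and monotone convergence
  returns the original integrals.\<close>

lemma prekopa_leindler_real:
  fixes F G H :: "real \<Rightarrow> ennreal"
  assumes [measurable]: "F \<in> borel_measurable borel" "G \<in> borel_measurable borel" "H \<in> borel_measurable borel"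
    and le: "\<And>x y. F x * G y \<le> (H ((x + y) / 2))\<^sup>2"
  shows "(\<integral>\<^sup>+x. F x \<partial>lborel) * (\<integral>\<^sup>+x. G x \<partial>lborel) \<le> (\<integral>\<^sup>+x. H x \<partial>lborel)\<^sup>2"
proof -
  have lim: "(\<lambda>n. \<integral>\<^sup>+x. min (f x) (of_nat n) \<partial>lborel) \<longlonglongrightarrow> (\<integral>\<^sup>+x. f x \<partial>lborel)"
    if [measurable]: "f \<in> borel_measurable borel" for f :: "real \<Rightarrow> ennreal"
  proof (rule nn_integral_LIMSEQ)
    show "incseq (\<lambda>n x. min (f x) (of_nat n))"
      by (auto simp: incseq_def le_fun_def intro: min.coboundedI2)
    fix x
    have "(SUP n. min (f x) (of_nat n)) = f x"
    proof -
      have "(SUP n. min (f x) (of_nat n)) = min (f x) (SUP n. of_nat n)"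
        unfolding inf_min[symmetric] by (rule inf_SUP[symmetric])
      then show ?thesis by (simp add: ennreal_SUP_of_nat_eq_top)
    qed
    moreover have "(\<lambda>n. min (f x) (of_nat n)) \<longlonglongrightarrow> (SUP n. min (f x) (of_nat n))"
      by (rule LIMSEQ_SUP) (auto simp: incseq_def intro: min.coboundedI2)
    ultimately show "(\<lambda>n. min (f x) (of_nat n)) \<longlonglongrightarrow> f x" by simp
  qed measurable
  have "(\<integral>\<^sup>+x. min (F x) (of_nat n) \<partial>lborel) * (\<integral>\<^sup>+x. min (G x) (of_nat m) \<partial>lborel) \<le> (\<integral>\<^sup>+x. H x \<partial>lborel)\<^sup>2" for n m
  proof (rule prekopa_leindler_real_bounded[where c="real (max n m)"])
    show "min (F x) (of_nat n) * min (G y) (of_nat m) \<le> (H ((x + y) / 2))\<^sup>2" for x y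
      using le[of x y] by (meson min.cobounded1 mult_mono order_trans zero_le)
    show "min (F x) (of_nat n) \<le> ennreal (real (max n m))" for x
      by (rule order_trans[OF min.cobounded2]) (simp add: ennreal_of_nat_eq_real_of_nat ennreal_leI)
    show "min (G x) (of_nat m) \<le> ennreal (real (max n m))" for x
      by (rule order_trans[OF min.cobounded2]) (simp add: ennreal_of_nat_eq_real_of_nat ennreal_leI)
  qed measurable
  note b = this
  show ?thesis
  \<comment> \<open>Multiplication is discontinuous at zero times infinity, so a vanishing integral
    is treated apart; the left side is then 0.\<close>
  proof (cases "(\<integral>\<^sup>+x. F x \<partial>lborel) = 0 \<or> (\<integral>\<^sup>+x. G x \<partial>lborel) = 0")
    case False
    have "(\<lambda>n. (\<integral>\<^sup>+x. min (F x) (of_nat n) \<partial>lborel) * (\<integral>\<^sup>+x. min (G x) (of_nat n) \<partial>lborel)) \<longlonglongrightarrow>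
        (\<integral>\<^sup>+x. F x \<partial>lborel) * (\<integral>\<^sup>+x. G x \<partial>lborel)"
      using False by (intro tendsto_mult_ennreal lim) auto
    then show ?thesis by (rule LIMSEQ_le_const2) (use b in blast)
  qed auto
qed

text \<open>Tensorization: with coordinate \<open>i\<close> fixed at \<open>a\<close>,
  \<open>b\<close> and their midpoint, the induction hypothesis says that the inner integrals
  satisfy the assumption of the inequality on the line.\<close>

lemma prekopa_leindler_PiM:
  fixes F G H :: "('i \<Rightarrow> real) \<Rightarrow> ennreal"
  assumes "finite I"
    and "F \<in> borel_measurable (PiM I (\<lambda>_. lborel))" "G \<in> borel_measurable (PiM I (\<lambda>_. lborel))"
      "H \<in> borel_measurable (PiM I (\<lambda>_. lborel))"
    and "\<And>x y. x \<in> I \<rightarrow>\<^sub>E UNIV \<Longrightarrow> y \<in> I \<rightarrow>\<^sub>E UNIV \<Longrightarrow> F x * G y \<le> (H (\<lambda>i\<in>I. (x i + y i) / 2))\<^sup>2"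
  shows "(\<integral>\<^sup>+x. F x \<partial>PiM I (\<lambda>_. lborel)) * (\<integral>\<^sup>+x. G x \<partial>PiM I (\<lambda>_. lborel))
    \<le> (\<integral>\<^sup>+x. H x \<partial>PiM I (\<lambda>_. lborel))\<^sup>2"
  using assms
proof (induction I arbitrary: F G H rule: finite_induct)
  case empty
  interpret product_sigma_finite "\<lambda>_. lborel :: real measure" ..
  show ?case using empty(4)[of "\<lambda>_. undefined" "\<lambda>_. undefined"]
    by (simp add: nn_integral_empty PiE_def restrict_def)
next
  case (insert i I)
  interpret product_sigma_finite "\<lambda>_. lborel :: real measure" ..
  interpret I: finite_product_sigma_finite "\<lambda>_. lborel :: real measure" I by standard fact
  note [measurable] = insert.prems(1-3)
  let ?L = "PiM I (\<lambda>_. lborel :: real measure)"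
  have split: "(\<integral>\<^sup>+x. f x \<partial>PiM (insert i I) (\<lambda>_. lborel)) = (\<integral>\<^sup>+y. \<integral>\<^sup>+x. f (x(i := y)) \<partial>?L \<partial>lborel)"
    if "f \<in> borel_measurable (PiM (insert i I) (\<lambda>_. lborel))" for f
    using that insert.hyps by (subst product_nn_integral_insert_rev) auto
  have meas: "(\<lambda>x. f (x(i := y))) \<in> borel_measurable ?L"
    if [measurable]: "f \<in> borel_measurable (PiM (insert i I) (\<lambda>_. lborel))" for f and y :: real
    by measurable
  have meas2: "(\<lambda>y. \<integral>\<^sup>+x. f (x(i := y)) \<partial>?L) \<in> borel_measurable borel"
    if [measurable]: "f \<in> borel_measurable (PiM (insert i I) (\<lambda>_. lborel))" for f
  proof -
    have "(\<lambda>(y, x). f (x(i := y))) \<in> borel_measurable (borel \<Otimes>\<^sub>M ?L)" by measurable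
    then show ?thesis by (rule I.borel_measurable_nn_integral)
  qed
  show ?case
    unfolding split[OF insert.prems(1)] split[OF insert.prems(2)] split[OF insert.prems(3)]
  proof (intro prekopa_leindler_real meas2 insert.prems(1-3))
    fix a b :: real
    show "(\<integral>\<^sup>+x. F (x(i := a)) \<partial>?L) * (\<integral>\<^sup>+x. G (x(i := b)) \<partial>?L) \<le> (\<integral>\<^sup>+x. H (x(i := (a + b) / 2)) \<partial>?L)\<^sup>2"
    proof (rule insert.IH)
      fix x y :: "'i \<Rightarrow> real" assume xy: "x \<in> I \<rightarrow>\<^sub>E UNIV" "y \<in> I \<rightarrow>\<^sub>E UNIV"
      have "F (x(i := a)) * G (y(i := b)) \<le> (H (\<lambda>j\<in>insert i I. ((x(i := a)) j + (y(i := b)) j) / 2))\<^sup>2"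
        using xy by (intro insert.prems(4)) (auto simp: PiE_def extensional_def)
      also have "(\<lambda>j\<in>insert i I. ((x(i := a)) j + (y(i := b)) j) / 2) = (\<lambda>j\<in>I. (x j + y j) / 2)(i := (a + b) / 2)"
        using insert.hyps by (auto simp: fun_eq_iff restrict_def)
      finally show "F (x(i := a)) * G (y(i := b)) \<le> (H ((\<lambda>j\<in>I. (x j + y j) / 2)(i := (a + b) / 2)))\<^sup>2" .
    qed (intro meas insert.prems(1-3))+
  qed
qed

section \<open>Log-concave vectors\<close>

text \<open>Midpoints of points from two half-spaces lie in the midpoint half-space, so the density
  times these indicators fits Prekopa-Leindler. The tail of each linear functional is therefore
  log-concave at midpoints, and the question becomes one-dimensional.\<close>

lemma log_concave_tail:
  fixes u :: "nat \<Rightarrow> real"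
  assumes vl: "vector_law n \<nu>" and lc: "log_concave n \<nu>"
  defines "T \<equiv> \<lambda>a. measure \<nu> {x \<in> space \<nu>. a \<le> (\<Sum>i<n. u i * x i)}"
  shows "T a * T b \<le> (T ((a + b) / 2))\<^sup>2"
proof -
  interpret N: prob_space \<nu> using vl by (simp add: vector_law_def)
  let ?L = "PiM {..<n} (\<lambda>_. lborel :: real measure)"
  define S where "S x = (\<Sum>i<n. u i * x i)" for x :: "nat \<Rightarrow> real"
  obtain f :: "(nat \<Rightarrow> real) \<Rightarrow> real" where f [measurable]: "f \<in> borel_measurable ?L" and f0: "\<And>x. 0 \<le> f x"
    and conc: "\<And>x y t. x \<in> {..<n} \<rightarrow>\<^sub>E UNIV \<Longrightarrow> y \<in> {..<n} \<rightarrow>\<^sub>E UNIV \<Longrightarrow> t \<in> {0<..<1} \<Longrightarrow>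
         f x powr (1 - t) * f y powr t \<le> f (\<lambda>i\<in>{..<n}. (1 - t) * x i + t * y i)"
    and \<nu>: "\<nu> = density ?L (\<lambda>x. ennreal (f x))"
    using lc unfolding log_concave_def by blast
  have [measurable]: "S \<in> borel_measurable ?L" unfolding S_def by measurable
  define F where "F a x = ennreal (f x) * indicator {x \<in> space ?L. a \<le> S x} x" for a x
  have [measurable]: "F a \<in> borel_measurable ?L" for a unfolding F_def by measurable
  have T: "ennreal (T a) = (\<integral>\<^sup>+x. F a x \<partial>?L)" for a
  proof -
    have sp: "space \<nu> = space ?L" by (simp add: \<nu>)
    have "ennreal (T a) = emeasure \<nu> {x \<in> space ?L. a \<le> S x}"
      by (simp add: T_def S_def N.emeasure_eq_measure sp)
    also have "\<dots> = (\<integral>\<^sup>+x. F a x \<partial>?L)"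
      unfolding \<nu> F_def by (subst emeasure_density) auto
    finally show ?thesis .
  qed
  have "(\<integral>\<^sup>+x. F a x \<partial>?L) * (\<integral>\<^sup>+x. F b x \<partial>?L) \<le> (\<integral>\<^sup>+x. F ((a + b) / 2) x \<partial>?L)\<^sup>2"
  proof (rule prekopa_leindler_PiM)
    fix x y :: "nat \<Rightarrow> real" assume xy: "x \<in> {..<n} \<rightarrow>\<^sub>E UNIV" "y \<in> {..<n} \<rightarrow>\<^sub>E UNIV"
    let ?m = "\<lambda>i\<in>{..<n}. (x i + y i) / 2"
    show "F a x * F b y \<le> (F ((a + b) / 2) ?m)\<^sup>2"
    proof (cases "a \<le> S x \<and> b \<le> S y")
      case True
      have "S ?m = (\<Sum>i<n. (u i * x i + u i * y i) / 2)"
        unfolding S_def by (intro sum.cong refl) (simp add: distrib_left)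
      also have "\<dots> = (S x + S y) / 2"
        by (simp add: S_def sum.distrib sum_divide_distrib[symmetric])
      finally have Sm: "(a + b) / 2 \<le> S ?m" using True by simp
      have m: "?m \<in> space ?L" by (auto simp: space_PiM)
      have "(\<lambda>i\<in>{..<n}. (1 - 1 / 2) * x i + 1 / 2 * y i) = ?m" by (auto simp: fun_eq_iff)
      then have "f x powr (1 / 2) * f y powr (1 / 2) \<le> f ?m"
        using conc[OF xy, of "1 / 2"] by simp
      then have "sqrt (f x) * sqrt (f y) \<le> f ?m" using f0 by (simp add: powr_half_sqrt)
      then have "(sqrt (f x) * sqrt (f y))\<^sup>2 \<le> (f ?m)\<^sup>2" using f0 by (intro power_mono) auto
      then have "f x * f y \<le> (f ?m)\<^sup>2" using f0 by (simp add: power_mult_distrib)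
      then have "ennreal (f x) * ennreal (f y) \<le> (ennreal (f ?m))\<^sup>2"
        using f0 by (simp add: ennreal_mult[symmetric] ennreal_power ennreal_leI)
      then show ?thesis using True xy Sm m by (simp add: F_def space_PiM)
    qed (auto simp: F_def)
  qed auto
  then have "ennreal (T a) * ennreal (T b) \<le> (ennreal (T ((a + b) / 2)))\<^sup>2" by (simp only: T)
  then show ?thesis by (simp add: T_def ennreal_mult[symmetric] ennreal_power ennreal_le_iff)
qed

text \<open>A log-concave tail that falls by the factor 16 between 0 and 1/2 keeps falling:
  \<open>T (2 * x) * T 0 <= (T x)^2\<close> doubles the distance and squares the factor. The
  positive part then has so small a second moment that two such parts cannot add up to 1.\<close>

lemma log_concave_upper_second_moment:
  fixes S :: "'a \<Rightarrow> real"
  assumes "prob_space M" and [measurable]: "S \<in> borel_measurable M"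
  defines "T \<equiv> \<lambda>a. measure M {x \<in> space M. a \<le> S x}"
  assumes T: "\<And>a b. T a * T b \<le> (T ((a + b) / 2))\<^sup>2" and drop: "T (1 / 2) \<le> T 0 / 16"
  shows "(\<integral>\<^sup>+x. ennreal ((max 0 (S x))\<^sup>2) \<partial>M) \<le> ennreal (1 / 3)"
proof -
  interpret prob_space M by fact
  have T0: "0 \<le> T a" "T a \<le> 1" for a by (auto simp: T_def)
  have Tmono: "T b \<le> T a" if "a \<le> b" for a b
    unfolding T_def using that by (intro finite_measure_mono) auto
  have step: "T (2 ^ i / 2) \<le> T 0 * (1 / 16) ^ (2 ^ i)" for i :: nat
  proof (cases "T 0 = 0")
    case True
    then have "T (2 ^ i / 2) \<le> 0" using Tmono[of 0 "2 ^ i / 2"] by simp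
    then show ?thesis using True by simp
  next
    case False
    then have pos: "0 < T 0" using T0(1)[of 0] by linarith
    show ?thesis
    proof (induction i)
      case 0
      then show ?case using drop by simp
    next
      case (Suc i)
      have "T (2 ^ Suc i / 2) * T 0 \<le> (T (2 ^ i / 2))\<^sup>2" using T[of "2 ^ Suc i / 2" 0] by simp
      also have "\<dots> \<le> (T 0 * (1 / 16) ^ (2 ^ i))\<^sup>2" by (intro power_mono Suc T0)
      also have "\<dots> = T 0 * (1 / 16) ^ (2 ^ Suc i) * T 0"
        by (simp add: power2_eq_square power_add mult_2)
      finally show ?case using pos by (simp only: mult_le_cancel_right_pos)
    qed
  qed
  \<comment> \<open>A linear exponent is enough: the sum over \<open>i\<close> of
    \<open>4^i * (1 / 16)^(i + 1)\<close> is 1/12, and values below 1/2 contribute at most 1/4,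
    together 1/3.\<close>
  have step': "T (2 ^ i / 2) \<le> (1 / 16) ^ (i + 1)" for i :: nat
  proof -
    have "T (2 ^ i / 2) \<le> 1 * (1 / 16) ^ (2 ^ i)"
      using step[of i] T0(2)[of 0] by (meson mult_right_mono order_trans zero_le_divide_1_iff zero_le_numeral zero_le_power)
    also have "\<dots> \<le> (1 / 16) ^ (i + 1)"
      unfolding mult_1 by (rule power_decreasing) (use Suc_leI[OF less_exp[of i]] in auto)
    finally show ?thesis .
  qed
  let ?E = "\<lambda>i::nat. {x \<in> space M. 2 ^ i / 2 \<le> S x}"
  have pt: "ennreal ((max 0 (S x))\<^sup>2) \<le> ennreal (1 / 4) + (\<Sum>i. ennreal (4 ^ i) * indicator (?E i) x)" if x: "x \<in> space M" for x
  proof (cases "S x < 1 / 2")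
    case True
    then have "(max 0 (S x))\<^sup>2 \<le> (1 / 2)\<^sup>2" by (intro power_mono) auto
    then have "ennreal ((max 0 (S x))\<^sup>2) \<le> ennreal (1 / 4)" by (intro ennreal_leI) (simp add: power2_eq_square)
    then show ?thesis by (simp add: add_increasing2)
  next
    case False
    obtain j :: nat where "S x < 2 ^ j" using real_arch_pow[of 2 "S x"] by auto
    define i where "i = (LEAST i::nat. S x < 2 ^ i)"
    have i: "S x < 2 ^ i" unfolding i_def using \<open>S x < 2 ^ j\<close> by (rule LeastI)
    have i2: "2 ^ i / 2 \<le> S x"
    proof (cases i)
      case 0 then show ?thesis using False by simp
    next
      case (Suc k)
      then have "\<not> S x < 2 ^ k" using not_less_Least[of k "\<lambda>i. S x < 2 ^ i"] by (simp add: i_def)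
      then show ?thesis using Suc by simp
    qed
    have "(max 0 (S x))\<^sup>2 \<le> (2 ^ i)\<^sup>2" using i False by (intro power_mono) auto
    also have "(2 ^ i)\<^sup>2 = (4::real) ^ i" by (simp add: power2_eq_square power_mult_distrib[symmetric])
    finally have "ennreal ((max 0 (S x))\<^sup>2) \<le> ennreal (4 ^ i) * indicator (?E i) x"
      using i2 x by (simp add: ennreal_leI)
    also have "\<dots> \<le> (\<Sum>i. ennreal (4 ^ i) * indicator (?E i) x)"
      by (rule ennreal_le_suminf)
    finally show ?thesis by (simp add: add_increasing)
  qed
  have "(\<integral>\<^sup>+x. ennreal ((max 0 (S x))\<^sup>2) \<partial>M) \<le> (\<integral>\<^sup>+x. ennreal (1 / 4) + (\<Sum>i. ennreal (4 ^ i) * indicator (?E i) x) \<partial>M)"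
    by (intro nn_integral_mono pt)
  also have "\<dots> = ennreal (1 / 4) + (\<Sum>i. ennreal (4 ^ i) * emeasure M (?E i))"
    by (subst nn_integral_add) (auto simp: nn_integral_suminf nn_integral_cmult emeasure_space_1)
  also have "(\<Sum>i. ennreal (4 ^ i) * emeasure M (?E i)) \<le> (\<Sum>i. ennreal (1 / 16 * (1 / 4) ^ i))"
  proof (intro suminf_le)
    fix i :: nat
    have "ennreal (4 ^ i) * emeasure M (?E i) = ennreal (4 ^ i * T (2 ^ i / 2))"
      by (simp add: T_def emeasure_eq_measure ennreal_mult)
    also have "\<dots> \<le> ennreal (4 ^ i * (1 / 16) ^ (i + 1))"
      by (intro ennreal_leI mult_left_mono step') simp
    also have "4 ^ i * (1 / 16) ^ (i + 1) = 1 / 16 * (4 * (1 / 16 :: real)) ^ i"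
      unfolding power_mult_distrib by simp
    finally show "ennreal (4 ^ i) * emeasure M (?E i) \<le> ennreal (1 / 16 * (1 / 4) ^ i)" by simp
  qed auto
  also have "(\<Sum>i. ennreal (1 / 16 * (1 / 4) ^ i)) = ennreal (1 / 12)"
    by (subst suminf_ennreal2, simp, intro summable_mult summable_geometric, simp, subst suminf_mult)
       (auto simp: suminf_geometric)
  also have "ennreal (1 / 4) + ennreal (1 / 12) = ennreal (1 / 3)"
    by (subst ennreal_plus[symmetric]) auto
  finally show ?thesis by simp
qed

text \<open>The complementary case: if the tail has not dropped much at 1/2, log-concavity bounds
  its logarithmic slope around 0, and an interval of length \<open>2 * s\<close> carries mass of
  order \<open>s\<close>.\<close>

lemma log_concave_small_ball_aux:
  fixes S :: "'a \<Rightarrow> real"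
  assumes "prob_space M" and [measurable]: "S \<in> borel_measurable M"
  defines "T \<equiv> \<lambda>a. measure M {x \<in> space M. a \<le> S x}"
  assumes T: "\<And>a b. T a * T b \<le> (T ((a + b) / 2))\<^sup>2" and drop: "T 0 / 16 < T (1 / 2)" and s: "0 < s"
  shows "measure M {x \<in> space M. \<bar>S x\<bar> \<le> s} \<le> 240 * s"
proof (cases "s \<le> 1 / 4")
  case False
  interpret prob_space M by fact
  show ?thesis using False prob_le_1[of "{x \<in> space M. \<bar>S x\<bar> \<le> s}"] by linarith
next
  case True
  interpret prob_space M by fact
  have T0: "0 \<le> T a" "T a \<le> 1" for a by (auto simp: T_def)
  have Tmono: "T b \<le> T a" if "a \<le> b" for a b
    unfolding T_def using that by (intro finite_measure_mono) auto
  have pos: "0 < T 0" using T0(1)[of 0] drop Tmono[of 0 "1 / 2"] by linarith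
  \<comment> \<open>The start 15 = 16 - 1 restates \<open>T 0 < 16 * T (1 / 2)\<close>. Each halving
    of the point takes a square root of the factor, and \<open>1 + c <= (1 + c / 2)^2\<close> halves
    the excess.\<close>
  define c :: "nat \<Rightarrow> real" where "c i = 15 / 2 ^ i" for i
  define x :: "nat \<Rightarrow> real" where "x i = (1 / 2) ^ Suc i" for i
  have c0: "0 \<le> c i" for i by (simp add: c_def)
  have cx: "T 0 \<le> T (x i) * (1 + c i)" for i
  proof (induction i)
    case 0
    then show ?case using drop by (simp add: c_def x_def)
  next
    case (Suc i)
    have "(T 0)\<^sup>2 \<le> T 0 * (T (x i) * (1 + c i))"
      unfolding power2_eq_square by (rule mult_left_mono[OF Suc T0(1)])
    also have "\<dots> = (T (x i) * T 0) * (1 + c i)" by simp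
    also have "\<dots> \<le> (T (x (Suc i)))\<^sup>2 * (1 + c i)"
    proof (rule mult_right_mono)
      have "(x i + 0) / 2 = x (Suc i)" by (simp add: x_def)
      then show "T (x i) * T 0 \<le> (T (x (Suc i)))\<^sup>2" using T[of "x i" 0] by (simp only:)
      show "0 \<le> 1 + c i" using c0[of i] by linarith
    qed
    also have "\<dots> \<le> (T (x (Suc i)))\<^sup>2 * (1 + c (Suc i))\<^sup>2"
    proof (intro mult_left_mono)
      have "1 + c i = 1 + 2 * c (Suc i)" by (simp add: c_def)
      then show "1 + c i \<le> (1 + c (Suc i))\<^sup>2" by (simp add: power2_eq_square algebra_simps)
    qed simp
    finally have "(T 0)\<^sup>2 \<le> (T (x (Suc i)) * (1 + c (Suc i)))\<^sup>2" by (simp add: power_mult_distrib)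
    moreover have "0 \<le> T (x (Suc i)) * (1 + c (Suc i))"
      using T0(1)[of "x (Suc i)"] c0[of "Suc i"] by (intro mult_nonneg_nonneg) linarith+
    ultimately show ?case by (rule power2_le_imp_le)
  qed
  \<comment> \<open>\<open>T (x i) * T (- x i) <= (T 0)^2\<close> transfers the estimate from the
    right of 0 to the left.\<close>
  have diff: "T (- x i) - T (x i) \<le> 2 * c i" for i
  proof -
    have "T (x i) \<noteq> 0" using cx[of i] pos by auto
    then have p: "0 < T (x i)" using T0(1)[of "x i"] by linarith
    have "T (x i) * T (- x i) \<le> T 0 * T 0" using T[of "x i" "- x i"] by (simp add: power2_eq_square)
    also have "\<dots> \<le> T 0 * (T (x i) * (1 + c i))" by (rule mult_left_mono[OF cx T0(1)])
    also have "\<dots> = T (x i) * (T 0 * (1 + c i))" by simp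
    finally have 1: "T (- x i) \<le> T 0 * (1 + c i)" using p by (simp only: mult_le_cancel_left_pos)
    have "T 0 - T (x i) \<le> T (x i) * c i" using cx[of i] by (simp add: algebra_simps)
    also have "\<dots> \<le> 1 * c i" by (rule mult_right_mono[OF T0(2) c0])
    finally have 2: "T 0 - T (x i) \<le> c i" by simp
    have "T 0 * c i \<le> 1 * c i" by (rule mult_right_mono[OF T0(2) c0])
    then show ?thesis using 1 2 by (simp add: algebra_simps)
  qed
  obtain j :: nat where "(1 / 2) ^ j < 2 * s" using real_arch_pow_inv[of "2 * s" "1 / 2"] s by auto
  \<comment> \<open>The aim is a dyadic point \<open>x i\<close> between \<open>2 * s\<close> and
    \<open>4 * s\<close>; \<open>s <= 1 / 4\<close> forces \<open>k >= 2\<close>. Then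
    \<open>2 * c i = 60 * x i <= 240 * s\<close>.\<close>
  define k where "k = (LEAST k::nat. (1 / 2) ^ k < 2 * s)"
  have k: "(1 / 2) ^ k < 2 * s" unfolding k_def using \<open>(1 / 2) ^ j < 2 * s\<close> by (rule LeastI)
  have "k \<noteq> 0"
  proof
    assume "k = 0"
    with k True show False by simp
  qed
  moreover have "k \<noteq> 1"
  proof
    assume "k = 1"
    with k True show False by simp
  qed
  ultimately obtain i where i: "k = Suc (Suc i)" by (cases k; cases "k - 1") auto
  have "\<not> (1 / 2) ^ Suc i < 2 * s" using not_less_Least[of "Suc i" "\<lambda>k. (1 / 2) ^ k < 2 * s"] i unfolding k_def by auto
  then have x1: "2 * s \<le> x i" by (simp add: x_def)
  have x2: "x i \<le> 4 * s" using k i by (simp add: x_def)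
  have "measure M {y \<in> space M. \<bar>S y\<bar> \<le> s} \<le> measure M ({y \<in> space M. - x i \<le> S y} - {y \<in> space M. x i \<le> S y})"
    using x1 s by (intro finite_measure_mono) auto
  also have "\<dots> = T (- x i) - T (x i)"
    unfolding T_def using x1 s by (intro finite_measure_Diff) auto
  also have "\<dots> \<le> 2 * c i" by (rule diff)
  also have "\<dots> = 60 * x i" unfolding c_def x_def by (simp add: power_one_over)
  finally show ?thesis using x2 by linarith
qed

text \<open>If the bound failed, the auxiliary lemma would force a drop by the factor 16 on both
  sides of 0, leaving a second moment of at most 2/3 instead of 1.\<close>

lemma log_concave_small_ball_real:
  fixes S :: "'a \<Rightarrow> real"
  assumes "prob_space M" and [measurable]: "S \<in> borel_measurable M"
    and up: "\<And>a b. measure M {x \<in> space M. a \<le> S x} * measure M {x \<in> space M. b \<le> S x}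
      \<le> (measure M {x \<in> space M. (a + b) / 2 \<le> S x})\<^sup>2"
    and low: "\<And>a b. measure M {x \<in> space M. a \<le> - S x} * measure M {x \<in> space M. b \<le> - S x}
      \<le> (measure M {x \<in> space M. (a + b) / 2 \<le> - S x})\<^sup>2"
    and sq: "(\<integral>\<^sup>+x. ennreal ((S x)\<^sup>2) \<partial>M) = 1" and s: "0 < s"
  shows "measure M {x \<in> space M. \<bar>S x\<bar> \<le> s} \<le> 240 * s"
proof (rule ccontr)
  assume neg: "\<not> ?thesis"
  have 1: "measure M {x \<in> space M. 1 / 2 \<le> S x} \<le> measure M {x \<in> space M. 0 \<le> S x} / 16"
    using log_concave_small_ball_aux[OF assms(1,2) up _ s] neg by force
  have 2: "measure M {x \<in> space M. 1 / 2 \<le> - S x} \<le> measure M {x \<in> space M. 0 \<le> - S x} / 16"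
    using log_concave_small_ball_aux[OF assms(1) _ low _ s] neg by force
  have "(\<integral>\<^sup>+x. ennreal ((S x)\<^sup>2) \<partial>M) = (\<integral>\<^sup>+x. ennreal ((max 0 (S x))\<^sup>2) + ennreal ((max 0 (- S x))\<^sup>2) \<partial>M)"
    by (intro nn_integral_cong) (auto simp: max_def)
  also have "\<dots> = (\<integral>\<^sup>+x. ennreal ((max 0 (S x))\<^sup>2) \<partial>M) + (\<integral>\<^sup>+x. ennreal ((max 0 (- S x))\<^sup>2) \<partial>M)"
    by (rule nn_integral_add) measurable
  also have "\<dots> \<le> ennreal (1 / 3) + ennreal (1 / 3)"
    by (intro add_mono log_concave_upper_second_moment assms(1) up low 1 2) measurable
  also have "\<dots> = ennreal (2 / 3)" by (subst ennreal_plus[symmetric]) auto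
  finally show False unfolding sq by (simp add: ennreal_1[symmetric] ennreal_le_iff del: ennreal_1)
qed

lemma isotropic_linear_nn_integral:
  assumes vl: "vector_law n \<nu>" and iso: "isotropic n \<nu>"
  shows "(\<integral>\<^sup>+x. ennreal ((\<Sum>i<n. u i * x i)\<^sup>2) \<partial>\<nu>) = ennreal (\<Sum>i<n. (u i)\<^sup>2)"
proof -
  have int: "integrable \<nu> (\<lambda>x. x i * x j)" and val: "(LINT x|\<nu>. x i * x j) = (if i = j then 1 else 0)"
    if "i < n" "j < n" for i j using iso that by (auto simp: isotropic_def)
  have eq: "(\<lambda>x :: nat \<Rightarrow> real. (\<Sum>i<n. u i * x i)\<^sup>2) = (\<lambda>x. \<Sum>i<n. \<Sum>j<n. u i * u j * (x i * x j))"
    by (simp add: power2_eq_square sum_product mult_ac)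
  have int2: "integrable \<nu> (\<lambda>x. (\<Sum>i<n. u i * x i)\<^sup>2)"
    unfolding eq using int by (intro Bochner_Integration.integrable_sum integrable_mult_right) auto
  have "(LINT x|\<nu>. (\<Sum>i<n. u i * x i)\<^sup>2) = (\<Sum>i<n. \<Sum>j<n. u i * u j * (LINT x|\<nu>. x i * x j))"
    unfolding eq using int by (subst Bochner_Integration.integral_sum) (auto intro!: sum.cong)
  also have "\<dots> = (\<Sum>i<n. \<Sum>j<n. u i * u j * (if i = j then 1 else 0))"
    using val by (intro sum.cong refl) auto
  also have "\<dots> = (\<Sum>i<n. (u i)\<^sup>2)"
    by (intro sum.cong refl) (simp add: power2_eq_square if_distrib cong: if_cong)
  finally show ?thesis using nn_integral_eq_integral[OF int2] by simp
qed

lemma log_concave_small_ball: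
  assumes vl: "vector_law n \<nu>" and iso: "isotropic n \<nu>" and lc: "log_concave n \<nu>"
  shows "small_ball n 240 \<nu>"
  unfolding small_ball_def
proof (intro allI impI)
  fix u :: "nat \<Rightarrow> real" and s :: real
  assume u1: "(\<Sum>i<n. (u i)\<^sup>2) = 1" and s: "0 < s"
  interpret N: prob_space \<nu> using vl by (simp add: vector_law_def)
  have [measurable]: "i < n \<Longrightarrow> (\<lambda>x. x i) \<in> borel_measurable \<nu>" for i
    by (rule vector_law_measurable_component[OF vl])
  have neg: "- (\<Sum>i<n. u i * x i) = (\<Sum>i<n. (- u i) * x i)" for x :: "nat \<Rightarrow> real"
    by (simp add: sum_negf)
  have "measure \<nu> {x \<in> space \<nu>. \<bar>\<Sum>i<n. u i * x i\<bar> \<le> s} \<le> 240 * s"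
  proof (rule log_concave_small_ball_real[OF N.prob_space_axioms])
    show "(\<integral>\<^sup>+x. ennreal ((\<Sum>i<n. u i * x i)\<^sup>2) \<partial>\<nu>) = 1"
      using isotropic_linear_nn_integral[OF vl iso, of u] u1 by simp
    show "measure \<nu> {x \<in> space \<nu>. a \<le> - (\<Sum>i<n. u i * x i)} * measure \<nu> {x \<in> space \<nu>. b \<le> - (\<Sum>i<n. u i * x i)}
      \<le> (measure \<nu> {x \<in> space \<nu>. (a + b) / 2 \<le> - (\<Sum>i<n. u i * x i)})\<^sup>2" for a b
      unfolding neg by (rule log_concave_tail[OF vl lc])
  qed (measurable, rule log_concave_tail[OF vl lc], rule s)
  then show "measure \<nu> {x \<in> space \<nu>. \<bar>\<Sum>i<n. u i * x i\<bar> \<le> s} \<le> sqrt (240 * s)"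
    by (rule N.prob_sqrt_bound)
qed

section \<open>The uniform distribution on the sphere\<close>

lemma uniform_on_sphere_vector_law: "uniform_on_sphere n \<nu> \<Longrightarrow> vector_law n \<nu>"
  by (simp add: uniform_on_sphere_def)

lemma uniform_on_sphere_norm:
  assumes "uniform_on_sphere n \<nu>"
  shows "AE x in \<nu>. (\<Sum>i<n. (x i)\<^sup>2) = real n"
proof -
  have "sq_norm2 (vec n x) = (\<Sum>i<n. (x i)\<^sup>2)" for x :: "nat \<Rightarrow> real"
    by (simp add: sq_norm2_def scalar_prod_def power2_eq_square atLeast0LessThan)
  then show ?thesis using assms by (simp add: uniform_on_sphere_def)
qed

text \<open>The Householder reflection exchanging \<open>u\<close> and \<open>v\<close> turns one functional into the other.\<close>

lemma uniform_on_sphere_linear_law: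
  assumes us: "uniform_on_sphere n \<nu>" and uv: "(\<Sum>i<n. (u i)\<^sup>2) = (\<Sum>i<n. (v i)\<^sup>2)"
    and [measurable]: "g \<in> borel_measurable borel"
  shows "(\<integral>\<^sup>+x. g (\<Sum>i<n. u i * x i) \<partial>\<nu>) = (\<integral>\<^sup>+x. g (\<Sum>i<n. v i * x i) \<partial>\<nu>)"
proof (cases "\<forall>i<n. u i = v i")
  case True
  then show ?thesis by simp
next
  case False
  have vl: "vector_law n \<nu>" by (rule uniform_on_sphere_vector_law[OF us])
  then have sets: "sets \<nu> = sets (PiM {..<n} (\<lambda>_. borel))" by (simp add: vector_law_def)
  have comp [measurable]: "i < n \<Longrightarrow> (\<lambda>x. x i) \<in> borel_measurable \<nu>" for i
    by (rule vector_law_measurable_component[OF vl])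
  define w where "w i = u i - v i" for i
  define W where "W = (\<Sum>i<n. (w i)\<^sup>2)"
  have W0: "W \<noteq> 0" unfolding W_def using False by (subst sum_nonneg_eq_0_iff) (auto simp: w_def)
  \<comment> \<open>The equal lengths of \<open>u\<close> and \<open>v\<close> enter here: they make
    the reflection along \<open>u - v\<close> exchange the two.\<close>
  have vw: "2 * (\<Sum>i<n. v i * w i) = - W"
  proof -
    have "W + 2 * (\<Sum>i<n. v i * w i) = (\<Sum>i<n. (u i)\<^sup>2 - (v i)\<^sup>2)"
      unfolding W_def sum_distrib_left sum.distrib[symmetric]
      by (intro sum.cong) (auto simp: w_def power2_eq_square algebra_simps)
    then show ?thesis using uv by (simp add: sum_subtractf)
  qed
  define Q where "Q = mat n n (\<lambda>(i, j). (if i = j then 1 else 0) - 2 / W * (w i * w j))"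
  have Q: "Q \<in> carrier_mat n n" by (simp add: Q_def)
  have orth: "Q\<^sup>T * Q = 1\<^sub>m n"
  proof (rule eq_matI)
    fix i j assume ij: "i < dim_row (1\<^sub>m n)" "j < dim_col (1\<^sub>m n)"
    then have "(Q\<^sup>T * Q) $$ (i, j) = (\<Sum>k<n. Q $$ (k, i) * Q $$ (k, j))"
      using Q by (simp add: scalar_prod_def atLeast0LessThan)
    also have "\<dots> = (\<Sum>k<n. (if k = i then (if k = j then 1 else 0) else 0) - (if k = i then 2 / W * (w k * w j) else 0)
        - (if k = j then 2 / W * (w k * w i) else 0) + (2 / W)\<^sup>2 * (w i * w j) * (w k)\<^sup>2)"
      using ij by (intro sum.cong refl) (simp add: Q_def power2_eq_square algebra_simps)
    also have "\<dots> = (if i = j then 1 else 0) - 2 / W * (w i * w j) - 2 / W * (w j * w i) + (2 / W)\<^sup>2 * (w i * w j) * W"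
      using ij by (simp add: sum.distrib sum_subtractf W_def sum_distrib_left[symmetric])
    also have "\<dots> = (if i = j then 1 else 0)"
      using W0 by (simp add: power2_eq_square field_simps)
    finally show "(Q\<^sup>T * Q) $$ (i, j) = 1\<^sub>m n $$ (i, j)" using ij by simp
  qed (use Q in auto)
  define T where "T x = (\<lambda>i\<in>{..<n}. (Q *\<^sub>v vec n x) $ i)" for x
  have T: "T x i = x i - 2 / W * w i * (\<Sum>j<n. w j * x j)" if "i < n" for x i
  proof -
    have "T x i = (\<Sum>j<n. Q $$ (i, j) * x j)"
      using that Q by (simp add: T_def scalar_prod_def atLeast0LessThan)
    also have "\<dots> = (\<Sum>j<n. (if i = j then x j else 0) - 2 / W * w i * (w j * x j))"
      using that by (intro sum.cong refl) (simp add: Q_def algebra_simps)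
    finally show ?thesis using that by (simp add: sum_subtractf sum_distrib_left)
  qed
  have inv: "distr \<nu> \<nu> T = \<nu>"
    using us Q orth unfolding uniform_on_sphere_def T_def by blast
  have mT: "T \<in> measurable \<nu> \<nu>"
  proof -
    have "T \<in> measurable \<nu> (PiM {..<n} (\<lambda>_. borel))"
      unfolding T_def
    proof (rule measurable_restrict)
      fix i assume i: "i \<in> {..<n}"
      have "(\<lambda>x. \<Sum>j<n. w j * x j) \<in> borel_measurable \<nu>" by measurable
      moreover have "(\<lambda>x. x i) \<in> borel_measurable \<nu>" using i comp by simp
      ultimately have "(\<lambda>x. x i - 2 / W * w i * (\<Sum>j<n. w j * x j)) \<in> borel_measurable \<nu>"
        by (intro borel_measurable_diff borel_measurable_times borel_measurable_const)
      moreover have "(\<lambda>x. (Q *\<^sub>v vec n x) $ i) = (\<lambda>x. x i - 2 / W * w i * (\<Sum>j<n. w j * x j))"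
        using T i by (auto simp: T_def)
      ultimately show "(\<lambda>x. (Q *\<^sub>v vec n x) $ i) \<in> borel_measurable \<nu>" by simp
    qed
    then show ?thesis using measurable_cong_sets[OF refl sets] by blast
  qed
  have vT: "(\<Sum>i<n. v i * T x i) = (\<Sum>i<n. u i * x i)" for x
  proof -
    have "(\<Sum>i<n. v i * T x i) = (\<Sum>i<n. v i * x i - 2 / W * (\<Sum>j<n. w j * x j) * (v i * w i))"
      by (intro sum.cong refl) (simp add: T algebra_simps)
    also have "\<dots> = (\<Sum>i<n. v i * x i) - 1 / W * (\<Sum>j<n. w j * x j) * (2 * (\<Sum>i<n. v i * w i))"
      by (simp add: sum_subtractf sum_distrib_left mult_ac)
    also have "\<dots> = (\<Sum>i<n. v i * x i) + (\<Sum>j<n. w j * x j)" unfolding vw using W0 by simp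
    also have "\<dots> = (\<Sum>i<n. u i * x i)" by (simp add: sum.distrib[symmetric] w_def algebra_simps)
    finally show ?thesis .
  qed
  have "(\<integral>\<^sup>+x. g (\<Sum>i<n. v i * x i) \<partial>\<nu>) = (\<integral>\<^sup>+x. g (\<Sum>i<n. v i * x i) \<partial>distr \<nu> \<nu> T)"
    by (simp only: inv)
  also have "\<dots> = (\<integral>\<^sup>+x. g (\<Sum>i<n. v i * T x i) \<partial>\<nu>)"
    by (rule nn_integral_distr[OF mT]) measurable
  finally show ?thesis by (simp only: vT)
qed

text \<open>By rotation invariance a functional has the second moment of its length times any one
  coordinate. Summing over the \<open>n\<close> coordinates gives the squared norm, which is
  \<open>n\<close>.\<close>

lemma uniform_on_sphere_second_moment:
  assumes us: "uniform_on_sphere n \<nu>"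
  shows "(\<integral>\<^sup>+x. ennreal ((\<Sum>i<n. u i * x i)\<^sup>2) \<partial>\<nu>) = ennreal (\<Sum>i<n. (u i)\<^sup>2)"
proof (cases "n = 0")
  case True
  then show ?thesis by simp
next
  case False
  have vl: "vector_law n \<nu>" by (rule uniform_on_sphere_vector_law[OF us])
  interpret N: prob_space \<nu> using vl by (simp add: vector_law_def)
  have comp [measurable]: "i < n \<Longrightarrow> (\<lambda>x. x i) \<in> borel_measurable \<nu>" for i
    by (rule vector_law_measurable_component[OF vl])
  define R where "R = (\<Sum>i<n. (u i)\<^sup>2)"
  have R0: "0 \<le> R" unfolding R_def by (intro sum_nonneg) auto
  define X where "X = (\<integral>\<^sup>+x. ennreal ((\<Sum>i<n. u i * x i)\<^sup>2) \<partial>\<nu>)"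
  have X: "X = (\<integral>\<^sup>+x. ennreal (R * (x k)\<^sup>2) \<partial>\<nu>)" if k: "k < n" for k
  proof -
    have "X = (\<integral>\<^sup>+x. ennreal ((\<Sum>i<n. (if i = k then sqrt R else 0) * x i)\<^sup>2) \<partial>\<nu>)"
      unfolding X_def
      by (rule uniform_on_sphere_linear_law[OF us, where g="\<lambda>y. ennreal (y\<^sup>2)"])
         (use k R0 in \<open>auto simp: R_def[symmetric] if_distrib[where f="\<lambda>x. x\<^sup>2"] cong: if_cong\<close>)
    also have "(\<lambda>x :: nat \<Rightarrow> real. (\<Sum>i<n. (if i = k then sqrt R else 0) * x i)\<^sup>2) = (\<lambda>x. R * (x k)\<^sup>2)"
      using k R0 by (simp add: if_distrib[where f="\<lambda>a. a * _"] power_mult_distrib cong: if_cong)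
    finally show ?thesis .
  qed
  have "of_nat n * X = (\<Sum>k<n. \<integral>\<^sup>+x. ennreal (R * (x k)\<^sup>2) \<partial>\<nu>)"
    by (subst sum.cong[OF refl X[symmetric]]) auto
  also have "\<dots> = (\<integral>\<^sup>+x. (\<Sum>k<n. ennreal (R * (x k)\<^sup>2)) \<partial>\<nu>)"
    by (rule nn_integral_sum[symmetric]) simp
  also have "\<dots> = (\<integral>\<^sup>+x. ennreal (R * real n) \<partial>\<nu>)"
    using uniform_on_sphere_norm[OF us]
    by (intro nn_integral_cong_AE) (auto simp: sum_ennreal R0 sum_distrib_left[symmetric])
  also have "\<dots> = of_nat n * ennreal R"
    using R0 by (simp add: N.emeasure_space_1 ennreal_mult ennreal_of_nat_eq_real_of_nat mult.commute)
  finally have "of_nat n * X = of_nat n * ennreal R" .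
  then show ?thesis using False
    by (simp add: X_def R_def ennreal_mult_cancel_left)
qed

text \<open>Polarization of the second moments in two coordinate directions and their sum;
  integrability comes from the boundedness of the sphere.\<close>

lemma uniform_on_sphere_isotropic:
  assumes us: "uniform_on_sphere n \<nu>"
  shows "isotropic n \<nu>"
  unfolding isotropic_def
proof (intro allI impI)
  fix i j assume ij: "i < n" "j < n"
  have vl: "vector_law n \<nu>" by (rule uniform_on_sphere_vector_law[OF us])
  interpret N: prob_space \<nu> using vl by (simp add: vector_law_def)
  have comp [measurable]: "i < n \<Longrightarrow> (\<lambda>x. x i) \<in> borel_measurable \<nu>" for i
    by (rule vector_law_measurable_component[OF vl])
  have le: "\<bar>x i * x j\<bar> \<le> real n" if "(\<Sum>i<n. (x i)\<^sup>2) = real n" "i < n" "j < n" for x :: "nat \<Rightarrow> real" and i j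
  proof -
    have "(x k)\<^sup>2 \<le> real n" if "k < n" for k
      using member_le_sum[of k "{..<n}" "\<lambda>i. (x i)\<^sup>2"] that \<open>(\<Sum>i<n. (x i)\<^sup>2) = real n\<close> by auto
    then have a: "\<bar>x k\<bar> \<le> sqrt (real n)" if "k < n" for k
      using that by (intro real_le_rsqrt) simp
    have "\<bar>x i\<bar> * \<bar>x j\<bar> \<le> sqrt (real n) * sqrt (real n)"
      by (intro mult_mono a that) auto
    then show ?thesis by (simp add: abs_mult)
  qed
  have int: "integrable \<nu> (\<lambda>x. x i * x j)" if "i < n" "j < n" for i j
    using uniform_on_sphere_norm[OF us] that
    by (intro N.integrable_const_bound[where B="real n"]) (auto intro: le)
  have sq: "(LINT x|\<nu>. (a * x i + b * x j)\<^sup>2) = (\<Sum>k<n. ((if k = i then a else 0) + (if k = j then b else 0))\<^sup>2)" for a b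
  proof -
    have eq: "(\<lambda>x :: nat \<Rightarrow> real. a * x i + b * x j) = (\<lambda>x. \<Sum>k<n. ((if k = i then a else 0) + (if k = j then b else 0)) * x k)"
      using ij by (simp add: distrib_right sum.distrib if_distrib[where f="\<lambda>a. a * _"] cong: if_cong)
    have i1: "integrable \<nu> (\<lambda>x. a\<^sup>2 * (x i * x i) + 2 * a * b * (x i * x j) + b\<^sup>2 * (x j * x j))"
      using ij by (intro Bochner_Integration.integrable_add integrable_mult_right int)
    have "integrable \<nu> (\<lambda>x. (a * x i + b * x j)\<^sup>2)"
      by (rule Bochner_Integration.integrable_cong[THEN iffD1, OF refl _ i1]) (simp add: power2_eq_square algebra_simps)
    then have "ennreal (LINT x|\<nu>. (a * x i + b * x j)\<^sup>2) = (\<integral>\<^sup>+x. ennreal ((a * x i + b * x j)\<^sup>2) \<partial>\<nu>)"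
      by (subst nn_integral_eq_integral) auto
    also have "\<dots> = ennreal (\<Sum>k<n. ((if k = i then a else 0) + (if k = j then b else 0))\<^sup>2)"
      using uniform_on_sphere_second_moment[OF us] by (simp only: fun_cong[OF eq])
    finally show ?thesis by (subst (asm) ennreal_inj) (auto intro!: sum_nonneg integral_nonneg_AE)
  qed
  show "integrable \<nu> (\<lambda>x. x i * x j) \<and> (LINT x|\<nu>. x i * x j) = (if i = j then 1 else 0)"
  proof (intro conjI int ij)
    have sq1: "(LINT x|\<nu>. (x i)\<^sup>2) = 1"
      using sq[of 1 0] ij by (simp add: if_distrib[where f="\<lambda>x. x\<^sup>2"] cong: if_cong)
    show "(LINT x|\<nu>. x i * x j) = (if i = j then 1 else 0)"
    proof (cases "i = j")
      case True
      then show ?thesis using sq1 by (simp add: power2_eq_square)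
    next
      case False
      have sq2: "(LINT x|\<nu>. (x j)\<^sup>2) = 1"
        using sq[of 0 1] ij by (simp add: if_distrib[where f="\<lambda>x. x\<^sup>2"] cong: if_cong)
      have "(LINT x|\<nu>. (x i + x j)\<^sup>2) = (\<Sum>k<n. (if k = i then 1 else 0) + (if k = j then 1 else 0))"
      proof -
        have "(LINT x|\<nu>. (x i + x j)\<^sup>2) = (\<Sum>k<n. ((if k = i then 1 else 0) + (if k = j then 1 else 0))\<^sup>2)"
          using sq[of 1 1] by (simp only: mult_1)
        also have "\<dots> = (\<Sum>k<n. (if k = i then 1 else 0) + (if k = j then 1 else 0))"
          by (intro sum.cong refl) (use False in auto)
        finally show ?thesis .
      qed
      also have "\<dots> = 2" using ij by (simp add: sum.distrib)
      finally have "(LINT x|\<nu>. (x i)\<^sup>2 + (x j)\<^sup>2 + 2 * (x i * x j)) = 2"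
        by (simp add: power2_eq_square algebra_simps)
      moreover have "(LINT x|\<nu>. (x i)\<^sup>2 + (x j)\<^sup>2 + 2 * (x i * x j)) = 1 + 1 + 2 * (LINT x|\<nu>. x i * x j)"
        using int ij sq1 sq2 by (simp add: power2_eq_square)
      ultimately show ?thesis using False by simp
    qed
  qed
qed

section \<open>The standard Gaussian vector and the comparison with it\<close>

definition std_gaussian :: "nat \<Rightarrow> (nat \<Rightarrow> real) measure" where
  "std_gaussian n = PiM {..<n} (\<lambda>_. std_normal_distribution)"

lemma std_gaussian_component:
  assumes "i < n"
  shows "distr (std_gaussian n) borel (\<lambda>x. x i) = std_normal_distribution"
proof -
  have "distr (std_gaussian n) std_normal_distribution (\<lambda>x. x i) = std_normal_distribution"
    unfolding std_gaussian_def by (rule distr_PiM_component) (use assms in \<open>auto intro: prob_space_normal_density\<close>)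
  moreover have "distr (std_gaussian n) std_normal_distribution (\<lambda>x. x i) = distr (std_gaussian n) borel (\<lambda>x. x i)"
    by (rule distr_cong) auto
  ultimately show ?thesis by simp
qed

lemma std_gaussian_vector_law: "vector_law n (std_gaussian n)"
  unfolding vector_law_def std_gaussian_def
  by (auto intro!: prob_space_PiM prob_space_normal_density sets_PiM_cong)

text \<open>The Gaussian vector is an instance of the independent case with density bound 1, so the
  linear bound \<open>300 * s\<close> is available for it.\<close>

lemma std_gaussian_indep_bounded_densities:
  assumes "0 < n"
  shows "indep_bounded_densities n 1 (std_gaussian n)"
  unfolding indep_bounded_densities_def
proof (intro conjI allI impI)
  interpret G: prob_space "std_gaussian n" using std_gaussian_vector_law[of n] by (simp add: vector_law_def)
  have comp: "i < n \<Longrightarrow> (\<lambda>x. x i) \<in> borel_measurable (std_gaussian n)" for i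
    by (rule vector_law_measurable_component[OF std_gaussian_vector_law])
  show "G.indep_vars (\<lambda>_. borel) (\<lambda>i x. x i) {..<n}"
  proof (rule iffD2[OF G.indep_vars_iff_distr_eq_PiM'])
    have "distr (std_gaussian n) (PiM {..<n} (\<lambda>_. borel)) (\<lambda>x. \<lambda>i\<in>{..<n}. x i) = distr (std_gaussian n) (std_gaussian n) (\<lambda>x. x)"
      using std_gaussian_vector_law[of n] vector_law_space[OF std_gaussian_vector_law[of n]]
      by (intro distr_cong) (auto simp: vector_law_def)
    also have "\<dots> = std_gaussian n" by (rule distr_id)
    also have "\<dots> = PiM {..<n} (\<lambda>i. distr (std_gaussian n) borel (\<lambda>x. x i))"
      unfolding std_gaussian_def by (intro PiM_cong refl) (simp add: std_gaussian_component[unfolded std_gaussian_def])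
    finally show "distr (std_gaussian n) (PiM {..<n} (\<lambda>_. borel)) (\<lambda>x. \<lambda>i\<in>{..<n}. x i) =
        PiM {..<n} (\<lambda>i. distr (std_gaussian n) borel (\<lambda>x. x i))" .
  qed (use assms comp in auto)
next
  fix i assume i: "i < n"
  have "std_normal_density t \<le> 1" for t
  proof -
    have "exp (- t\<^sup>2 / 2) \<le> 1" by simp
    moreover have "1 \<le> sqrt (2 * pi)" using pi_ge_two by simp
    ultimately have "exp (- t\<^sup>2 / 2) \<le> sqrt (2 * pi)" by linarith
    then show ?thesis by (simp add: std_normal_density_def field_simps)
  qed
  moreover have "distributed (std_gaussian n) lborel (\<lambda>x. x i) (\<lambda>t. ennreal (std_normal_density t))"
    unfolding distributed_def
  proof (intro conjI)
    show "(\<lambda>x. x i) \<in> measurable (std_gaussian n) lborel"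
      using vector_law_measurable_component[OF std_gaussian_vector_law i] by simp
    show "distr (std_gaussian n) lborel (\<lambda>x. x i) = density lborel (\<lambda>t. ennreal (std_normal_density t))"
      using std_gaussian_component[OF i] by (simp cong: distr_cong)
  qed measurable
  ultimately show "\<exists>f. (\<forall>t. 0 \<le> f t \<and> f t \<le> 1) \<and> distributed (std_gaussian n) lborel (\<lambda>x. x i) (\<lambda>t. ennreal (f t))"
    by (intro exI[of _ std_normal_density]) auto
qed

lemma std_gaussian_second_moment:
  assumes "i < n"
  shows "(\<integral>\<^sup>+x. ennreal ((x i)\<^sup>2) \<partial>std_gaussian n) = 1"
proof -
  have "(\<integral>\<^sup>+x. ennreal ((x i)\<^sup>2) \<partial>std_gaussian n) = (\<integral>\<^sup>+y. ennreal (y\<^sup>2) \<partial>distr (std_gaussian n) borel (\<lambda>x. x i))"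
    by (subst nn_integral_distr) (auto intro: vector_law_measurable_component[OF std_gaussian_vector_law assms])
  also have "\<dots> = (\<integral>\<^sup>+y. ennreal (std_normal_density y * y ^ (2 * 1)) \<partial>lborel)"
    unfolding std_gaussian_component[OF assms]
    by (subst nn_integral_density) (auto intro!: nn_integral_cong simp: ennreal_mult)
  also have "\<dots> = ennreal (fact (2 * 1) / (2 ^ 1 * fact 1))"
    using std_normal_moment_even[of 1] by (intro nn_integral_eq_integral[THEN trans]) (auto simp: has_bochner_integral_iff)
  finally show ?thesis by (simp add: fact_numeral)
qed

text \<open>Comparison with a Gaussian vector \<open>g\<close>: by rotation invariance the small ball probability does
  not change when the direction is replaced by that of \<open>g\<close>, and given \<open>x\<close> the variable
  \<open>g \<bullet> x\<close> is Gaussian with variance \<open>n\<close>.\<close>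

lemma uniform_on_sphere_small_ball:
  assumes us: "uniform_on_sphere n \<nu>"
  shows "small_ball n 90601 \<nu>"
  unfolding small_ball_def
proof (intro allI impI)
  fix u :: "nat \<Rightarrow> real" and s :: real
  assume u1: "(\<Sum>i<n. (u i)\<^sup>2) = 1" and s: "0 < s"
  have n: "0 < n" using u1 by (cases n) auto
  have vl: "vector_law n \<nu>" by (rule uniform_on_sphere_vector_law[OF us])
  interpret N: prob_space \<nu> using vl by (simp add: vector_law_def)
  let ?G = "std_gaussian n"
  have vlG: "vector_law n ?G" by (rule std_gaussian_vector_law)
  interpret G: prob_space ?G using vlG by (simp add: vector_law_def)
  interpret P: pair_prob_space ?G \<nu> ..
  have [measurable]: "i < n \<Longrightarrow> (\<lambda>x. x i) \<in> borel_measurable \<nu>" for i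
    by (rule vector_law_measurable_component[OF vl])
  have [measurable]: "i < n \<Longrightarrow> (\<lambda>x. x i) \<in> borel_measurable ?G" for i
    by (rule vector_law_measurable_component[OF vlG])
  define L where "L g = sqrt (\<Sum>i<n. (g i)\<^sup>2)" for g :: "nat \<Rightarrow> real"
  have [measurable]: "L \<in> borel_measurable ?G" unfolding L_def by measurable
  have L0: "0 \<le> L g" for g unfolding L_def by (intro real_sqrt_ge_zero sum_nonneg) auto
  have L2: "(L g)\<^sup>2 = (\<Sum>i<n. (g i)\<^sup>2)" for g unfolding L_def by (intro real_sqrt_pow2 sum_nonneg) auto
  let ?f = "\<lambda>g x. indicator {y. \<bar>y\<bar> \<le> s * L g} (\<Sum>i<n. g i * x i) :: ennreal"
  let ?c = "emeasure \<nu> {x \<in> space \<nu>. \<bar>\<Sum>i<n. u i * x i\<bar> \<le> s}"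
  show "measure \<nu> {x \<in> space \<nu>. \<bar>\<Sum>i<n. u i * x i\<bar> \<le> s} \<le> sqrt (90601 * s)"
  proof (cases "s \<le> 1")
    case False
    then have "1 \<le> sqrt (90601 * s)" by simp
    then show ?thesis using N.prob_le_1[of "{x \<in> space \<nu>. \<bar>\<Sum>i<n. u i * x i\<bar> \<le> s}"] by linarith
  next
    case True
    have c: "?c \<le> (\<integral>\<^sup>+x. ?f g x \<partial>\<nu>)" for g
    proof -
      have "?c = (\<integral>\<^sup>+x. indicator {x \<in> space \<nu>. \<bar>\<Sum>i<n. u i * x i\<bar> \<le> s} x \<partial>\<nu>)" by simp
      also have "\<dots> \<le> (\<integral>\<^sup>+x. indicator {y. \<bar>y\<bar> \<le> s * L g} (\<Sum>i<n. (L g * u i) * x i) \<partial>\<nu>)"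
      proof (rule nn_integral_mono)
        fix x
        have "(\<Sum>i<n. (L g * u i) * x i) = L g * (\<Sum>i<n. u i * x i)" by (simp add: sum_distrib_left mult.assoc)
        then have "\<bar>\<Sum>i<n. (L g * u i) * x i\<bar> = L g * \<bar>\<Sum>i<n. u i * x i\<bar>" using L0[of g] by (simp add: abs_mult)
        then show "(indicator {x \<in> space \<nu>. \<bar>\<Sum>i<n. u i * x i\<bar> \<le> s} x :: ennreal)
          \<le> indicator {y. \<bar>y\<bar> \<le> s * L g} (\<Sum>i<n. (L g * u i) * x i)"
          using L0[of g] by (auto simp: indicator_def mult.commute[of s] intro: mult_left_mono)
      qed
      also have "\<dots> = (\<integral>\<^sup>+x. ?f g x \<partial>\<nu>)"
      proof (rule uniform_on_sphere_linear_law[OF us])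
        show "(\<Sum>i<n. (L g * u i)\<^sup>2) = (\<Sum>i<n. (g i)\<^sup>2)"
          using u1 by (simp add: power_mult_distrib sum_distrib_left[symmetric] L2)
      qed measurable
      finally show ?thesis .
    qed
    have "?c = (\<integral>\<^sup>+g. ?c \<partial>?G)" by (simp add: G.emeasure_space_1)
    also have "\<dots> \<le> (\<integral>\<^sup>+g. \<integral>\<^sup>+x. ?f g x \<partial>\<nu> \<partial>?G)" by (intro nn_integral_mono c)
    also have "\<dots> = (\<integral>\<^sup>+x. \<integral>\<^sup>+g. ?f g x \<partial>?G \<partial>\<nu>)"
      by (rule P.Fubini'[symmetric]) (simp add: case_prod_beta, measurable)
    also have "\<dots> \<le> (\<integral>\<^sup>+x. ennreal (301 * sqrt s) \<partial>\<nu>)"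
    proof (rule nn_integral_mono_AE, use uniform_on_sphere_norm[OF us] in eventually_elim)
      fix x :: "nat \<Rightarrow> real" assume x: "(\<Sum>i<n. (x i)\<^sup>2) = real n"
      let ?v = "\<lambda>i. x i / sqrt (real n)"
      let ?E = "{g \<in> space ?G. \<bar>\<Sum>i<n. ?v i * g i\<bar> \<le> sqrt s}"
      have v1: "(\<Sum>i<n. (?v i)\<^sup>2) = 1"
        using x n by (simp add: power_divide sum_divide_distrib[symmetric])
      \<comment> \<open>The norm of \<open>g\<close> is cut at \<open>sqrt (n / s)\<close>. Below
        the cut the event has Gaussian probability at most \<open>300 * sqrt s\<close>; above it
        Markov's inequality gives \<open>s <= sqrt s\<close>. The sum \<open>301 * sqrt s\<close> is
        \<open>sqrt (90601 * s)\<close>, whence the square root in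
        \<open>small_ball\<close>.\<close>
      have pt: "?f g x \<le> indicator ?E g + ennreal (s / real n) * (\<Sum>i<n. ennreal ((g i)\<^sup>2))" if g: "g \<in> space ?G" for g
      proof (cases "(L g)\<^sup>2 \<le> real n / s")
        case True
        then have "L g \<le> sqrt (real n / s)" by (rule real_le_rsqrt)
        then have "s * L g \<le> s * sqrt (real n / s)" using s by (intro mult_left_mono) auto
        also have "s * sqrt (real n / s) = sqrt s * sqrt (real n)"
          using s by (simp add: real_sqrt_divide field_simps)
        finally have b: "s * L g \<le> sqrt s * sqrt (real n)" .
        have "\<bar>\<Sum>i<n. ?v i * g i\<bar> = \<bar>\<Sum>i<n. g i * x i\<bar> / sqrt (real n)"
          by (simp add: sum_divide_distrib[symmetric] mult.commute)
        also have "\<dots> \<le> sqrt s" if "\<bar>\<Sum>i<n. g i * x i\<bar> \<le> s * L g"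
          using that b n by (simp only: pos_divide_le_eq real_sqrt_gt_0_iff of_nat_0_less_iff)
        finally have "?f g x \<le> indicator ?E g" using g by (auto simp: indicator_def)
        then show ?thesis by (simp add: add_increasing2)
      next
        case False
        then have "1 \<le> s / real n * (L g)\<^sup>2" using s n by (simp add: field_simps)
        then have "ennreal 1 \<le> ennreal (s / real n * (\<Sum>i<n. (g i)\<^sup>2))" unfolding L2 by (rule ennreal_leI)
        also have "\<dots> = ennreal (s / real n) * (\<Sum>i<n. ennreal ((g i)\<^sup>2))"
          using s by (subst ennreal_mult') (auto simp: sum_ennreal)
        finally have "1 \<le> ennreal (s / real n) * (\<Sum>i<n. ennreal ((g i)\<^sup>2))" by simp
        moreover have "?f g x \<le> 1" by (simp add: indicator_def)
        ultimately show ?thesis by (meson add_increasing order_trans zero_le)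
      qed
      have "(\<integral>\<^sup>+g. ?f g x \<partial>?G) \<le> (\<integral>\<^sup>+g. indicator ?E g + ennreal (s / real n) * (\<Sum>i<n. ennreal ((g i)\<^sup>2)) \<partial>?G)"
        by (intro nn_integral_mono pt)
      also have "\<dots> = emeasure ?G ?E + ennreal (s / real n) * (\<Sum>i<n. \<integral>\<^sup>+g. ennreal ((g i)\<^sup>2) \<partial>?G)"
      proof -
        have "(\<lambda>g. ennreal ((g i)\<^sup>2)) \<in> borel_measurable ?G" if "i \<in> {..<n}" for i
          using that by simp
        then have "(\<integral>\<^sup>+g. (\<Sum>i<n. ennreal ((g i)\<^sup>2)) \<partial>?G) = (\<Sum>i<n. \<integral>\<^sup>+g. ennreal ((g i)\<^sup>2) \<partial>?G)"
          by (rule nn_integral_sum)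
        then show ?thesis
          by (subst nn_integral_add) (auto simp: nn_integral_cmult simp del: sum_ennreal)
      qed
      also have "(\<Sum>i<n. \<integral>\<^sup>+g. ennreal ((g i)\<^sup>2) \<partial>?G) = ennreal (real n)"
        by (simp add: std_gaussian_second_moment ennreal_of_nat_eq_real_of_nat)
      also have "ennreal (s / real n) * ennreal (real n) = ennreal s"
        using s n by (simp add: ennreal_mult[symmetric])
      also have "emeasure ?G ?E \<le> ennreal (300 * 1 * sqrt s)"
        unfolding G.emeasure_eq_measure
        using indep_bounded_densities_small_ball_linear[OF vlG std_gaussian_indep_bounded_densities[OF n] v1, of "sqrt s"] s
        by (intro ennreal_leI) simp
      also have "ennreal (300 * 1 * sqrt s) + ennreal s \<le> ennreal (301 * sqrt s)"
      proof -
        have "s \<le> sqrt s" using True s by (intro real_le_rsqrt) (simp add: power2_eq_square mult_left_le)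
        then show ?thesis using s by (simp add: ennreal_plus[symmetric] ennreal_leI del: ennreal_plus)
      qed
      finally show "(\<integral>\<^sup>+g. ?f g x \<partial>?G) \<le> ennreal (301 * sqrt s)" by (simp add: add_right_mono)
    qed
    also have "\<dots> = ennreal (sqrt (90601 * s))"
    proof -
      have "sqrt 90601 = (301::real)" by (rule real_sqrt_unique) auto
      then show ?thesis by (simp add: N.emeasure_space_1 real_sqrt_mult)
    qed
    finally show ?thesis using s by (simp add: N.emeasure_eq_measure)
  qed
qed

section \<open>Negative moments\<close>

text \<open>A moment of order -1/4 of the functional, written with its square so that quadratic
  forms can take its place. The shift \<epsilon> avoids the singularity at 0, and because it appears
  on both sides the inequality can be iterated over the factors.\<close>

definition neg_moment :: "nat \<Rightarrow> real \<Rightarrow> (nat \<Rightarrow> real) measure \<Rightarrow> bool" where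
  "neg_moment n B \<nu> \<longleftrightarrow> (\<forall>v. \<forall>\<epsilon>>0.
     (\<integral>\<^sup>+x. ennreal (((\<Sum>i<n. v i * x i)\<^sup>2 + \<epsilon>) powr (- 1 / 8)) \<partial>\<nu>)
       \<le> ennreal (B * ((\<Sum>i<n. (v i)\<^sup>2) + \<epsilon>) powr (- 1 / 8)))"

text \<open>Dyadic layers of the integrand: doubling it shrinks the bound on \<open>|S|\<close> by
  16 and hence the bound on the probability by 4, so the layers sum up.\<close>

lemma nn_integral_neg_powr_le:
  assumes "prob_space \<nu>" and [measurable]: "S \<in> borel_measurable \<nu>" and A: "0 < A" and \<epsilon>: "0 < \<epsilon>"
    and sb: "\<And>s. 0 < s \<Longrightarrow> measure \<nu> {x \<in> space \<nu>. \<bar>S x\<bar> \<le> s} \<le> sqrt (A * s)"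
  shows "(\<integral>\<^sup>+x. ennreal (((S x)\<^sup>2 + \<epsilon>) powr (- 1 / 8)) \<partial>\<nu>) \<le> ennreal (5 * A powr (1 / 4))"
proof -
  interpret prob_space \<nu> by fact
  \<comment> \<open>The value \<open>s0\<close> corresponds to \<open>|S| = 1 / A\<close>, where the
    small ball bound reaches 1. Level \<open>s0 * 2^m\<close> has probability at most
    \<open>4^-m\<close>, so the layers add up to \<open>4 * s0\<close>; values below
    \<open>s0\<close> make it \<open>5 * s0\<close>.\<close>
  define s0 where "s0 = A powr (1 / 4)"
  have s0: "0 < s0" using A by (simp add: s0_def)
  have "s0 ^ 4 = A powr (1 / 4 * 4)" unfolding s0_def by (subst powr_powr[symmetric], subst powr_numeral) auto
  then have s04: "s0 ^ 4 = A" using A by simp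
  define Z where "Z x = ((S x)\<^sup>2 + \<epsilon>) powr (- 1 / 8)" for x
  have pos: "0 < (S x)\<^sup>2 + \<epsilon>" for x using \<epsilon> by (simp add: add_nonneg_pos)
  have Z8: "Z x ^ 8 * ((S x)\<^sup>2 + \<epsilon>) = 1" for x
  proof -
    have "Z x ^ 8 = ((S x)\<^sup>2 + \<epsilon>) powr (- 1 / 8 * 8)"
      unfolding Z_def using pos[of x] by (subst powr_powr[symmetric], subst powr_numeral) auto
    then show ?thesis using pos[of x] by (simp add: powr_minus)
  qed
  let ?E = "\<lambda>m::nat. {x \<in> space \<nu>. \<bar>S x\<bar> \<le> 1 / (A * 16 ^ m)}"
  have E: "x \<in> ?E m" if x: "x \<in> space \<nu>" and Z: "s0 * 2 ^ m < Z x" for x m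
  proof -
    have "(s0 * 2 ^ m) ^ 8 \<le> Z x ^ 8" using Z s0 by (intro power_mono) auto
    moreover have "(s0 * 2 ^ m) ^ 8 = (A * 16 ^ m)\<^sup>2"
    proof -
      have "(s0 * 2 ^ m) ^ 8 = (s0 ^ 4 * (2 ^ 4) ^ m)\<^sup>2"
        unfolding power_mult_distrib power_mult[symmetric] by (simp add: mult.commute)
      then show ?thesis unfolding s04 by simp
    qed
    ultimately have "(A * 16 ^ m)\<^sup>2 * (S x)\<^sup>2 \<le> Z x ^ 8 * ((S x)\<^sup>2 + \<epsilon>)"
      using \<epsilon> by (intro mult_mono) auto
    then have "(A * 16 ^ m * \<bar>S x\<bar>)\<^sup>2 \<le> 1\<^sup>2" by (simp only: Z8 power_mult_distrib power2_abs power_one)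
    then have "A * 16 ^ m * \<bar>S x\<bar> \<le> 1" by (rule power2_le_imp_le) simp
    then show ?thesis using x A by (simp add: field_simps)
  qed
  have pt: "ennreal (Z x) \<le> ennreal s0 + (\<Sum>m. ennreal (2 * s0 * 2 ^ m) * indicator (?E m) x)" if x: "x \<in> space \<nu>" for x
  proof (cases "Z x \<le> s0")
    case True
    then show ?thesis by (simp add: add_increasing2 ennreal_leI)
  next
    case False
    obtain j :: nat where j: "Z x / s0 < 2 ^ j" using real_arch_pow[of 2 "Z x / s0"] by auto
    define i where "i = (LEAST i::nat. Z x / s0 < 2 ^ i)"
    have i: "Z x / s0 < 2 ^ i" unfolding i_def using j by (rule LeastI)
    have "i \<noteq> 0"
    proof
      assume "i = 0"
      with i False s0 show False by (simp add: field_simps)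
    qed
    then obtain m where m: "i = Suc m" by (cases i) auto
    have m1: "\<not> Z x / s0 < 2 ^ m" using not_less_Least[of m "\<lambda>i. Z x / s0 < 2 ^ i"] m by (simp add: i_def)
    \<comment> \<open>Membership in \<open>?E m\<close> requires a strict inequality, so a value
      equal to \<open>s0 * 2^m\<close> is charged to the layer below.\<close>
    show ?thesis
    proof (cases "Z x = s0 * 2 ^ m")
      case True
      have "m \<noteq> 0" using True False by (intro notI) simp
      then obtain m' where m': "m = Suc m'" by (cases m) auto
      have "s0 * 2 ^ m' < Z x" using True m' s0 by simp
      then have "ennreal (Z x) \<le> ennreal (2 * s0 * 2 ^ m') * indicator (?E m') x"
        using E[OF x, of m'] True m' by simp
      also have "\<dots> \<le> (\<Sum>m. ennreal (2 * s0 * 2 ^ m) * indicator (?E m) x)" by (rule ennreal_le_suminf)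
      finally show ?thesis by (simp add: add_increasing)
    next
      case ne: False
      have "s0 * 2 ^ m < Z x" using m1 s0 ne by (simp add: field_simps)
      then have xE: "x \<in> ?E m" by (rule E[OF x])
      have "Z x \<le> 2 * s0 * 2 ^ m" using i m s0 by (simp add: field_simps)
      then have "ennreal (Z x) \<le> ennreal (2 * s0 * 2 ^ m) * indicator (?E m) x"
        using xE by (simp add: ennreal_leI)
      also have "\<dots> \<le> (\<Sum>m. ennreal (2 * s0 * 2 ^ m) * indicator (?E m) x)" by (rule ennreal_le_suminf)
      finally show ?thesis by (simp add: add_increasing)
    qed
  qed
  have "(\<integral>\<^sup>+x. ennreal (Z x) \<partial>\<nu>) \<le> (\<integral>\<^sup>+x. ennreal s0 + (\<Sum>m. ennreal (2 * s0 * 2 ^ m) * indicator (?E m) x) \<partial>\<nu>)"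
    by (intro nn_integral_mono pt)
  also have "\<dots> = ennreal s0 + (\<Sum>m. ennreal (2 * s0 * 2 ^ m) * emeasure \<nu> (?E m))"
    by (subst nn_integral_add) (auto simp: nn_integral_suminf nn_integral_cmult emeasure_space_1)
  also have "(\<Sum>m. ennreal (2 * s0 * 2 ^ m) * emeasure \<nu> (?E m)) \<le> (\<Sum>m. ennreal (2 * s0 * (1 / 2) ^ m))"
  proof (intro suminf_le)
    fix m :: nat
    have "prob (?E m) \<le> sqrt (A * (1 / (A * 16 ^ m)))" using A by (intro sb) simp
    also have "\<dots> = (1 / 4) ^ m"
    proof -
      have "A * (1 / (A * 16 ^ m)) = ((1 / 4) ^ m)\<^sup>2"
        using A by (simp add: power2_eq_square power_mult_distrib[symmetric] power_one_over)
      then show ?thesis by simp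
    qed
    finally have "2 * s0 * 2 ^ m * prob (?E m) \<le> 2 * s0 * 2 ^ m * (1 / 4) ^ m"
      using s0 by (intro mult_left_mono) auto
    also have "\<dots> = 2 * s0 * (1 / 2) ^ m" by (simp add: power_mult_distrib[symmetric])
    finally show "ennreal (2 * s0 * 2 ^ m) * emeasure \<nu> (?E m) \<le> ennreal (2 * s0 * (1 / 2) ^ m)"
      unfolding emeasure_eq_measure using s0 by (subst ennreal_mult'[symmetric]) (auto intro: ennreal_leI)
  qed auto
  also have "(\<Sum>m. ennreal (2 * s0 * (1 / 2) ^ m)) = ennreal (4 * s0)"
    using s0 by (subst suminf_ennreal2, simp, intro summable_mult summable_geometric, simp, subst suminf_mult)
       (auto simp: suminf_geometric)
  also have "ennreal s0 + ennreal (4 * s0) = ennreal (5 * s0)"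
    using s0 by (subst ennreal_plus[symmetric]) auto
  finally show ?thesis by (simp add: Z_def s0_def)
qed

text \<open>The cost of replacing the larger of two summands by their sum, which is at most twice as
  large.\<close>

lemma powr_neg_eighth_half:
  assumes "0 < (y::real)"
  shows "y powr (- 1 / 8) \<le> 1.2 * (2 * y) powr (- 1 / 8)"
proof -
  have "(2 powr (1 / 8)) ^ 8 = (2::real) powr (1 / 8 * 8)"
    by (subst powr_powr[symmetric], subst powr_numeral) auto
  also have "\<dots> \<le> 1.2 ^ 8" by (simp add: power_divide)
  finally have "2 powr (1 / 8) \<le> (1.2::real)" by (rule power_le_imp_le_base[of _ 7, simplified]) simp
  then have "2 powr (- 1 / 8) * 2 powr (1 / 8) \<le> 2 powr (- 1 / 8) * (1.2::real)"
    by (intro mult_left_mono) auto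
  moreover have "2 powr (- 1 / 8) * 2 powr (1 / 8) = (1::real)" by (simp add: powr_add[symmetric])
  ultimately have "1 \<le> 1.2 * 2 powr (- 1 / 8 :: real)" by (simp only: mult.commute)
  then have "1 * y powr (- 1 / 8) \<le> 1.2 * 2 powr (- 1 / 8) * y powr (- 1 / 8)"
    by (rule mult_right_mono) simp
  then show ?thesis using assms by (simp only: powr_mult mult_1 mult.assoc)
qed

text \<open>When \<epsilon> exceeds \<open>R\<close>, bounding the integrand by its value at 0
  suffices provided \<open>1.2 <= 6 * s0\<close>, which is the origin of
  \<open>1 / 625 = (1 / 5)^4\<close>. Otherwise scaling to a unit vector gives
  \<open>5 * s0\<close>, and 1.2 * 5 = 6.\<close>

lemma small_ball_neg_moment:
  assumes vl: "vector_law n \<nu>" and sb: "small_ball n A \<nu>" and A: "1 / 625 \<le> A"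
  shows "neg_moment n (6 * A powr (1 / 4)) \<nu>"
  unfolding neg_moment_def
proof (intro allI impI)
  fix v :: "nat \<Rightarrow> real" and \<epsilon> :: real assume \<epsilon>: "0 < \<epsilon>"
  interpret N: prob_space \<nu> using vl by (simp add: vector_law_def)
  have [measurable]: "i < n \<Longrightarrow> (\<lambda>x. x i) \<in> borel_measurable \<nu>" for i
    by (rule vector_law_measurable_component[OF vl])
  define R where "R = (\<Sum>i<n. (v i)\<^sup>2)"
  have R0: "0 \<le> R" unfolding R_def by (intro sum_nonneg) auto
  define s0 where "s0 = A powr (1 / 4)"
  have s0: "1 / 5 \<le> s0"
  proof -
    have "(1 / 625) powr (1 / 4) \<le> s0" unfolding s0_def using A by (intro powr_mono2) auto
    moreover have "(1 / 625 :: real) = (1 / 5) powr 4" by (simp add: power_divide)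
    ultimately show ?thesis by (simp only: powr_powr) simp
  qed
  let ?S = "\<lambda>x. \<Sum>i<n. v i * x i"
  show "(\<integral>\<^sup>+x. ennreal (((?S x)\<^sup>2 + \<epsilon>) powr (- 1 / 8)) \<partial>\<nu>) \<le> ennreal (6 * A powr (1 / 4) * ((\<Sum>i<n. (v i)\<^sup>2) + \<epsilon>) powr (- 1 / 8))"
    unfolding R_def[symmetric] s0_def[symmetric]
  proof (cases "\<epsilon> \<le> R")
    case False
    have "(\<integral>\<^sup>+x. ennreal (((?S x)\<^sup>2 + \<epsilon>) powr (- 1 / 8)) \<partial>\<nu>) \<le> (\<integral>\<^sup>+x. ennreal (6 * s0 * (R + \<epsilon>) powr (- 1 / 8)) \<partial>\<nu>)"
    proof (intro nn_integral_mono ennreal_leI)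
      fix x
      have "((?S x)\<^sup>2 + \<epsilon>) powr (- 1 / 8) \<le> \<epsilon> powr (- 1 / 8)" using \<epsilon> by (intro powr_mono2') auto
      also have "\<dots> \<le> 1.2 * (2 * \<epsilon>) powr (- 1 / 8)" by (rule powr_neg_eighth_half[OF \<epsilon>])
      also have "\<dots> \<le> 6 * s0 * (R + \<epsilon>) powr (- 1 / 8)"
        using False R0 \<epsilon> s0 by (intro mult_mono powr_mono2') auto
      finally show "((?S x)\<^sup>2 + \<epsilon>) powr (- 1 / 8) \<le> 6 * s0 * (R + \<epsilon>) powr (- 1 / 8)" .
    qed
    also have "\<dots> = ennreal (6 * s0 * (R + \<epsilon>) powr (- 1 / 8))" by (simp add: N.emeasure_space_1)
    finally show "(\<integral>\<^sup>+x. ennreal (((?S x)\<^sup>2 + \<epsilon>) powr (- 1 / 8)) \<partial>\<nu>) \<le> ennreal (6 * s0 * (R + \<epsilon>) powr (- 1 / 8))" .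
  next
    case True
    then have R: "0 < R" using \<epsilon> by linarith
    define u where "u i = v i / sqrt R" for i
    have u1: "(\<Sum>i<n. (u i)\<^sup>2) = 1"
      using R by (simp add: u_def power_divide sum_divide_distrib[symmetric] R_def[symmetric])
    define S where "S x = (\<Sum>i<n. u i * x i)" for x
    have [measurable]: "S \<in> borel_measurable \<nu>" unfolding S_def by measurable
    have vS: "?S x = sqrt R * S x" for x
      unfolding S_def sum_distrib_left using R by (intro sum.cong) (auto simp: u_def)
    have eq: "((?S x)\<^sup>2 + \<epsilon>) powr (- 1 / 8) = R powr (- 1 / 8) * ((S x)\<^sup>2 + \<epsilon> / R) powr (- 1 / 8)" for x
    proof -
      have "(?S x)\<^sup>2 + \<epsilon> = R * ((S x)\<^sup>2 + \<epsilon> / R)"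
        unfolding vS using R by (simp add: power_mult_distrib distrib_left)
      then show ?thesis using R \<epsilon> by (simp add: powr_mult)
    qed
    have "(\<integral>\<^sup>+x. ennreal (((?S x)\<^sup>2 + \<epsilon>) powr (- 1 / 8)) \<partial>\<nu>) = ennreal (R powr (- 1 / 8)) * (\<integral>\<^sup>+x. ennreal (((S x)\<^sup>2 + \<epsilon> / R) powr (- 1 / 8)) \<partial>\<nu>)"
      unfolding eq by (simp add: ennreal_mult nn_integral_cmult)
    also have "\<dots> \<le> ennreal (R powr (- 1 / 8)) * ennreal (5 * s0)"
      unfolding s0_def using A R \<epsilon> sb u1
      by (intro mult_left_mono nn_integral_neg_powr_le N.prob_space_axioms) (auto simp: small_ball_def S_def)
    also have "\<dots> = ennreal (R powr (- 1 / 8) * (5 * s0))" by (simp add: ennreal_mult')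
    also have "\<dots> \<le> ennreal (6 * s0 * (R + \<epsilon>) powr (- 1 / 8))"
    proof (rule ennreal_leI)
      have "R powr (- 1 / 8) \<le> 1.2 * (2 * R) powr (- 1 / 8)" by (rule powr_neg_eighth_half[OF R])
      also have "\<dots> \<le> 1.2 * (R + \<epsilon>) powr (- 1 / 8)"
        using True R \<epsilon> by (intro mult_left_mono powr_mono2') auto
      finally have "R powr (- 1 / 8) * (5 * s0) \<le> 1.2 * (R + \<epsilon>) powr (- 1 / 8) * (5 * s0)"
        using s0 by (intro mult_right_mono) auto
      then show "R powr (- 1 / 8) * (5 * s0) \<le> 6 * s0 * (R + \<epsilon>) powr (- 1 / 8)" by simp
    qed
    finally show "(\<integral>\<^sup>+x. ennreal (((?S x)\<^sup>2 + \<epsilon>) powr (- 1 / 8)) \<partial>\<nu>) \<le> ennreal (6 * s0 * (R + \<epsilon>) powr (- 1 / 8))" .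
  qed
qed

text \<open>Chebyshev's inequality: a functional with second moment 1 lies in [-2, 2] with
  probability at least 3/4. The lower bound on \<open>A\<close> later keeps \<alpha> at most 1 and
  meets the hypothesis of \<open>small_ball_neg_moment\<close>.\<close>

lemma small_ball_isotropic_lower_bound:
  assumes vl: "vector_law n \<nu>" and iso: "isotropic n \<nu>" and sb: "small_ball n A \<nu>" and n: "0 < n"
  shows "1 / 4 \<le> A"
proof -
  interpret N: prob_space \<nu> using vl by (simp add: vector_law_def)
  have [measurable]: "i < n \<Longrightarrow> (\<lambda>x. x i) \<in> borel_measurable \<nu>" for i
    by (rule vector_law_measurable_component[OF vl])
  define u where "u i = (if i = 0 then 1 else 0 :: real)" for i :: nat
  define S where "S x = (\<Sum>i<n. u i * x i)" for x
  have [measurable]: "S \<in> borel_measurable \<nu>" unfolding S_def by measurable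
  have u1: "(\<Sum>i<n. (u i)\<^sup>2) = 1" using n by (simp add: u_def if_distrib[where f="\<lambda>x. x\<^sup>2"] cong: if_cong)
  let ?E = "{x \<in> space \<nu>. \<bar>S x\<bar> \<le> 2}"
  have "ennreal 1 = (\<integral>\<^sup>+x. 1 \<partial>\<nu>)" by (simp add: N.emeasure_space_1)
  also have "\<dots> \<le> (\<integral>\<^sup>+x. indicator ?E x + ennreal (1 / 4) * ennreal ((S x)\<^sup>2) \<partial>\<nu>)"
  proof (rule nn_integral_mono)
    fix x assume x: "x \<in> space \<nu>"
    show "1 \<le> indicator ?E x + ennreal (1 / 4) * ennreal ((S x)\<^sup>2)"
    proof (cases "\<bar>S x\<bar> \<le> 2")
      case False
      then have "2\<^sup>2 \<le> \<bar>S x\<bar>\<^sup>2" by (intro power_mono) auto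
      then have "ennreal 1 \<le> ennreal (1 / 4 * (S x)\<^sup>2)" by (intro ennreal_leI) simp
      then show ?thesis by (subst (asm) ennreal_mult') (auto simp: add_increasing)
    qed (use x in simp)
  qed
  also have "\<dots> = emeasure \<nu> ?E + ennreal (1 / 4) * 1"
    using isotropic_linear_nn_integral[OF vl iso, of u] u1
    by (subst nn_integral_add) (auto simp: nn_integral_cmult S_def)
  also have "\<dots> = ennreal (measure \<nu> ?E + 1 / 4)"
    by (simp add: N.emeasure_eq_measure)
  finally have "1 \<le> measure \<nu> ?E + 1 / 4" by (subst (asm) ennreal_le_iff) auto
  also have "measure \<nu> ?E \<le> sqrt (A * 2)" using sb u1 by (simp add: small_ball_def S_def)
  finally have "3 / 4 \<le> sqrt (A * 2)" by simp
  then have "(3 / 4)\<^sup>2 \<le> A * 2"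
    by (metis real_sqrt_le_iff real_sqrt_unique zero_le_divide_iff zero_le_numeral real_sqrt_abs abs_of_nonneg)
  then show ?thesis by (simp add: power2_eq_square)
qed

lemma convex_on_powr_neg_eighth: "convex_on {0<..} (\<lambda>x::real. x powr (- 1 / 8))"
proof (rule f''_ge0_imp_convex)
  fix x :: real assume x: "x \<in> {0<..}"
  show "((\<lambda>x. x powr (- 1 / 8)) has_real_derivative (- 1 / 8) * x powr (- 1 / 8 - 1)) (at x)"
    using x by (auto intro!: derivative_eq_intros)
  show "((\<lambda>x. (- 1 / 8) * x powr (- 1 / 8 - 1)) has_real_derivative (- 1 / 8) * ((- 1 / 8 - 1) * x powr (- 1 / 8 - 1 - 1))) (at x)"
    using x by (auto intro!: derivative_eq_intros)
  show "0 \<le> (- 1 / 8) * ((- 1 / 8 - 1) * x powr (- 1 / 8 - 1 - 1))" by simp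
qed simp

text \<open>Convexity reduces a quadratic form of any rank to the linear functionals it is made of.\<close>

lemma neg_moment_quadratic:
  fixes D :: nat
  assumes vl: "vector_law n \<nu>" and nm: "neg_moment n B \<nu>" and \<epsilon>: "0 < \<epsilon>"
  shows "(\<integral>\<^sup>+x. ennreal (((\<Sum>m<D. (\<Sum>a<n. X m a * x a)\<^sup>2) + \<epsilon>) powr (- 1 / 8)) \<partial>\<nu>)
    \<le> ennreal (B * ((\<Sum>m<D. \<Sum>a<n. (X m a)\<^sup>2) + \<epsilon>) powr (- 1 / 8))"
proof -
  have [measurable]: "i < n \<Longrightarrow> (\<lambda>x. x i) \<in> borel_measurable \<nu>" for i
    by (rule vector_law_measurable_component[OF vl])
  define r where "r m = (\<Sum>a<n. (X m a)\<^sup>2)" for m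
  have r0: "0 \<le> r m" for m unfolding r_def by (intro sum_nonneg) auto
  define R where "R = (\<Sum>m<D. r m)"
  \<comment> \<open>Zero rows would get weight 0, and the rescaled rows \<open>v\<close> are
    obtained by dividing by square roots of weights.\<close>
  define J where "J = {m. m < D \<and> 0 < r m}"
  have J: "finite J" "J \<subseteq> {..<D}" by (auto simp: J_def)
  have RJ: "R = sum r J"
  proof -
    have "r m = 0" if "m \<in> {..<D} - J" for m using that r0[of m] by (simp add: J_def)
    then show ?thesis unfolding R_def using J by (intro sum.mono_neutral_right) auto
  qed
  have Xz: "X m a = 0" if "m < D" "m \<notin> J" "a < n" for m a
  proof -
    have "r m = 0" using that r0[of m] by (simp add: J_def)
    then show ?thesis using that(3) unfolding r_def by (subst (asm) sum_nonneg_eq_0_iff) auto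
  qed
  have sumJ: "(\<Sum>m<D. (\<Sum>a<n. X m a * x a)\<^sup>2) = (\<Sum>m\<in>J. (\<Sum>a<n. X m a * x a)\<^sup>2)" for x
    using J Xz by (intro sum.mono_neutral_right) auto
  show ?thesis
    unfolding r_def[symmetric] R_def[symmetric]
  proof (cases "J = {}")
    case True
    then have "R = 0" using RJ by simp
    moreover note nm[unfolded neg_moment_def, rule_format, OF \<epsilon>, of "\<lambda>_. 0"]
    ultimately show "(\<integral>\<^sup>+x. ennreal (((\<Sum>m<D. (\<Sum>a<n. X m a * x a)\<^sup>2) + \<epsilon>) powr (- 1 / 8)) \<partial>\<nu>) \<le> ennreal (B * (R + \<epsilon>) powr (- 1 / 8))"
      using True by (simp add: sumJ del: ennreal_le_iff)
  next
    case False
    have rJ: "m \<in> J \<Longrightarrow> 0 < r m" for m by (simp add: J_def)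
    have R: "0 < R" unfolding RJ using J(1) False rJ by (rule sum_pos)
    \<comment> \<open>Each row is weighted by its share of the total and rescaled to squared length
      \<open>R\<close>. The form becomes a convex combination of squared functionals of equal
      length, so all terms have the same moment bound.\<close>
    define p where "p m = r m / R" for m
    have p: "m \<in> J \<Longrightarrow> 0 < p m" for m using rJ R by (simp add: p_def)
    have p1: "sum p J = 1" using R RJ by (simp add: p_def sum_divide_distrib[symmetric])
    define v where "v m a = X m a / sqrt (p m)" for m a
    have v: "(\<Sum>a<n. (v m a)\<^sup>2) = R" if "m \<in> J" for m
    proof -
      have "(\<Sum>a<n. (v m a)\<^sup>2) = r m / p m"
        unfolding r_def sum_divide_distrib using p[OF that] by (intro sum.cong) (auto simp: v_def power_divide)
      then show ?thesis using rJ[OF that] R by (simp add: p_def)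
    qed
    let ?y = "\<lambda>m x. (\<Sum>a<n. v m a * x a)\<^sup>2 + \<epsilon>"
    have y0: "0 < ?y m x" for m x using \<epsilon> by (simp add: add_nonneg_pos)
    have pt: "((\<Sum>m<D. (\<Sum>a<n. X m a * x a)\<^sup>2) + \<epsilon>) powr (- 1 / 8) \<le> (\<Sum>m\<in>J. p m * ?y m x powr (- 1 / 8))" for x
    proof -
      have "(\<Sum>m\<in>J. p m * ?y m x) = (\<Sum>m\<in>J. (\<Sum>a<n. X m a * x a)\<^sup>2 + p m * \<epsilon>)"
      proof (intro sum.cong refl)
        fix m assume m: "m \<in> J"
        have "(\<Sum>a<n. X m a * x a) = sqrt (p m) * (\<Sum>a<n. v m a * x a)"
          unfolding sum_distrib_left using p[OF m] by (intro sum.cong) (auto simp: v_def)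
        then show "p m * ?y m x = (\<Sum>a<n. X m a * x a)\<^sup>2 + p m * \<epsilon>"
          using p[OF m] by (simp add: power_mult_distrib distrib_left)
      qed
      also have "\<dots> = (\<Sum>m<D. (\<Sum>a<n. X m a * x a)\<^sup>2) + \<epsilon>"
        by (simp add: sum.distrib sum_distrib_right[symmetric] p1 sumJ)
      finally have eq: "(\<Sum>m<D. (\<Sum>a<n. X m a * x a)\<^sup>2) + \<epsilon> = (\<Sum>m\<in>J. p m *\<^sub>R ?y m x)" by simp
      show ?thesis unfolding eq
        by (rule convex_on_sum[OF J(1) False convex_on_powr_neg_eighth p1]) (use p y0 in \<open>auto simp: less_imp_le\<close>)
    qed
    have "(\<integral>\<^sup>+x. ennreal (((\<Sum>m<D. (\<Sum>a<n. X m a * x a)\<^sup>2) + \<epsilon>) powr (- 1 / 8)) \<partial>\<nu>)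
        \<le> (\<integral>\<^sup>+x. (\<Sum>m\<in>J. ennreal (p m) * ennreal (?y m x powr (- 1 / 8))) \<partial>\<nu>)"
    proof (rule nn_integral_mono)
      fix x
      have "ennreal (((\<Sum>m<D. (\<Sum>a<n. X m a * x a)\<^sup>2) + \<epsilon>) powr (- 1 / 8)) \<le> ennreal (\<Sum>m\<in>J. p m * ?y m x powr (- 1 / 8))"
        by (rule ennreal_leI[OF pt])
      also have "\<dots> = (\<Sum>m\<in>J. ennreal (p m) * ennreal (?y m x powr (- 1 / 8)))"
        using p by (subst sum_ennreal[symmetric]) (auto simp: ennreal_mult less_imp_le)
      finally show "ennreal (((\<Sum>m<D. (\<Sum>a<n. X m a * x a)\<^sup>2) + \<epsilon>) powr (- 1 / 8)) \<le> \<dots>" .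
    qed
    also have "\<dots> = (\<Sum>m\<in>J. ennreal (p m) * (\<integral>\<^sup>+x. ennreal (?y m x powr (- 1 / 8)) \<partial>\<nu>))"
      by (subst nn_integral_sum) (auto simp: nn_integral_cmult)
    also have "\<dots> \<le> (\<Sum>m\<in>J. ennreal (p m) * ennreal (B * (R + \<epsilon>) powr (- 1 / 8)))"
    proof (intro sum_mono mult_left_mono)
      fix m assume m: "m \<in> J"
      show "(\<integral>\<^sup>+x. ennreal (?y m x powr (- 1 / 8)) \<partial>\<nu>) \<le> ennreal (B * (R + \<epsilon>) powr (- 1 / 8))"
        using nm[unfolded neg_moment_def, rule_format, OF \<epsilon>, of "v m"] unfolding v[OF m] .
    qed simp
    also have "\<dots> = ennreal (B * (R + \<epsilon>) powr (- 1 / 8))"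
      using p p1 by (simp add: sum_distrib_right[symmetric] sum_ennreal less_imp_le)
    finally show "(\<integral>\<^sup>+x. ennreal (((\<Sum>m<D. (\<Sum>a<n. X m a * x a)\<^sup>2) + \<epsilon>) powr (- 1 / 8)) \<partial>\<nu>) \<le> ennreal (B * (R + \<epsilon>) powr (- 1 / 8))" .
  qed
qed

section \<open>Kronecker products of independent vectors\<close>

text \<open>An arbitrary index list in place of the indices of one column, so that inductions can
  split the head coordinate off the product measure.\<close>

definition kron_sample :: "nat \<Rightarrow> 'i list \<Rightarrow> ('i \<Rightarrow> nat \<Rightarrow> real) \<Rightarrow> real vec" where
  "kron_sample n js \<omega> = kron_list (map (\<lambda>i. vec n (\<omega> i)) js)"

lemma kron_sample_Nil: "kron_sample n [] \<omega> = vec 1 (\<lambda>_. 1)"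
  by (simp add: kron_sample_def kron_list_def)

lemma kron_sample_Cons: "kron_sample n (i # js) \<omega> = kron_vec (vec n (\<omega> i)) (kron_sample n js \<omega>)"
  by (simp add: kron_sample_def kron_list_def)

lemma kron_sample_carrier [simp]: "kron_sample n js \<omega> \<in> carrier_vec (n ^ length js)"
  by (induction js) (auto simp: kron_sample_Nil kron_sample_Cons kron_vec_def)

lemma kron_sample_dim [simp]: "dim_vec (kron_sample n js \<omega>) = n ^ length js"
  using kron_sample_carrier[of n js \<omega>] by (rule carrier_vecD)

lemma kron_sample_upd: "i \<notin> set js \<Longrightarrow> kron_sample n js (fun_upd \<omega> i y) = kron_sample n js \<omega>"
  unfolding kron_sample_def by (intro arg_cong[where f=kron_list] map_cong) auto

section \<open>Contraction of a tensor with one factor\<close>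

lemma sum_lessThan_mult:
  fixes f :: "nat \<Rightarrow> 'a :: comm_monoid_add"
  shows "(\<Sum>p<n * D. f p) = (\<Sum>a<n. \<Sum>m<D. f (a * D + m))"
proof (induction n)
  case (Suc n)
  have "(\<Sum>p<N + D. f p) = (\<Sum>p<N. f p) + (\<Sum>m<D. f (N + m))" for N
    by (induction D) (auto simp: add.assoc)
  from this[of "n * D"] Suc show ?case by (simp add: add.commute)
qed simp

text \<open>With \<open>x\<close> read as an \<open>n\<close> by \<open>D\<close> matrix in
  row-major order, this is its transpose applied to \<open>y\<close>.\<close>

definition contract :: "nat \<Rightarrow> nat \<Rightarrow> real vec \<Rightarrow> (nat \<Rightarrow> real) \<Rightarrow> real vec" where
  "contract n D x y = vec D (\<lambda>m. \<Sum>a<n. x $ (a * D + m) * y a)"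

lemma contract_carrier [simp]: "contract n D x y \<in> carrier_vec D"
  by (simp add: contract_def)

lemma kron_sample_Cons_scalar_prod:
  assumes x: "x \<in> carrier_vec (n ^ length (i # js))"
  shows "kron_sample n (i # js) \<omega> \<bullet> x = kron_sample n js \<omega> \<bullet> contract n (n ^ length js) x (\<omega> i)"
proof -
  let ?D = "n ^ length js" and ?K = "kron_sample n js \<omega>"
  have "kron_sample n (i # js) \<omega> \<bullet> x = (\<Sum>p<n * ?D. kron_sample n (i # js) \<omega> $ p * x $ p)"
    using x by (simp add: scalar_prod_def atLeast0LessThan)
  also have "\<dots> = (\<Sum>a<n. \<Sum>m<?D. kron_sample n (i # js) \<omega> $ (a * ?D + m) * x $ (a * ?D + m))"
    by (rule sum_lessThan_mult)
  also have "\<dots> = (\<Sum>a<n. \<Sum>m<?D. \<omega> i a * ?K $ m * x $ (a * ?D + m))"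
  proof (intro sum.cong refl)
    fix a m assume am: "a \<in> {..<n}" "m \<in> {..<?D}"
    then have "a * ?D + m < Suc a * ?D" by simp
    also have "\<dots> \<le> n * ?D" using am by (intro mult_right_mono) auto
    finally show "kron_sample n (i # js) \<omega> $ (a * ?D + m) * x $ (a * ?D + m) = \<omega> i a * ?K $ m * x $ (a * ?D + m)"
      using am by (simp add: kron_sample_Cons kron_vec_def)
  qed
  also have "\<dots> = (\<Sum>m<?D. \<Sum>a<n. \<omega> i a * ?K $ m * x $ (a * ?D + m))"
    by (rule sum.swap)
  also have "\<dots> = ?K \<bullet> contract n ?D x (\<omega> i)"
    by (simp add: scalar_prod_def atLeast0LessThan contract_def sum_distrib_left mult_ac)
  finally show ?thesis .
qed

lemma sq_norm2_eq_sum: "x \<in> carrier_vec d \<Longrightarrow> sq_norm2 x = (\<Sum>i<d. (x $ i)\<^sup>2)"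
  by (simp add: sq_norm2_def scalar_prod_def power2_eq_square atLeast0LessThan)

lemma sq_norm2_nonneg: "0 \<le> sq_norm2 x"
  using sq_norm2_eq_sum[of x "dim_vec x"] by (simp add: sum_nonneg)

lemma sq_norm2_contract:
  "sq_norm2 (contract n D x y) = (\<Sum>m<D. (\<Sum>a<n. x $ (a * D + m) * y a)\<^sup>2)"
  by (subst sq_norm2_eq_sum[OF contract_carrier]) (simp add: contract_def)

lemma sq_norm2_eq_double_sum:
  assumes "x \<in> carrier_vec (n * D)"
  shows "sq_norm2 x = (\<Sum>m<D. \<Sum>a<n. (x $ (a * D + m))\<^sup>2)"
  unfolding sq_norm2_eq_sum[OF assms] sum_lessThan_mult by (rule sum.swap)

section \<open>Iterated integration over the factors\<close>

lemma measurable_PiM_vector_component: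
  assumes vl: "vector_law n \<nu>" and "i \<in> J" "a < n"
  shows "(\<lambda>\<omega>. \<omega> i a) \<in> borel_measurable (PiM J (\<lambda>_. \<nu>))"
  using measurable_comp[OF measurable_component_singleton[OF assms(2), of "\<lambda>_. \<nu>"]
      vector_law_measurable_component[OF vl assms(3)]]
  by (simp add: comp_def)

lemma measurable_kron_sample:
  assumes vl: "vector_law n \<nu>" and "set js \<subseteq> J" "p < n ^ length js"
  shows "(\<lambda>\<omega>. kron_sample n js \<omega> $ p) \<in> borel_measurable (PiM J (\<lambda>_. \<nu>))"
  using assms(2,3)
proof (induction js arbitrary: p)
  case Nil
  then show ?case by (simp add: kron_sample_Nil)
next
  case (Cons i js)
  have n0: "0 < n ^ length js" using Cons.prems(2) by (cases "n ^ length js = 0") auto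
  have "p div n ^ length js < n" using Cons.prems(2) n0 by (simp add: less_mult_imp_div_less)
  moreover have "p mod n ^ length js < n ^ length js" using n0 by simp
  ultimately have "(\<lambda>\<omega>. \<omega> i (p div n ^ length js) * kron_sample n js \<omega> $ (p mod n ^ length js)) \<in> borel_measurable (PiM J (\<lambda>_. \<nu>))"
    using Cons.prems(1) by (intro borel_measurable_times measurable_PiM_vector_component[OF vl] Cons.IH) auto
  then show ?case
    using Cons.prems(2) \<open>p div n ^ length js < n\<close> by (simp add: kron_sample_Cons kron_vec_def)
qed

lemma measurable_kron_sample_scalar_prod:
  assumes vl: "vector_law n \<nu>" and "set js \<subseteq> J" "x \<in> carrier_vec (n ^ length js)"
  shows "(\<lambda>\<omega>. kron_sample n js \<omega> \<bullet> x) \<in> borel_measurable (PiM J (\<lambda>_. \<nu>))"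
  using assms(3) unfolding scalar_prod_def
  by (intro borel_measurable_sum borel_measurable_times measurable_kron_sample[OF vl assms(2)]) auto

text \<open>The head factor is integrated last, so that the inner integral is an instance of the
  induction hypothesis at the contracted vector.\<close>

lemma kron_sample_nn_integral_Cons:
  fixes g :: "real \<Rightarrow> ennreal"
  assumes vl: "vector_law n \<nu>" and d: "distinct (i # js)" and x: "x \<in> carrier_vec (n ^ length (i # js))"
    and [measurable]: "g \<in> borel_measurable borel"
  shows "(\<integral>\<^sup>+\<omega>. g (kron_sample n (i # js) \<omega> \<bullet> x) \<partial>PiM (set (i # js)) (\<lambda>_. \<nu>))
    = (\<integral>\<^sup>+y. \<integral>\<^sup>+\<omega>. g (kron_sample n js \<omega> \<bullet> contract n (n ^ length js) x y) \<partial>PiM (set js) (\<lambda>_. \<nu>) \<partial>\<nu>)"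
proof -
  interpret N: prob_space \<nu> using vl by (simp add: vector_law_def)
  interpret product_sigma_finite "\<lambda>_. \<nu>" ..
  have "(\<lambda>\<omega>. kron_sample n (i # js) \<omega> \<bullet> x) \<in> borel_measurable (PiM (insert i (set js)) (\<lambda>_. \<nu>))"
    by (rule measurable_kron_sample_scalar_prod[OF vl _ x]) auto
  then have "(\<integral>\<^sup>+\<omega>. g (kron_sample n (i # js) \<omega> \<bullet> x) \<partial>PiM (insert i (set js)) (\<lambda>_. \<nu>))
    = (\<integral>\<^sup>+y. \<integral>\<^sup>+\<omega>. g (kron_sample n (i # js) (fun_upd \<omega> i y) \<bullet> x) \<partial>PiM (set js) (\<lambda>_. \<nu>) \<partial>\<nu>)"
    using d by (subst product_nn_integral_insert_rev) auto
  also have "\<dots> = (\<integral>\<^sup>+y. \<integral>\<^sup>+\<omega>. g (kron_sample n js \<omega> \<bullet> contract n (n ^ length js) x y) \<partial>PiM (set js) (\<lambda>_. \<nu>) \<partial>\<nu>)"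
    using d by (simp add: kron_sample_Cons_scalar_prod[OF x] kron_sample_upd)
  finally show ?thesis by simp
qed

text \<open>Given the head factor, the others contribute one \<open>B\<close> each and leave the
  squared norm of the contraction, a quadratic form in the head factor.
  \<open>neg_moment_quadratic\<close> averages it for one more \<open>B\<close>, with the same
  \<epsilon> throughout.\<close>

lemma kron_sample_neg_moment:
  fixes js :: "'i list"
  assumes vl: "vector_law n \<nu>" and nm: "neg_moment n B \<nu>" and \<epsilon>: "0 < \<epsilon>" and B: "0 \<le> B"
    and "distinct js" "x \<in> carrier_vec (n ^ length js)"
  shows "(\<integral>\<^sup>+\<omega>. ennreal (((kron_sample n js \<omega> \<bullet> x)\<^sup>2 + \<epsilon>) powr (- 1 / 8)) \<partial>PiM (set js) (\<lambda>_. \<nu>))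
    \<le> ennreal (B ^ length js * (sq_norm2 x + \<epsilon>) powr (- 1 / 8))"
  using assms(5,6)
proof (induction js arbitrary: x)
  case Nil
  interpret N: prob_space \<nu> using vl by (simp add: vector_law_def)
  have "vec 1 (\<lambda>_. 1) \<bullet> x = x $ 0" using Nil by (simp add: scalar_prod_def)
  then show ?case using Nil
    using prob_space.emeasure_space_1[OF prob_space_PiM[of "{} :: 'i set" "\<lambda>_. \<nu>"]] N.prob_space_axioms
    by (simp add: kron_sample_Nil sq_norm2_eq_sum[of x 1])
next
  case (Cons i js)
  let ?D = "n ^ length js"
  let ?g = "\<lambda>t. ennreal ((t\<^sup>2 + \<epsilon>) powr (- 1 / 8))"
  have "(\<integral>\<^sup>+\<omega>. ?g (kron_sample n (i # js) \<omega> \<bullet> x) \<partial>PiM (set (i # js)) (\<lambda>_. \<nu>))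
    = (\<integral>\<^sup>+y. \<integral>\<^sup>+\<omega>. ?g (kron_sample n js \<omega> \<bullet> contract n ?D x y) \<partial>PiM (set js) (\<lambda>_. \<nu>) \<partial>\<nu>)"
    by (rule kron_sample_nn_integral_Cons[OF vl Cons.prems]) measurable
  also have "\<dots> \<le> (\<integral>\<^sup>+y. ennreal (B ^ length js) * ennreal (((\<Sum>m<?D. (\<Sum>a<n. x $ (a * ?D + m) * y a)\<^sup>2) + \<epsilon>) powr (- 1 / 8)) \<partial>\<nu>)"
    using Cons.IH[of "contract n ?D x _"] Cons.prems B
    by (intro nn_integral_mono) (simp add: sq_norm2_contract ennreal_mult[symmetric])
  also have "\<dots> = ennreal (B ^ length js) * (\<integral>\<^sup>+y. ennreal (((\<Sum>m<?D. (\<Sum>a<n. x $ (a * ?D + m) * y a)\<^sup>2) + \<epsilon>) powr (- 1 / 8)) \<partial>\<nu>)"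
  proof (rule nn_integral_cmult)
    have [measurable]: "i < n \<Longrightarrow> (\<lambda>x. x i) \<in> borel_measurable \<nu>" for i
      by (rule vector_law_measurable_component[OF vl])
    show "(\<lambda>y. ennreal (((\<Sum>m<?D. (\<Sum>a<n. x $ (a * ?D + m) * y a)\<^sup>2) + \<epsilon>) powr (- 1 / 8))) \<in> borel_measurable \<nu>"
      by measurable
  qed
  also have "\<dots> \<le> ennreal (B ^ length js) * ennreal (B * ((\<Sum>m<?D. \<Sum>a<n. (x $ (a * ?D + m))\<^sup>2) + \<epsilon>) powr (- 1 / 8))"
    by (intro mult_left_mono neg_moment_quadratic[OF vl nm \<epsilon>]) simp
  also have "\<dots> = ennreal (B ^ length (i # js) * (sq_norm2 x + \<epsilon>) powr (- 1 / 8))"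
    using Cons.prems(2) B by (subst sq_norm2_eq_double_sum[of x n ?D]) (auto simp: ennreal_mult[symmetric] mult_ac)
  finally show ?case .
qed

text \<open>The same recursion as for the negative moments; isotropy makes every step an
  equality.\<close>

lemma kron_sample_second_moment:
  fixes js :: "'i list"
  assumes vl: "vector_law n \<nu>" and iso: "isotropic n \<nu>"
    and "distinct js" "x \<in> carrier_vec (n ^ length js)"
  shows "(\<integral>\<^sup>+\<omega>. ennreal ((kron_sample n js \<omega> \<bullet> x)\<^sup>2) \<partial>PiM (set js) (\<lambda>_. \<nu>)) = ennreal (sq_norm2 x)"
  using assms(3,4)
proof (induction js arbitrary: x)
  case Nil
  interpret N: prob_space \<nu> using vl by (simp add: vector_law_def)
  have "vec 1 (\<lambda>_. 1) \<bullet> x = x $ 0" using Nil by (simp add: scalar_prod_def)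
  then show ?case using Nil
    using prob_space.emeasure_space_1[OF prob_space_PiM[of "{} :: 'i set" "\<lambda>_. \<nu>"]] N.prob_space_axioms
    by (simp add: kron_sample_Nil sq_norm2_eq_sum[of x 1])
next
  case (Cons i js)
  let ?D = "n ^ length js"
  have [measurable]: "i < n \<Longrightarrow> (\<lambda>x. x i) \<in> borel_measurable \<nu>" for i
    by (rule vector_law_measurable_component[OF vl])
  have "(\<integral>\<^sup>+\<omega>. ennreal ((kron_sample n (i # js) \<omega> \<bullet> x)\<^sup>2) \<partial>PiM (set (i # js)) (\<lambda>_. \<nu>))
    = (\<integral>\<^sup>+y. \<integral>\<^sup>+\<omega>. ennreal ((kron_sample n js \<omega> \<bullet> contract n ?D x y)\<^sup>2) \<partial>PiM (set js) (\<lambda>_. \<nu>) \<partial>\<nu>)"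
    by (rule kron_sample_nn_integral_Cons[OF vl Cons.prems, where g="\<lambda>t. ennreal (t\<^sup>2)"]) measurable
  also have "\<dots> = (\<integral>\<^sup>+y. (\<Sum>m<?D. ennreal ((\<Sum>a<n. x $ (a * ?D + m) * y a)\<^sup>2)) \<partial>\<nu>)"
    using Cons.IH[of "contract n ?D x _"] Cons.prems
    by (intro nn_integral_cong) (simp add: sq_norm2_contract sum_ennreal)
  also have "\<dots> = (\<Sum>m<?D. \<integral>\<^sup>+y. ennreal ((\<Sum>a<n. x $ (a * ?D + m) * y a)\<^sup>2) \<partial>\<nu>)"
    by (rule nn_integral_sum) measurable
  also have "\<dots> = (\<Sum>m<?D. ennreal (\<Sum>a<n. (x $ (a * ?D + m))\<^sup>2))"
    by (intro sum.cong refl isotropic_linear_nn_integral[OF vl iso])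
  also have "\<dots> = ennreal (sq_norm2 x)"
    using Cons.prems(2) by (subst sq_norm2_eq_double_sum[of x n ?D]) (auto simp: sum_ennreal sum_nonneg)
  finally show ?case .
qed

text \<open>Markov's inequality for the negative moment with the shift set to the threshold: on the
  event the shifted square is at most \<open>2 * \<tau>\<close>.\<close>

lemma kron_sample_small_ball:
  assumes vl: "vector_law n \<nu>" and nm: "neg_moment n B \<nu>" and B: "0 \<le> B" and \<tau>: "0 < \<tau>"
    and d: "distinct js" and x: "x \<in> carrier_vec (n ^ length js)" and x1: "1 \<le> sq_norm2 x"
  shows "emeasure (PiM (set js) (\<lambda>_. \<nu>)) {\<omega> \<in> space (PiM (set js) (\<lambda>_. \<nu>)). (kron_sample n js \<omega> \<bullet> x)\<^sup>2 \<le> \<tau>}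
    \<le> ennreal (B ^ length js * (2 * \<tau>) powr (1 / 8))"
proof -
  let ?P = "PiM (set js) (\<lambda>_. \<nu>)" and ?K = "\<lambda>\<omega>. kron_sample n js \<omega> \<bullet> x"
  have [measurable]: "?K \<in> borel_measurable ?P"
    by (rule measurable_kron_sample_scalar_prod[OF vl subset_refl x])
  let ?E = "{\<omega> \<in> space ?P. (?K \<omega>)\<^sup>2 \<le> \<tau>}"
  have "emeasure ?P ?E = (\<integral>\<^sup>+\<omega>. indicator ?E \<omega> \<partial>?P)" by simp
  also have "\<dots> \<le> (\<integral>\<^sup>+\<omega>. ennreal ((2 * \<tau>) powr (1 / 8)) * ennreal (((?K \<omega>)\<^sup>2 + \<tau>) powr (- 1 / 8)) \<partial>?P)"
  proof (rule nn_integral_mono)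
    fix \<omega>
    show "indicator ?E \<omega> \<le> ennreal ((2 * \<tau>) powr (1 / 8)) * ennreal (((?K \<omega>)\<^sup>2 + \<tau>) powr (- 1 / 8))"
    proof (cases "\<omega> \<in> ?E")
      case True
      have "(2 * \<tau>) powr (- 1 / 8) \<le> ((?K \<omega>)\<^sup>2 + \<tau>) powr (- 1 / 8)"
        using True \<tau> by (intro powr_mono2') (auto simp: add_nonneg_pos)
      then have "(2 * \<tau>) powr (1 / 8) * (2 * \<tau>) powr (- 1 / 8) \<le> (2 * \<tau>) powr (1 / 8) * ((?K \<omega>)\<^sup>2 + \<tau>) powr (- 1 / 8)"
        by (intro mult_left_mono) auto
      moreover have "(2 * \<tau>) powr (1 / 8) * (2 * \<tau>) powr (- 1 / 8) = 1"
        using \<tau> by (simp add: powr_add[symmetric])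
      ultimately have "ennreal 1 \<le> ennreal ((2 * \<tau>) powr (1 / 8) * ((?K \<omega>)\<^sup>2 + \<tau>) powr (- 1 / 8))"
        by (intro ennreal_leI) (simp only:)
      then show ?thesis using True by (simp add: ennreal_mult)
    qed simp
  qed
  also have "\<dots> = ennreal ((2 * \<tau>) powr (1 / 8)) * (\<integral>\<^sup>+\<omega>. ennreal (((?K \<omega>)\<^sup>2 + \<tau>) powr (- 1 / 8)) \<partial>?P)"
    by (rule nn_integral_cmult) measurable
  also have "\<dots> \<le> ennreal ((2 * \<tau>) powr (1 / 8)) * ennreal (B ^ length js * (sq_norm2 x + \<tau>) powr (- 1 / 8))"
    by (intro mult_left_mono kron_sample_neg_moment[OF vl nm \<tau> B d x]) simp
  also have "\<dots> \<le> ennreal ((2 * \<tau>) powr (1 / 8)) * ennreal (B ^ length js * 1)"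
  proof (intro mult_left_mono ennreal_leI)
    have "(sq_norm2 x + \<tau>) powr (- 1 / 8) \<le> 1 powr (- 1 / 8)"
      using x1 \<tau> by (intro powr_mono2') auto
    then show "(sq_norm2 x + \<tau>) powr (- 1 / 8) \<le> 1" by simp
  qed (use B in auto)
  also have "\<dots> = ennreal (B ^ length js * (2 * \<tau>) powr (1 / 8))"
    using B by (simp add: ennreal_mult[symmetric] mult.commute)
  finally show ?thesis .
qed

section \<open>Vertices of polytopes\<close>

lemma mult_mat_vec_eq_zero_imp:
  fixes A :: "real mat"
  assumes A: "A \<in> carrier_mat r r" and det: "det A \<noteq> 0" and w: "w \<in> carrier_vec r"
    and rows: "\<And>i. i < r \<Longrightarrow> row A i \<bullet> w = 0"
  shows "w = 0\<^sub>v r"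
proof (rule ccontr)
  assume "w \<noteq> 0\<^sub>v r"
  moreover have "A *\<^sub>v w = 0\<^sub>v r" using A rows by (intro eq_vecI) auto
  ultimately show False using det_0_iff_vec_prod_zero_field[OF A] det w by blast
qed

lemma sq_norm2_line_ge:
  assumes x: "x \<in> carrier_vec d" and y: "y \<in> carrier_vec d" and xy: "0 \<le> x \<bullet> y" and s: "0 \<le> s"
  shows "sq_norm2 x \<le> sq_norm2 (x + s \<cdot>\<^sub>v y)"
proof -
  have "sq_norm2 (x + s \<cdot>\<^sub>v y) = (\<Sum>i<d. (x $ i)\<^sup>2 + 2 * s * (x $ i * y $ i) + s\<^sup>2 * (y $ i)\<^sup>2)"
    using x y by (subst sq_norm2_eq_sum[of _ d]) (auto intro!: sum.cong simp: power2_eq_square algebra_simps)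
  also have "\<dots> = sq_norm2 x + 2 * s * (x \<bullet> y) + s\<^sup>2 * sq_norm2 y"
    using y by (simp add: sum.distrib sum_distrib_left[symmetric] sq_norm2_eq_sum[OF x] sq_norm2_eq_sum[OF y]
        scalar_prod_def atLeast0LessThan)
  finally show ?thesis using xy s sq_norm2_nonneg[of y] by simp
qed

text \<open>A feasible point that is not a vertex is moved along a line on which all constraints selected so
  far stay active and the norm does not decrease, until a further constraint becomes active. The rows
  of \<open>A\<close> are the selected constraints, completed to an invertible matrix.\<close>

lemma ex_vertex_step:
  fixes g :: "'t \<Rightarrow> real vec" and U :: "real mat"
  assumes T: "finite T" and g: "\<And>t. t \<in> T \<Longrightarrow> g t \<in> carrier_vec r"
    and unit: "\<And>i. i < r \<Longrightarrow> \<exists>t\<in>T. g t = unit_vec r i" and U: "U \<in> carrier_mat d r"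
    and c: "c \<in> carrier_vec r" and feas: "\<And>t. t \<in> T \<Longrightarrow> \<bar>g t \<bullet> c\<bar> \<le> \<beta> t"
    and A: "A \<in> carrier_mat r r" and det: "det A \<noteq> 0" and m: "m < r"
    and act: "\<And>i. i < m \<Longrightarrow> \<sigma> i \<in> T \<and> row A i = g (\<sigma> i) \<and> \<bar>g (\<sigma> i) \<bullet> c\<bar> = \<beta> (\<sigma> i)"
  shows "\<exists>c' A' \<sigma>'. c' \<in> carrier_vec r \<and> (\<forall>t\<in>T. \<bar>g t \<bullet> c'\<bar> \<le> \<beta> t) \<and> sq_norm2 (U *\<^sub>v c) \<le> sq_norm2 (U *\<^sub>v c') \<and>
     A' \<in> carrier_mat r r \<and> det A' \<noteq> 0 \<and>
     (\<forall>i<Suc m. \<sigma>' i \<in> T \<and> row A' i = g (\<sigma>' i) \<and> \<bar>g (\<sigma>' i) \<bullet> c'\<bar> = \<beta> (\<sigma>' i))"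
proof -
  \<comment> \<open>Column \<open>m\<close> of the adjugate is orthogonal to every row of
    \<open>A\<close> except row \<open>m\<close>, so motion along it leaves the selected constraints
    at their values.\<close>
  define v0 where "v0 = adj_mat A *\<^sub>v unit_vec r m"
  have v0c: "v0 \<in> carrier_vec r" using adj_mat[OF A] by (simp add: v0_def)
  have Av0: "A *\<^sub>v v0 = det A \<cdot>\<^sub>v unit_vec r m"
  proof -
    have "A *\<^sub>v v0 = (A * adj_mat A) *\<^sub>v unit_vec r m"
      unfolding v0_def using A adj_mat[OF A] by (intro assoc_mult_mat_vec[symmetric]) auto
    also have "\<dots> = (det A \<cdot>\<^sub>m 1\<^sub>m r) *\<^sub>v unit_vec r m" using adj_mat[OF A] by simp
    also have "\<dots> = det A \<cdot>\<^sub>v unit_vec r m" by (intro eq_vecI) (auto simp: m)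
    finally show ?thesis .
  qed
  have rowv0: "row A i \<bullet> v0 = (if i = m then det A else 0)" if "i < r" for i
  proof -
    have "row A i \<bullet> v0 = (A *\<^sub>v v0) $ i" using A that by simp
    then show ?thesis unfolding Av0 using that m by simp
  qed
  \<comment> \<open>The sign makes the norm of the image under \<open>U\<close> nondecreasing along
    the ray.\<close>
  define e :: real where "e = (if 0 \<le> (U *\<^sub>v c) \<bullet> (U *\<^sub>v v0) then 1 else - 1)"
  define v where "v = e \<cdot>\<^sub>v v0"
  have e0: "e \<noteq> 0" by (simp add: e_def)
  have vc: "v \<in> carrier_vec r" using v0c by (simp add: v_def)
  note Uc = mult_mat_vec_carrier[OF U c] and Uv = mult_mat_vec_carrier[OF U vc]
    and Uv0 = mult_mat_vec_carrier[OF U v0c]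
  have Uv_eq: "U *\<^sub>v v = e \<cdot>\<^sub>v (U *\<^sub>v v0)" unfolding v_def by (rule mult_mat_vec[OF U v0c])
  have inner: "0 \<le> (U *\<^sub>v c) \<bullet> (U *\<^sub>v v)"
    unfolding Uv_eq scalar_prod_smult_distrib[OF Uc Uv0] by (simp add: e_def)
  have gv: "g t \<bullet> v = e * (g t \<bullet> v0)" if "t \<in> T" for t
    unfolding v_def by (rule scalar_prod_smult_distrib[OF g[OF that] v0c])
  have v0nz: "v0 \<noteq> 0\<^sub>v r"
  proof
    assume "v0 = 0\<^sub>v r"
    then have "row A m \<bullet> v0 = 0" using A by (simp add: scalar_prod_def)
    with rowv0[OF m] det show False by simp
  qed
  define S where "S = {t \<in> T. g t \<bullet> v \<noteq> 0}"
  \<comment> \<open>The unit vectors among the constraints keep the ray from staying feasible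
    forever.\<close>
  have "S \<noteq> {}"
  proof -
    have "\<exists>i<r. v0 $ i \<noteq> 0"
    proof (rule ccontr)
      assume "\<not> ?thesis"
      then have "v0 = 0\<^sub>v r" using v0c by (intro eq_vecI) auto
      with v0nz show False by simp
    qed
    then obtain i where i: "i < r" "v0 $ i \<noteq> 0" by blast
    obtain t where t: "t \<in> T" "g t = unit_vec r i" using unit[OF i(1)] by blast
    have "g t \<bullet> v = e * v0 $ i" using gv[OF t(1)] t(2) v0c i(1) by simp
    then show ?thesis using t(1) i(2) e0 by (auto simp: S_def)
  qed
  \<comment> \<open>The step length at which constraint \<open>t\<close> becomes active; the
    smallest one is taken, as in the ratio test of the simplex method.\<close>
  define \<tau> where "\<tau> t = (\<beta> t - sgn (g t \<bullet> v) * (g t \<bullet> c)) / \<bar>g t \<bullet> v\<bar>" for t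
  have Sfin: "finite S" using T by (simp add: S_def)
  have "Min (\<tau> ` S) \<in> \<tau> ` S" using Sfin \<open>S \<noteq> {}\<close> by (intro Min_in) auto
  then obtain t0 where t0: "t0 \<in> S" "\<tau> t0 = Min (\<tau> ` S)" by auto
  have t0_le: "\<tau> t0 \<le> \<tau> t" if "t \<in> S" for t
    unfolding t0(2) using Sfin that by (intro Min_le) auto
  define s where "s = \<tau> t0"
  have sgn_le: "sgn (g t \<bullet> v) * (g t \<bullet> c) \<le> \<beta> t \<and> - \<beta> t \<le> sgn (g t \<bullet> v) * (g t \<bullet> c)" if "t \<in> T" for t
    using feas[OF that] by (auto simp: sgn_if)
  have s0: "0 \<le> s" unfolding s_def \<tau>_def using sgn_le t0(1) by (intro divide_nonneg_nonneg) (auto simp: S_def)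
  define c' where "c' = c + s \<cdot>\<^sub>v v"
  have c'c: "c' \<in> carrier_vec r" using c vc by (simp add: c'_def)
  have gc': "g t \<bullet> c' = g t \<bullet> c + s * (g t \<bullet> v)" if "t \<in> T" for t
    unfolding c'_def using c vc g[OF that]
    by (simp add: scalar_prod_add_distrib[of _ r] scalar_prod_smult_distrib[of _ r])
  have sg: "sgn (g t \<bullet> v) * (g t \<bullet> c') = sgn (g t \<bullet> v) * (g t \<bullet> c) + s * \<bar>g t \<bullet> v\<bar>" if "t \<in> T" for t
    unfolding gc'[OF that] by (simp add: distrib_left abs_sgn mult_ac)
  have abs_sgn_mult: "\<bar>y\<bar> = \<bar>sgn b * y\<bar>" if "b \<noteq> 0" for b y :: real
    using that by (simp add: abs_mult sgn_if)
  have feas': "\<bar>g t \<bullet> c'\<bar> \<le> \<beta> t" if t: "t \<in> T" for t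
  proof (cases "g t \<bullet> v = 0")
    case True
    then show ?thesis using feas[OF t] gc'[OF t] by simp
  next
    case False
    then have "s \<le> \<tau> t" unfolding s_def using t by (intro t0_le) (simp add: S_def)
    then have "s * \<bar>g t \<bullet> v\<bar> \<le> \<beta> t - sgn (g t \<bullet> v) * (g t \<bullet> c)"
      using False by (simp add: \<tau>_def pos_le_divide_eq)
    then have "sgn (g t \<bullet> v) * (g t \<bullet> c') \<le> \<beta> t" using sg[OF t] by simp
    moreover have "0 \<le> s * \<bar>g t \<bullet> v\<bar>" using s0 by simp
    then have "- \<beta> t \<le> sgn (g t \<bullet> v) * (g t \<bullet> c')" using sg[OF t] sgn_le[OF t] by linarith
    ultimately have "\<bar>sgn (g t \<bullet> v) * (g t \<bullet> c')\<bar> \<le> \<beta> t" by linarith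
    then show ?thesis by (simp only: abs_sgn_mult[OF False, of "g t \<bullet> c'"])
  qed
  have t0T: "t0 \<in> T" and gt0: "g t0 \<bullet> v \<noteq> 0" using t0(1) by (auto simp: S_def)
  have act0: "\<bar>g t0 \<bullet> c'\<bar> = \<beta> t0"
  proof -
    have "s * \<bar>g t0 \<bullet> v\<bar> = \<beta> t0 - sgn (g t0 \<bullet> v) * (g t0 \<bullet> c)" using gt0 by (simp add: s_def \<tau>_def)
    then have "sgn (g t0 \<bullet> v) * (g t0 \<bullet> c') = \<beta> t0" using sg[OF t0T] by simp
    moreover have "0 \<le> \<beta> t0" using feas[OF t0T] by linarith
    ultimately have "\<bar>sgn (g t0 \<bullet> v) * (g t0 \<bullet> c')\<bar> = \<beta> t0" by simp
    then show ?thesis by (simp only: abs_sgn_mult[OF gt0, of "g t0 \<bullet> c'"])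
  qed
  have norm: "sq_norm2 (U *\<^sub>v c) \<le> sq_norm2 (U *\<^sub>v c')"
  proof -
    have "U *\<^sub>v c' = U *\<^sub>v c + s \<cdot>\<^sub>v (U *\<^sub>v v)"
      unfolding c'_def using U c vc by (simp add: mult_add_distrib_mat_vec[of _ d r] mult_mat_vec[of _ d r])
    then show ?thesis using sq_norm2_line_ge[OF Uc Uv inner s0] by simp
  qed
  define A' where "A' = mat r r (\<lambda>(i, j). if i = m then g t0 $ j else A $$ (i, j))"
  define \<sigma>' where "\<sigma>' = \<sigma>(m := t0)"
  have A'c: "A' \<in> carrier_mat r r" by (simp add: A'_def)
  have rowA'm: "row A' m = g t0" using m g[OF t0T] by (intro eq_vecI) (auto simp: A'_def)
  have rowA': "row A' i = row A i" if "i < r" "i \<noteq> m" for i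
    using that A by (intro eq_vecI) (auto simp: A'_def)
  \<comment> \<open>A kernel vector of \<open>A'\<close> is orthogonal to all rows of
    \<open>A\<close> but row \<open>m\<close>, hence a multiple of \<open>v0\<close>; since
    \<open>g t0\<close> is not orthogonal to \<open>v0\<close>, the multiple is 0.\<close>
  have detA': "det A' \<noteq> 0"
  proof
    assume "det A' = 0"
    then obtain w where w: "w \<in> carrier_vec r" "w \<noteq> 0\<^sub>v r" "A' *\<^sub>v w = 0\<^sub>v r"
      using det_0_iff_vec_prod_zero_field[OF A'c] by blast
    have rw: "row A' i \<bullet> w = 0" if "i < r" for i
      using arg_cong[OF w(3), of "\<lambda>x. x $ i"] A'c that by simp
    define \<theta> where "\<theta> = row A m \<bullet> w"
    have "A *\<^sub>v w = \<theta> \<cdot>\<^sub>v unit_vec r m"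
    proof (rule eq_vecI)
      fix i assume i: "i < dim_vec (\<theta> \<cdot>\<^sub>v unit_vec r m)"
      then show "(A *\<^sub>v w) $ i = (\<theta> \<cdot>\<^sub>v unit_vec r m) $ i"
        using A m rw[of i] rowA'[of i] by (cases "i = m") (auto simp: \<theta>_def)
    qed (use A in simp)
    then have "adj_mat A *\<^sub>v (A *\<^sub>v w) = \<theta> \<cdot>\<^sub>v v0"
      unfolding v0_def using adj_mat[OF A] by (simp add: mult_mat_vec[of _ r r])
    moreover have "adj_mat A *\<^sub>v (A *\<^sub>v w) = det A \<cdot>\<^sub>v w"
    proof -
      have "adj_mat A *\<^sub>v (A *\<^sub>v w) = (adj_mat A * A) *\<^sub>v w"
        using A adj_mat[OF A] w by (intro assoc_mult_mat_vec[symmetric]) auto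
      also have "\<dots> = (det A \<cdot>\<^sub>m 1\<^sub>m r) *\<^sub>v w" using adj_mat[OF A] by simp
      also have "\<dots> = det A \<cdot>\<^sub>v w" using w(1) by (intro eq_vecI) auto
      finally show ?thesis .
    qed
    ultimately have dw: "det A \<cdot>\<^sub>v w = \<theta> \<cdot>\<^sub>v v0" by simp
    have "g t0 \<bullet> (det A \<cdot>\<^sub>v w) = 0"
      using rw[OF m] rowA'm w(1) g[OF t0T] by (simp add: scalar_prod_smult_distrib[of _ r])
    then have "\<theta> * (g t0 \<bullet> v0) = 0" unfolding dw using g[OF t0T] v0c by (simp add: scalar_prod_smult_distrib[of _ r])
    moreover have "g t0 \<bullet> v0 \<noteq> 0" using gt0 gv[OF t0T] by auto
    ultimately have "\<theta> = 0" by simp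
    then have "row A i \<bullet> w = 0" if "i < r" for i
      using rw[OF that] rowA'[OF that] by (cases "i = m") (auto simp: \<theta>_def)
    then have "w = 0\<^sub>v r" by (rule mult_mat_vec_eq_zero_imp[OF A det w(1)])
    with w(2) show False by simp
  qed
  have act': "\<sigma>' i \<in> T \<and> row A' i = g (\<sigma>' i) \<and> \<bar>g (\<sigma>' i) \<bullet> c'\<bar> = \<beta> (\<sigma>' i)" if i: "i < Suc m" for i
  proof (cases "i = m")
    case True
    show ?thesis unfolding \<sigma>'_def True fun_upd_same using t0T rowA'm act0 by (intro conjI)
  next
    case False
    then have im: "i < m" using i by simp
    have ir: "i < r" using im m by simp
    have "g (\<sigma> i) \<bullet> v = 0" using gv act[OF im] rowv0[OF ir] False by simp
    then show ?thesis using act[OF im] rowA'[OF ir False] gc' False by (simp add: \<sigma>'_def)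
  qed
  show ?thesis
    using c'c feas' norm A'c detA' act' by blast
qed

text \<open>After \<open>r\<close> steps the matrix consists of active constraints. Its
  invertibility shows both that these are distinct and that they determine the vertex once the signs
  are known.\<close>

lemma ex_vertex:
  fixes g :: "'t \<Rightarrow> real vec" and U :: "real mat"
  assumes T: "finite T" and g: "\<And>t. t \<in> T \<Longrightarrow> g t \<in> carrier_vec r"
    and unit: "\<And>i. i < r \<Longrightarrow> \<exists>t\<in>T. g t = unit_vec r i" and U: "U \<in> carrier_mat d r"
    and c0: "c0 \<in> carrier_vec r" and feas: "\<And>t. t \<in> T \<Longrightarrow> \<bar>g t \<bullet> c0\<bar> \<le> \<beta> t"
  shows "\<exists>c I. c \<in> carrier_vec r \<and> I \<subseteq> T \<and> card I = r \<and> sq_norm2 (U *\<^sub>v c0) \<le> sq_norm2 (U *\<^sub>v c) \<and>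
    (\<forall>t\<in>T. \<bar>g t \<bullet> c\<bar> \<le> \<beta> t) \<and> (\<forall>t\<in>I. \<bar>g t \<bullet> c\<bar> = \<beta> t) \<and>
    (\<forall>w\<in>carrier_vec r. (\<forall>t\<in>I. g t \<bullet> w = 0) \<longrightarrow> w = 0\<^sub>v r)"
proof -
  have "m \<le> r \<Longrightarrow> \<exists>c A \<sigma>. c \<in> carrier_vec r \<and> (\<forall>t\<in>T. \<bar>g t \<bullet> c\<bar> \<le> \<beta> t) \<and> sq_norm2 (U *\<^sub>v c0) \<le> sq_norm2 (U *\<^sub>v c) \<and>
     A \<in> carrier_mat r r \<and> det A \<noteq> 0 \<and>
     (\<forall>i<m. \<sigma> i \<in> T \<and> row A i = g (\<sigma> i) \<and> \<bar>g (\<sigma> i) \<bullet> c\<bar> = \<beta> (\<sigma> i))" for m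
  proof (induction m)
    case 0
    \<comment> \<open>The identity matrix is filler whose rows are replaced one at a time by active
      constraints.\<close>
    show ?case using c0 feas by (intro exI[of _ c0] exI[of _ "1\<^sub>m r"]) auto
  next
    case (Suc m)
    then obtain c A \<sigma> where IH: "c \<in> carrier_vec r" "\<forall>t\<in>T. \<bar>g t \<bullet> c\<bar> \<le> \<beta> t"
      "sq_norm2 (U *\<^sub>v c0) \<le> sq_norm2 (U *\<^sub>v c)" "A \<in> carrier_mat r r" "det A \<noteq> 0"
      "\<forall>i<m. \<sigma> i \<in> T \<and> row A i = g (\<sigma> i) \<and> \<bar>g (\<sigma> i) \<bullet> c\<bar> = \<beta> (\<sigma> i)" by auto
    obtain c' A' \<sigma>' where st: "c' \<in> carrier_vec r" "\<forall>t\<in>T. \<bar>g t \<bullet> c'\<bar> \<le> \<beta> t" "sq_norm2 (U *\<^sub>v c) \<le> sq_norm2 (U *\<^sub>v c')"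
     "A' \<in> carrier_mat r r" "det A' \<noteq> 0"
     "\<forall>i<Suc m. \<sigma>' i \<in> T \<and> row A' i = g (\<sigma>' i) \<and> \<bar>g (\<sigma>' i) \<bullet> c'\<bar> = \<beta> (\<sigma>' i)"
      using ex_vertex_step[OF T g unit U IH(1) _ IH(4,5), of \<beta> m \<sigma>] IH(2,6) Suc.prems by (auto simp: Suc_le_eq)
    show ?case
      using st order_trans[OF IH(3) st(3)] by blast
  qed
  from this[OF order_refl] obtain c A \<sigma> where c: "c \<in> carrier_vec r" "\<forall>t\<in>T. \<bar>g t \<bullet> c\<bar> \<le> \<beta> t"
    "sq_norm2 (U *\<^sub>v c0) \<le> sq_norm2 (U *\<^sub>v c)" and A: "A \<in> carrier_mat r r" "det A \<noteq> 0"
    and \<sigma>: "\<And>i. i < r \<Longrightarrow> \<sigma> i \<in> T" "\<And>i. i < r \<Longrightarrow> row A i = g (\<sigma> i)"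
      "\<And>i. i < r \<Longrightarrow> \<bar>g (\<sigma> i) \<bullet> c\<bar> = \<beta> (\<sigma> i)" by blast
  have inj: "inj_on \<sigma> {..<r}"
  proof (rule inj_onI, rule ccontr)
    fix i j assume ij: "i \<in> {..<r}" "j \<in> {..<r}" "\<sigma> i = \<sigma> j" "i \<noteq> j"
    then have "row A i = row A j" using \<sigma>(2) by simp
    then have "det A = 0" using det_identical_rows[OF A(1) ij(4)] ij by simp
    with A(2) show False by simp
  qed
  have "w = 0\<^sub>v r" if "w \<in> carrier_vec r" "\<forall>t\<in>\<sigma> ` {..<r}. g t \<bullet> w = 0" for w
    using that \<sigma>(2) by (intro mult_mat_vec_eq_zero_imp[OF A]) auto
  then show ?thesis
    using c \<sigma>(1,3) card_image[OF inj] by (intro exI[of _ c] exI[of _ "\<sigma> ` {..<r}"]) auto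
qed

section \<open>Coordinates on a subspace\<close>

text \<open>A finite basis has to be found before \<open>dim\<close> can be evaluated. Independent
  subsets of \<open>V\<close> are independent in the ambient space and so have at most
  \<open>d\<close> elements; a maximal one is a basis, to which Gram-Schmidt applies.\<close>

lemma subspace_orthogonal_basis:
  assumes V: "subspace_of_dim d r V"
  shows "\<exists>us. set us \<subseteq> carrier_vec d \<and> length us = r \<and> corthogonal us \<and>
    V = (\<lambda>c. mat_of_cols d us *\<^sub>v c) ` carrier_vec r"
proof -
  interpret M: cof_vec_space d "TYPE(real)" .
  have sub: "VectorSpace.subspace class_ring V M.V" and dimV: "vectorspace.dim class_ring (M.V\<lparr>carrier := V\<rparr>) = r"
    using V by (auto simp: subspace_of_dim_def)
  interpret W: vectorspace "class_ring :: real ring" "M.V\<lparr>carrier := V\<rparr>"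
    by (rule M.subspace_is_vs[OF sub])
  have subm: "submodule class_ring V M.V" using sub by (rule M.is_module)
  have Vc: "V \<subseteq> carrier_vec d" using subm by (simp add: submodule_def)
  have dep: "W.lin_dep S = M.lin_dep S" and spn: "W.span S = M.span S" if "S \<subseteq> V" for S
    using M.span_li_not_depend[OF that subm] by auto
  have "\<exists>A. finite A \<and> maximal A (\<lambda>S. S \<subseteq> carrier (M.V\<lparr>carrier := V\<rparr>) \<and> \<not> W.lin_dep S)"
  proof (rule maximal_exists[where N=d])
    fix A assume "A \<subseteq> carrier (M.V\<lparr>carrier := V\<rparr>) \<and> \<not> W.lin_dep A"
    then have A: "A \<subseteq> V" "\<not> M.lin_dep A" using dep by auto
    show "finite A \<and> card A \<le> d"
      using M.li_le_dim[OF M.fin_dim _ A(2)] A(1) Vc by (auto simp: M.dim_is_n)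
  next
    show "{} \<subseteq> carrier (M.V\<lparr>carrier := V\<rparr>) \<and> \<not> W.lin_dep {}"
      by (simp add: W.lin_dep_def)
  qed
  then obtain A where A: "finite A" "maximal A (\<lambda>S. S \<subseteq> carrier (M.V\<lparr>carrier := V\<rparr>) \<and> \<not> W.lin_dep S)" by blast
  have bas: "W.basis A" by (rule W.max_li_is_basis[OF A(2)])
  then have AV: "A \<subseteq> V" and "\<not> W.lin_dep A" and "W.span A = V" by (auto simp: W.basis_def)
  then have ind: "\<not> M.lin_dep A" and span: "M.span A = V" using dep[OF AV] spn[OF AV] by auto
  have cardA: "card A = r" using W.dim_basis[OF A(1) bas] dimV by simp
  obtain ws where ws: "set ws = A" "distinct ws" using finite_distinct_list[OF A(1)] by blast
  define us where "us = gram_schmidt d ws"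
  have gs: "M.span (set ws) = M.span (set us)" "corthogonal us" "set us \<subseteq> carrier_vec d" "length us = length ws"
    using M.gram_schmidt_result[OF _ ws(2) _ us_def] ws(1) AV Vc ind by auto
  have len: "length us = r" using gs(4) ws cardA distinct_card by metis
  have "V = M.span_list us" using gs(1) ws(1) span M.span_list_as_span[OF gs(3)] by simp
  also have "\<dots> = range (\<lambda>c. mat_of_cols d us *\<^sub>v vec r c)"
    using gs(3) len by (auto simp: M.span_list_def M.lincomb_list_as_mat_mult subset_eq)
  also have "\<dots> = (\<lambda>c. mat_of_cols d us *\<^sub>v c) ` carrier_vec r"
  proof (intro equalityI subsetI)
    fix x assume "x \<in> (\<lambda>c. mat_of_cols d us *\<^sub>v c) ` carrier_vec r"
    then obtain c where "c \<in> carrier_vec r" "x = mat_of_cols d us *\<^sub>v c" by auto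
    moreover from this have "vec r (\<lambda>i. c $ i) = c" by (intro eq_vecI) auto
    ultimately show "x \<in> range (\<lambda>c. mat_of_cols d us *\<^sub>v vec r c)" by (metis rangeI)
  qed auto
  finally show ?thesis using gs len by blast
qed

lemma scalar_prod_square_le:
  assumes "x \<in> carrier_vec d" "y \<in> carrier_vec d"
  shows "(x \<bullet> y)\<^sup>2 \<le> sq_norm2 x * sq_norm2 y"
  using Cauchy_Schwarz_ineq_sum[of "\<lambda>i. x $ i" "\<lambda>i. y $ i" "{..<d}"] assms
  by (simp add: scalar_prod_def atLeast0LessThan sq_norm2_eq_sum)

text \<open>The inner product with column \<open>i\<close> isolates coordinate \<open>i\<close> by
  orthogonality, and Cauchy-Schwarz bounds that coordinate by the reciprocal length of the column.
  These bounds are the box of the polytope.\<close>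

lemma subspace_coordinates:
  assumes V: "subspace_of_dim d r V"
  shows "\<exists>U b. U \<in> carrier_mat d r \<and> V = (\<lambda>c. U *\<^sub>v c) ` carrier_vec r \<and>
    (\<forall>c\<in>carrier_vec r. sq_norm2 (U *\<^sub>v c) \<le> 1 \<longrightarrow> (\<forall>i<r. \<bar>c $ i\<bar> \<le> b i))"
proof -
  obtain us where us: "set us \<subseteq> carrier_vec d" "length us = r" "corthogonal us"
    "V = (\<lambda>c. mat_of_cols d us *\<^sub>v c) ` carrier_vec r"
    using subspace_orthogonal_basis[OF V] by blast
  define U where "U = mat_of_cols d us"
  have U: "U \<in> carrier_mat d r" using us(2) by (auto simp: U_def)
  have uc: "us ! i \<in> carrier_vec d" if "i < r" for i using us(1,2) that by (auto dest: nth_mem)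
  have orth: "us ! j \<bullet> us ! i = 0 \<longleftrightarrow> j \<noteq> i" if "i < r" "j < r" for i j
    using corthogonalD[OF us(3), of j i] that us(2) by simp
  define b where "b i = 1 / sqrt (sq_norm2 (us ! i))" for i
  have "\<bar>c $ i\<bar> \<le> b i" if c: "c \<in> carrier_vec r" and le: "sq_norm2 (U *\<^sub>v c) \<le> 1" and i: "i < r" for c i
  proof -
    let ?u = "us ! i" and ?x = "U *\<^sub>v c"
    have x: "?x \<in> carrier_vec d" by (rule mult_mat_vec_carrier[OF U c])
    have n0: "0 < sq_norm2 ?u" using orth[OF i i] sq_norm2_nonneg[of ?u] by (simp add: sq_norm2_def)
    have "?x \<bullet> ?u = (\<Sum>p<d. (\<Sum>j<r. us ! j $ p * c $ j) * ?u $ p)"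
      using uc[OF i] U c us(2) by (auto simp: scalar_prod_def atLeast0LessThan U_def mat_of_cols_index intro!: sum.cong)
    also have "\<dots> = (\<Sum>p<d. \<Sum>j<r. c $ j * (us ! j $ p * ?u $ p))"
      by (simp add: sum_distrib_left mult_ac)
    also have "\<dots> = (\<Sum>j<r. c $ j * (us ! j \<bullet> ?u))"
      using uc[OF i] by (subst sum.swap) (simp add: sum_distrib_left scalar_prod_def atLeast0LessThan)
    also have "\<dots> = (\<Sum>j<r. if j = i then c $ i * sq_norm2 ?u else 0)"
      using orth[OF i] by (intro sum.cong refl) (auto simp: sq_norm2_def)
    also have "\<dots> = c $ i * sq_norm2 ?u" using i by simp
    finally have "(c $ i * sq_norm2 ?u)\<^sup>2 \<le> sq_norm2 ?x * sq_norm2 ?u"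
      using scalar_prod_square_le[OF x uc[OF i]] by simp
    also have "\<dots> \<le> 1 * sq_norm2 ?u" using le n0 by (intro mult_right_mono) auto
    finally have "(c $ i)\<^sup>2 * sq_norm2 ?u * sq_norm2 ?u \<le> 1 * sq_norm2 ?u" by (simp add: power2_eq_square mult_ac)
    then have "(c $ i)\<^sup>2 * sq_norm2 ?u \<le> 1" using n0 by simp
    then have "(c $ i)\<^sup>2 \<le> 1 / sq_norm2 ?u" using n0 by (simp add: pos_le_divide_eq)
    then have "sqrt ((c $ i)\<^sup>2) \<le> sqrt (1 / sq_norm2 ?u)" by (rule real_sqrt_le_mono)
    then show ?thesis by (simp add: b_def real_sqrt_divide)
  qed
  then show ?thesis using U us(4) unfolding U_def by blast
qed

section \<open>Columns of the test matrix\<close>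

definition column_index :: "nat \<Rightarrow> nat \<Rightarrow> (nat \<times> nat) list" where
  "column_index l j = map (Pair j) [0..<l]"

lemma set_column_index: "set (column_index l j) = {j} \<times> {..<l}"
  by (auto simp: column_index_def)

lemma distinct_column_index: "distinct (column_index l j)"
  by (simp add: column_index_def distinct_map inj_on_def)

lemma length_column_index [simp]: "length (column_index l j) = l"
  by (simp add: column_index_def)

definition KR_column :: "nat \<Rightarrow> nat \<Rightarrow> nat \<Rightarrow> (nat \<times> nat \<Rightarrow> nat \<Rightarrow> real) \<Rightarrow> real vec" where
  "KR_column n l j \<omega> = kron_sample n (column_index l j) \<omega>"

lemma KR_column_carrier [simp]: "KR_column n l j \<omega> \<in> carrier_vec (n ^ l)"
  using kron_sample_carrier[of n "column_index l j" \<omega>] by (simp add: KR_column_def)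

lemma KR_column_cong:
  assumes "\<And>i. i < l \<Longrightarrow> \<omega> (j, i) = \<omega>' (j, i)"
  shows "KR_column n l j \<omega> = KR_column n l j \<omega>'"
  unfolding KR_column_def kron_sample_def
  using assms by (intro arg_cong[where f=kron_list] map_cong) (auto simp: set_column_index)

lemma KR_matrix_eq:
  "KR_matrix n l k \<omega> = (1 / sqrt (real k)) \<cdot>\<^sub>m mat_of_cols (n ^ l) (map (\<lambda>j. KR_column n l j \<omega>) [0..<k])"
  by (simp add: KR_matrix_def KR_column_def kron_sample_def column_index_def comp_def)

lemma sq_norm2_KR_matrix:
  assumes x: "x \<in> carrier_vec (n ^ l)" and k: "0 < k"
  shows "sq_norm2 ((KR_matrix n l k \<omega>)\<^sup>T *\<^sub>v x) = (\<Sum>j<k. (KR_column n l j \<omega> \<bullet> x)\<^sup>2) / real k"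
proof -
  have carr: "(KR_matrix n l k \<omega>)\<^sup>T *\<^sub>v x \<in> carrier_vec k"
    by (intro carrier_vecI) (simp add: KR_matrix_eq)
  have comp: "((KR_matrix n l k \<omega>)\<^sup>T *\<^sub>v x) $ j = (KR_column n l j \<omega> \<bullet> x) / sqrt (real k)" if j: "j < k" for j
  proof -
    have "((KR_matrix n l k \<omega>)\<^sup>T *\<^sub>v x) $ j = col (KR_matrix n l k \<omega>) j \<bullet> x"
      using j by (simp add: KR_matrix_eq)
    also have "col (KR_matrix n l k \<omega>) j = (1 / sqrt (real k)) \<cdot>\<^sub>v KR_column n l j \<omega>"
      using j carrier_vecD[OF KR_column_carrier[of n l j \<omega>]]
      by (intro eq_vecI) (auto simp: KR_matrix_eq mat_of_cols_index)
    finally show ?thesis using smult_scalar_prod_distrib[OF KR_column_carrier x] by simp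
  qed
  have "sq_norm2 ((KR_matrix n l k \<omega>)\<^sup>T *\<^sub>v x) = (\<Sum>j<k. ((KR_column n l j \<omega> \<bullet> x) / sqrt (real k))\<^sup>2)"
    unfolding sq_norm2_eq_sum[OF carr] by (intro sum.cong refl) (simp add: comp)
  then show ?thesis by (simp add: power_divide sum_divide_distrib)
qed

section \<open>Measurability, moments and independence of the columns\<close>

lemma measurable_KR_column_scalar_prod:
  assumes "vector_law n \<nu>" "{j} \<times> {..<l} \<subseteq> J" "x \<in> carrier_vec (n ^ l)"
  shows "(\<lambda>\<omega>. KR_column n l j \<omega> \<bullet> x) \<in> borel_measurable (PiM J (\<lambda>_. \<nu>))"
  unfolding KR_column_def using assms by (intro measurable_kron_sample_scalar_prod) (auto simp: set_column_index)

lemma measurable_KR_column_entry: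
  assumes "vector_law n \<nu>" "{j} \<times> {..<l} \<subseteq> J" "p < n ^ l"
  shows "(\<lambda>\<omega>. KR_column n l j \<omega> $ p) \<in> borel_measurable (PiM J (\<lambda>_. \<nu>))"
  unfolding KR_column_def using assms by (intro measurable_kron_sample) (auto simp: set_column_index)

lemma random_matrix_KR:
  assumes vl: "vector_law n \<nu>"
  shows "random_matrix (KR_space l k \<nu>) (n ^ l) k (KR_matrix n l k)"
  unfolding random_matrix_def
proof (intro conjI allI impI ballI)
  interpret N: prob_space \<nu> using vl by (simp add: vector_law_def)
  show "prob_space (KR_space l k \<nu>)"
    unfolding KR_space_def by (intro prob_space_PiM N.prob_space_axioms)
  show "KR_matrix n l k \<omega> \<in> carrier_mat (n ^ l) k" for \<omega>
    unfolding KR_matrix_eq by (intro smult_carrier_mat mat_of_cols_carrier[where vs="map _ [0..<k]", simplified])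
  fix i j assume "i < n ^ l" "j < k"
  then show "(\<lambda>\<omega>. KR_matrix n l k \<omega> $$ (i, j)) \<in> borel_measurable (KR_space l k \<nu>)"
    unfolding KR_space_def using measurable_KR_column_entry[OF vl, of j l "{..<k} \<times> {..<l}" i]
    by (simp add: KR_matrix_eq mat_of_cols_index lessThan_def) (auto intro!: borel_measurable_divide)
qed

lemma KR_column_second_moment:
  assumes vl: "vector_law n \<nu>" and iso: "isotropic n \<nu>" and j: "j < k" and x: "x \<in> carrier_vec (n ^ l)"
  shows "(\<integral>\<^sup>+\<omega>. ennreal ((KR_column n l j \<omega> \<bullet> x)\<^sup>2) \<partial>KR_space l k \<nu>) = ennreal (sq_norm2 x)"
proof -
  interpret N: prob_space \<nu> using vl by (simp add: vector_law_def)
  interpret product_prob_space "\<lambda>_. \<nu>" UNIV by (intro product_prob_spaceI N.prob_space_axioms)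
  let ?I = "{j} \<times> {..<l}" and ?J = "{..<k} \<times> {..<l}"
  have sub: "?I \<subseteq> ?J" using j by auto
  have "ennreal (sq_norm2 x) = (\<integral>\<^sup>+\<omega>. ennreal ((KR_column n l j \<omega> \<bullet> x)\<^sup>2) \<partial>PiM ?I (\<lambda>_. \<nu>))"
    using kron_sample_second_moment[OF vl iso distinct_column_index, of x l j] x
    by (simp add: KR_column_def set_column_index)
  also have "PiM ?I (\<lambda>_. \<nu>) = distr (PiM ?J (\<lambda>_. \<nu>)) (PiM ?I (\<lambda>_. \<nu>)) (\<lambda>f. restrict f ?I)"
    by (rule distr_restrict[OF sub]) simp
  also have "(\<integral>\<^sup>+\<omega>. ennreal ((KR_column n l j \<omega> \<bullet> x)\<^sup>2) \<partial>\<dots>) = (\<integral>\<^sup>+\<omega>. ennreal ((KR_column n l j (restrict \<omega> ?I) \<bullet> x)\<^sup>2) \<partial>PiM ?J (\<lambda>_. \<nu>))"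
    using measurable_KR_column_scalar_prod[OF vl subset_refl x, of j]
    by (intro nn_integral_distr measurable_restrict_subset sub) auto
  also have "\<dots> = (\<integral>\<^sup>+\<omega>. ennreal ((KR_column n l j \<omega> \<bullet> x)\<^sup>2) \<partial>PiM ?J (\<lambda>_. \<nu>))"
  proof -
    have "KR_column n l j (restrict \<omega> ?I) = KR_column n l j \<omega>" for \<omega> :: "nat \<times> nat \<Rightarrow> nat \<Rightarrow> real"
      by (rule KR_column_cong) simp
    then show ?thesis by simp
  qed
  finally show ?thesis by (simp add: KR_space_def)
qed

lemma KR_matrix_expectation:
  assumes vl: "vector_law n \<nu>" and iso: "isotropic n \<nu>" and k: "0 < k" and x: "x \<in> carrier_vec (n ^ l)"
  shows "integrable (KR_space l k \<nu>) (\<lambda>\<omega>. sq_norm2 ((KR_matrix n l k \<omega>)\<^sup>T *\<^sub>v x))"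
    and "(LINT \<omega>|KR_space l k \<nu>. sq_norm2 ((KR_matrix n l k \<omega>)\<^sup>T *\<^sub>v x)) = sq_norm2 x"
proof -
  let ?P = "KR_space l k \<nu>" and ?f = "\<lambda>j \<omega>. (KR_column n l j \<omega> \<bullet> x)\<^sup>2"
  have meas: "?f j \<in> borel_measurable ?P" if "j < k" for j
    unfolding KR_space_def using that
    by (intro borel_measurable_power measurable_KR_column_scalar_prod[OF vl _ x]) auto
  have int: "integrable ?P (?f j)" and val: "(LINT \<omega>|?P. ?f j \<omega>) = sq_norm2 x" if "j < k" for j
  proof -
    have *: "(\<integral>\<^sup>+\<omega>. ennreal (?f j \<omega>) \<partial>?P) = ennreal (sq_norm2 x)"
      by (rule KR_column_second_moment[OF vl iso that x])
    show "integrable ?P (?f j)" using * meas[OF that] by (intro integrableI_nonneg) auto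
    show "(LINT \<omega>|?P. ?f j \<omega>) = sq_norm2 x"
      using * meas[OF that] by (subst integral_eq_nn_integral) (auto simp: sq_norm2_nonneg)
  qed
  show "integrable ?P (\<lambda>\<omega>. sq_norm2 ((KR_matrix n l k \<omega>)\<^sup>T *\<^sub>v x))"
    unfolding sq_norm2_KR_matrix[OF x k] using int by (intro integrable_divide Bochner_Integration.integrable_sum) auto
  have "(LINT \<omega>|?P. sq_norm2 ((KR_matrix n l k \<omega>)\<^sup>T *\<^sub>v x)) = (LINT \<omega>|?P. (\<Sum>j<k. ?f j \<omega>)) / real k"
    unfolding sq_norm2_KR_matrix[OF x k] by simp
  also have "(LINT \<omega>|?P. (\<Sum>j<k. ?f j \<omega>)) = (\<Sum>j<k. LINT \<omega>|?P. ?f j \<omega>)"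
    using int by (intro Bochner_Integration.integral_sum) auto
  also have "\<dots> = real k * sq_norm2 x" using val by simp
  finally show "(LINT \<omega>|?P. sq_norm2 ((KR_matrix n l k \<omega>)\<^sup>T *\<^sub>v x)) = sq_norm2 x" using k by simp
qed

text \<open>Different columns read disjoint blocks of the sample, so the integral of the product
  factorizes.\<close>

lemma KR_columns_small_ball_fixed:
  assumes vl: "vector_law n \<nu>" and x: "x \<in> carrier_vec (n ^ l)" and fin: "finite J"
    and p: "\<And>j. emeasure (PiM ({j} \<times> {..<l}) (\<lambda>_. \<nu>))
      {\<omega> \<in> space (PiM ({j} \<times> {..<l}) (\<lambda>_. \<nu>)). (KR_column n l j \<omega> \<bullet> x)\<^sup>2 \<le> \<tau>} \<le> p"
  shows "(\<integral>\<^sup>+\<omega>. (\<Prod>j\<in>J. indicator {y. y\<^sup>2 \<le> \<tau>} (KR_column n l j \<omega> \<bullet> x)) \<partial>PiM (J \<times> {..<l}) (\<lambda>_. \<nu>)) \<le> p ^ card J"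
  using fin
proof (induction J rule: finite_induct)
  case empty
  interpret N: prob_space \<nu> using vl by (simp add: vector_law_def)
  show ?case
    using prob_space.emeasure_space_1[OF prob_space_PiM[of "{} :: (nat \<times> nat) set" "\<lambda>_. \<nu>"]] N.prob_space_axioms by simp
next
  case (insert j J)
  interpret N: prob_space \<nu> using vl by (simp add: vector_law_def)
  interpret product_sigma_finite "\<lambda>_. \<nu>" ..
  let ?h = "\<lambda>j \<omega>. indicator {y. y\<^sup>2 \<le> \<tau>} (KR_column n l j \<omega> \<bullet> x) :: ennreal"
  let ?I = "{j} \<times> {..<l}" and ?K = "J \<times> {..<l}"
  have un: "insert j J \<times> {..<l} = ?I \<union> ?K" by auto
  have disj: "?I \<inter> ?K = {}" using insert.hyps by auto
  have meas: "?h i \<in> borel_measurable (PiM S (\<lambda>_. \<nu>))" if "{i} \<times> {..<l} \<subseteq> S" for i S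
    using measurable_KR_column_scalar_prod[OF vl that x] by measurable
  have "(\<integral>\<^sup>+\<omega>. (\<Prod>i\<in>insert j J. ?h i \<omega>) \<partial>PiM (?I \<union> ?K) (\<lambda>_. \<nu>))
      = (\<integral>\<^sup>+\<omega>. \<integral>\<^sup>+\<omega>'. (\<Prod>i\<in>insert j J. ?h i (merge ?I ?K (\<omega>, \<omega>'))) \<partial>PiM ?K (\<lambda>_. \<nu>) \<partial>PiM ?I (\<lambda>_. \<nu>))"
  proof (rule product_nn_integral_fold[OF disj])
    show "(\<lambda>\<omega>. \<Prod>i\<in>insert j J. ?h i \<omega>) \<in> borel_measurable (PiM (?I \<union> ?K) (\<lambda>_. \<nu>))"
      by (intro borel_measurable_prod_ennreal meas) auto
  qed (use insert.hyps in auto)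
  also have "\<dots> = (\<integral>\<^sup>+\<omega>. \<integral>\<^sup>+\<omega>'. ?h j \<omega> * (\<Prod>i\<in>J. ?h i \<omega>') \<partial>PiM ?K (\<lambda>_. \<nu>) \<partial>PiM ?I (\<lambda>_. \<nu>))"
  proof (intro nn_integral_cong)
    fix \<omega> \<omega>' :: "nat \<times> nat \<Rightarrow> nat \<Rightarrow> real"
    have "KR_column n l j (merge ?I ?K (\<omega>, \<omega>')) = KR_column n l j \<omega>"
      by (rule KR_column_cong) (auto simp: merge_def)
    moreover have "KR_column n l i (merge ?I ?K (\<omega>, \<omega>')) = KR_column n l i \<omega>'" if "i \<in> J" for i
      using that insert.hyps by (intro KR_column_cong) (auto simp: merge_def)
    ultimately show "(\<Prod>i\<in>insert j J. ?h i (merge ?I ?K (\<omega>, \<omega>'))) = ?h j \<omega> * (\<Prod>i\<in>J. ?h i \<omega>')"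
      using insert.hyps by simp
  qed
  also have "\<dots> = (\<integral>\<^sup>+\<omega>. ?h j \<omega> * (\<integral>\<^sup>+\<omega>'. (\<Prod>i\<in>J. ?h i \<omega>') \<partial>PiM ?K (\<lambda>_. \<nu>)) \<partial>PiM ?I (\<lambda>_. \<nu>))"
    by (intro nn_integral_cong nn_integral_cmult borel_measurable_prod_ennreal meas) auto
  also have "\<dots> = (\<integral>\<^sup>+\<omega>. ?h j \<omega> \<partial>PiM ?I (\<lambda>_. \<nu>)) * (\<integral>\<^sup>+\<omega>'. (\<Prod>i\<in>J. ?h i \<omega>') \<partial>PiM ?K (\<lambda>_. \<nu>))"
    by (intro nn_integral_multc meas) auto
  also have "\<dots> \<le> p * p ^ card J"
  proof (intro mult_mono insert.IH)
    have "(\<integral>\<^sup>+\<omega>. ?h j \<omega> \<partial>PiM ?I (\<lambda>_. \<nu>)) = (\<integral>\<^sup>+\<omega>. indicator {\<omega> \<in> space (PiM ?I (\<lambda>_. \<nu>)). (KR_column n l j \<omega> \<bullet> x)\<^sup>2 \<le> \<tau>} \<omega> \<partial>PiM ?I (\<lambda>_. \<nu>))"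
      by (intro nn_integral_cong) (auto simp: indicator_def)
    also have "\<dots> = emeasure (PiM ?I (\<lambda>_. \<nu>)) {\<omega> \<in> space (PiM ?I (\<lambda>_. \<nu>)). (KR_column n l j \<omega> \<bullet> x)\<^sup>2 \<le> \<tau>}"
      using measurable_KR_column_scalar_prod[OF vl subset_refl x, of j] by (intro nn_integral_indicator) measurable
    also have "\<dots> \<le> p" by (rule p)
    finally show "(\<integral>\<^sup>+\<omega>. ?h j \<omega> \<partial>PiM ?I (\<lambda>_. \<nu>)) \<le> p" .
  qed auto
  also have "\<dots> = p ^ card (insert j J)" using insert.hyps by simp
  finally show ?case unfolding un .
qed

text \<open>\<open>Xa\<close> says that \<open>X\<close> reads none of the columns in
  \<open>J\<close>. With the other columns fixed, \<open>X\<close> is a constant vector, and Fubini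
  reduces the claim to \<open>KR_columns_small_ball_fixed\<close>.\<close>

lemma KR_columns_small_ball_adapted:
  fixes X :: "(nat \<times> nat \<Rightarrow> nat \<Rightarrow> real) \<Rightarrow> real vec"
  assumes vl: "vector_law n \<nu>" and J: "J \<subseteq> {..<k}"
    and Xc: "\<And>\<omega>. X \<omega> \<in> carrier_vec (n ^ l)"
    and Xm: "\<And>q. q < n ^ l \<Longrightarrow> (\<lambda>\<omega>. X \<omega> $ q) \<in> borel_measurable (KR_space l k \<nu>)"
    and Xa: "\<And>\<omega> \<omega>'. (\<And>j i. j < k \<Longrightarrow> j \<notin> J \<Longrightarrow> i < l \<Longrightarrow> \<omega> (j, i) = \<omega>' (j, i)) \<Longrightarrow> X \<omega> = X \<omega>'"
    and p: "\<And>x j. x \<in> carrier_vec (n ^ l) \<Longrightarrow> 1 \<le> sq_norm2 x \<Longrightarrow> emeasure (PiM ({j} \<times> {..<l}) (\<lambda>_. \<nu>))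
      {\<omega> \<in> space (PiM ({j} \<times> {..<l}) (\<lambda>_. \<nu>)). (KR_column n l j \<omega> \<bullet> x)\<^sup>2 \<le> \<tau>} \<le> p"
  shows "{\<omega> \<in> space (KR_space l k \<nu>). 1 \<le> sq_norm2 (X \<omega>) \<and> (\<forall>j\<in>J. (KR_column n l j \<omega> \<bullet> X \<omega>)\<^sup>2 \<le> \<tau>)} \<in> sets (KR_space l k \<nu>)"
    (is "?E \<in> _")
    and "emeasure (KR_space l k \<nu>) {\<omega> \<in> space (KR_space l k \<nu>). 1 \<le> sq_norm2 (X \<omega>) \<and> (\<forall>j\<in>J. (KR_column n l j \<omega> \<bullet> X \<omega>)\<^sup>2 \<le> \<tau>)} \<le> p ^ card J"
proof -
  interpret N: prob_space \<nu> using vl by (simp add: vector_law_def)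
  interpret product_sigma_finite "\<lambda>_. \<nu>" ..
  let ?P = "KR_space l k \<nu>"
  have finJ: "finite J" using J finite_subset by blast
  have mS: "(\<lambda>\<omega>. sq_norm2 (X \<omega>)) \<in> borel_measurable ?P"
    unfolding sq_norm2_eq_sum[OF Xc] using Xm by (intro borel_measurable_sum borel_measurable_power) auto
  have mC: "(\<lambda>\<omega>. KR_column n l j \<omega> \<bullet> X \<omega>) \<in> borel_measurable ?P" if "j \<in> J" for j
  proof -
    have "(\<lambda>\<omega>. \<Sum>q<n ^ l. KR_column n l j \<omega> $ q * X \<omega> $ q) \<in> borel_measurable ?P"
      unfolding KR_space_def using that J Xm[unfolded KR_space_def]
      by (intro borel_measurable_sum borel_measurable_times measurable_KR_column_entry[OF vl]) auto
    then show ?thesis using carrier_vecD[OF Xc] by (simp add: scalar_prod_def atLeast0LessThan)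
  qed
  let ?F = "\<lambda>\<omega>. indicator {1..} (sq_norm2 (X \<omega>)) * (\<Prod>j\<in>J. indicator {y. y\<^sup>2 \<le> \<tau>} (KR_column n l j \<omega> \<bullet> X \<omega>)) :: ennreal"
  have mF: "?F \<in> borel_measurable ?P"
  proof (intro borel_measurable_times_ennreal borel_measurable_prod_ennreal)
    show "(\<lambda>\<omega>. indicator {1..} (sq_norm2 (X \<omega>)) :: ennreal) \<in> borel_measurable ?P" using mS by measurable
    show "(\<lambda>\<omega>. indicator {y. y\<^sup>2 \<le> \<tau>} (KR_column n l j \<omega> \<bullet> X \<omega>) :: ennreal) \<in> borel_measurable ?P" if "j \<in> J" for j
      using mC[OF that] by measurable
  qed
  show E: "?E \<in> sets ?P"
  proof -
    have "?E = {\<omega> \<in> space ?P. 1 \<le> sq_norm2 (X \<omega>)} \<inter> {\<omega> \<in> space ?P. \<forall>j\<in>J. (KR_column n l j \<omega> \<bullet> X \<omega>)\<^sup>2 \<le> \<tau>}" by auto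
    also have "\<dots> \<in> sets ?P"
    proof (intro sets.Int sets.sets_Collect_finite_All finJ)
      show "{\<omega> \<in> space ?P. 1 \<le> sq_norm2 (X \<omega>)} \<in> sets ?P" using mS by measurable
      show "{\<omega> \<in> space ?P. (KR_column n l j \<omega> \<bullet> X \<omega>)\<^sup>2 \<le> \<tau>} \<in> sets ?P" if "j \<in> J" for j
        using mC[OF that] by measurable
    qed
    finally show ?thesis .
  qed
  let ?I = "({..<k} - J) \<times> {..<l}" and ?K = "J \<times> {..<l}"
  have un: "{..<k} \<times> {..<l} = ?I \<union> ?K" using J by auto
  have disj: "?I \<inter> ?K = {}" by auto
  have "emeasure ?P ?E = (\<integral>\<^sup>+\<omega>. indicator ?E \<omega> \<partial>?P)" using E by simp
  also have "\<dots> = (\<integral>\<^sup>+\<omega>. ?F \<omega> \<partial>?P)"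
    using finJ by (intro nn_integral_cong) (auto simp: indicator_def prod_zero_iff)
  also have "\<dots> = (\<integral>\<^sup>+\<omega>. ?F \<omega> \<partial>PiM (?I \<union> ?K) (\<lambda>_. \<nu>))" by (simp only: KR_space_def un)
  also have "\<dots> = (\<integral>\<^sup>+\<omega>. \<integral>\<^sup>+\<omega>'. ?F (merge ?I ?K (\<omega>, \<omega>')) \<partial>PiM ?K (\<lambda>_. \<nu>) \<partial>PiM ?I (\<lambda>_. \<nu>))"
    using mF finJ unfolding KR_space_def un by (intro product_nn_integral_fold[OF disj]) auto
  also have "\<dots> \<le> (\<integral>\<^sup>+\<omega>. p ^ card J \<partial>PiM ?I (\<lambda>_. \<nu>))"
  proof (rule nn_integral_mono)
    fix \<omega>
    have Xm: "X (merge ?I ?K (\<omega>, \<omega>')) = X \<omega>" for \<omega>'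
      by (rule Xa) (auto simp: merge_def)
    have Cm: "KR_column n l j (merge ?I ?K (\<omega>, \<omega>')) = KR_column n l j \<omega>'" if "j \<in> J" for j \<omega>'
      using that by (intro KR_column_cong) (auto simp: merge_def)
    have F: "?F (merge ?I ?K (\<omega>, \<omega>')) = indicator {1..} (sq_norm2 (X \<omega>)) * (\<Prod>j\<in>J. indicator {y. y\<^sup>2 \<le> \<tau>} (KR_column n l j \<omega>' \<bullet> X \<omega>))" for \<omega>'
      by (simp add: Xm Cm)
    show "(\<integral>\<^sup>+\<omega>'. ?F (merge ?I ?K (\<omega>, \<omega>')) \<partial>PiM ?K (\<lambda>_. \<nu>)) \<le> p ^ card J"
    proof (cases "1 \<le> sq_norm2 (X \<omega>)")
      case True
      then show ?thesis
        unfolding F using KR_columns_small_ball_fixed[OF vl Xc finJ p[OF Xc True]] by simp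
    next
      case False
      then show ?thesis unfolding F by simp
    qed
  qed
  also have "\<dots> = p ^ card J"
    using prob_space.emeasure_space_1[OF prob_space_PiM[of ?I "\<lambda>_. \<nu>"]] N.prob_space_axioms by simp
  finally show "emeasure ?P ?E \<le> p ^ card J" .
qed

section \<open>Vertices determined by random constraints\<close>

lemma borel_measurable_det:
  fixes A :: "'w \<Rightarrow> real mat"
  assumes A: "\<And>w. A w \<in> carrier_mat n n"
    and meas: "\<And>i j. i < n \<Longrightarrow> j < n \<Longrightarrow> (\<lambda>w. A w $$ (i, j)) \<in> borel_measurable M"
  shows "(\<lambda>w. det (A w)) \<in> borel_measurable M"
proof -
  have "(\<lambda>w. det (A w)) = (\<lambda>w. \<Sum>p\<in>{p. p permutes {0..<n}}. signof p * (\<Prod>i = 0..<n. A w $$ (i, p i)))"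
    by (intro ext det_def'[OF A])
  also have "\<dots> \<in> borel_measurable M"
    using permutes_in_image by (intro borel_measurable_sum borel_measurable_times borel_measurable_prod borel_measurable_const meas) fastforce+
  finally show ?thesis .
qed

lemma borel_measurable_adj_mat:
  fixes A :: "'w \<Rightarrow> real mat"
  assumes A: "\<And>w. A w \<in> carrier_mat n n"
    and meas: "\<And>i j. i < n \<Longrightarrow> j < n \<Longrightarrow> (\<lambda>w. A w $$ (i, j)) \<in> borel_measurable M"
    and ij: "i < n" "j < n"
  shows "(\<lambda>w. adj_mat (A w) $$ (i, j)) \<in> borel_measurable M"
proof -
  have "(\<lambda>w. adj_mat (A w) $$ (i, j)) = (\<lambda>w. (- 1) ^ (j + i) * det (mat_delete (A w) j i))"
    using ij by (simp add: adj_mat_def cofactor_def carrier_matD[OF A])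
  also have "\<dots> \<in> borel_measurable M"
  proof (intro borel_measurable_times borel_measurable_const borel_measurable_det[where n="n - 1"])
    show "mat_delete (A w) j i \<in> carrier_mat (n - 1) (n - 1)" for w
      using A by (rule mat_delete_carrier)
    fix a b assume ab: "a < n - 1" "b < n - 1"
    have "(\<lambda>w. mat_delete (A w) j i $$ (a, b)) = (\<lambda>w. A w $$ (if a < j then a else Suc a, if b < i then b else Suc b))"
      using ab carrier_matD[OF A] by (auto simp: mat_delete_def)
    also have "\<dots> \<in> borel_measurable M" using ab by (intro meas) auto
    finally show "(\<lambda>w. mat_delete (A w) j i $$ (a, b)) \<in> borel_measurable M" .
  qed
  finally show ?thesis .
qed

text \<open>Functionals in the coordinates of the subspace: indices below \<open>k\<close> stand for
  columns of the test matrix, index \<open>k + i\<close> for the box constraint on coordinate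
  \<open>i\<close>. One common range lets a choice of active constraints be a set of
  numbers.\<close>

definition constraint :: "nat \<Rightarrow> nat \<Rightarrow> nat \<Rightarrow> nat \<Rightarrow> real mat \<Rightarrow> (nat \<times> nat \<Rightarrow> nat \<Rightarrow> real) \<Rightarrow> nat \<Rightarrow> real vec" where
  "constraint n l k r U \<omega> t = (if t < k then U\<^sup>T *\<^sub>v KR_column n l t \<omega> else unit_vec r (t - k))"

definition constraint_mat :: "nat \<Rightarrow> nat \<Rightarrow> nat \<Rightarrow> nat \<Rightarrow> real mat \<Rightarrow> nat set \<Rightarrow> (nat \<times> nat \<Rightarrow> nat \<Rightarrow> real) \<Rightarrow> real mat" where
  "constraint_mat n l k r U I \<omega> =
     mat r r (\<lambda>(i, j). constraint n l k r U \<omega> (sorted_list_of_set I ! i) $ j)"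

text \<open>The solution, by Cramer's rule, of the linear system in which the constraints from \<open>I\<close> are active,
  with value \<open>\<beta> t\<close> for \<open>t \<in> S\<close> and \<open>- \<beta> t\<close> otherwise (a junk value if the system is singular).\<close>

definition vertex_point :: "nat \<Rightarrow> nat \<Rightarrow> nat \<Rightarrow> nat \<Rightarrow> real mat \<Rightarrow> (nat \<Rightarrow> real) \<Rightarrow> nat set \<Rightarrow> nat set \<Rightarrow>
    (nat \<times> nat \<Rightarrow> nat \<Rightarrow> real) \<Rightarrow> real vec" where
  "vertex_point n l k r U \<beta> I S \<omega> = (1 / det (constraint_mat n l k r U I \<omega>)) \<cdot>\<^sub>v
     (adj_mat (constraint_mat n l k r U I \<omega>) *\<^sub>v
        vec r (\<lambda>i. let t = sorted_list_of_set I ! i in if t \<in> S then \<beta> t else - \<beta> t))"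

context
  fixes n l k r :: nat and U :: "real mat"
  assumes U: "U \<in> carrier_mat (n ^ l) r"
begin

lemma constraint_carrier: "constraint n l k r U \<omega> t \<in> carrier_vec r"
  using U by (auto simp: constraint_def)

lemma constraint_scalar_prod:
  assumes "t < k" "c \<in> carrier_vec r"
  shows "constraint n l k r U \<omega> t \<bullet> c = KR_column n l t \<omega> \<bullet> (U *\<^sub>v c)"
proof -
  let ?y = "KR_column n l t \<omega>"
  have "U\<^sup>T *\<^sub>v ?y = vec r (\<lambda>j. ?y \<bullet> col U j)"
    using U by (intro eq_vecI) (auto intro!: comm_scalar_prod[of _ "n ^ l"])
  moreover have "U *\<^sub>v c = vec (n ^ l) (\<lambda>i. row U i \<bullet> c)"
    using U by (intro eq_vecI) auto
  ultimately show ?thesis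
    using assms(1) assoc_scalar_prod[OF KR_column_carrier U assms(2), of t \<omega>] by (simp add: constraint_def)
qed

lemma constraint_mat_carrier: "constraint_mat n l k r U I \<omega> \<in> carrier_mat r r"
  by (simp add: constraint_mat_def)

lemma vertex_point_carrier: "vertex_point n l k r U \<beta> I S \<omega> \<in> carrier_vec r"
  unfolding vertex_point_def
  by (intro smult_carrier_vec[THEN iffD2] mult_mat_vec_carrier[OF adj_mat(1)[OF constraint_mat_carrier]]) simp

lemma row_constraint_mat:
  "i < r \<Longrightarrow> row (constraint_mat n l k r U I \<omega>) i = constraint n l k r U \<omega> (sorted_list_of_set I ! i)"
  using carrier_vecD[OF constraint_carrier] by (intro eq_vecI) (auto simp: constraint_mat_def)

text \<open>Identifies the vertex supplied by \<open>ex_vertex\<close> with an explicit measurable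
  function of the columns in \<open>I\<close>; \<open>S\<close> records on which side each active
  constraint is attained.\<close>

lemma vertex_point_unique:
  assumes fin: "finite I" and card: "card I = r" and c: "c \<in> carrier_vec r"
    and act: "\<And>t. t \<in> I \<Longrightarrow> \<bar>constraint n l k r U \<omega> t \<bullet> c\<bar> = \<beta> t"
    and inj: "\<And>w. w \<in> carrier_vec r \<Longrightarrow> (\<And>t. t \<in> I \<Longrightarrow> constraint n l k r U \<omega> t \<bullet> w = 0) \<Longrightarrow> w = 0\<^sub>v r"
    and S: "S = {t \<in> I. constraint n l k r U \<omega> t \<bullet> c = \<beta> t}"
  shows "vertex_point n l k r U \<beta> I S \<omega> = c"
proof -
  let ?A = "constraint_mat n l k r U I \<omega>" and ?h = "\<lambda>i. sorted_list_of_set I ! i"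
  have A: "?A \<in> carrier_mat r r" by (rule constraint_mat_carrier)
  have hI: "?h ` {..<r} = I"
  proof -
    have "set (sorted_list_of_set I) = ?h ` {..<length (sorted_list_of_set I)}" by (auto simp: set_conv_nth)
    then show ?thesis using fin card by simp
  qed
  have det: "det ?A \<noteq> 0"
  proof
    assume "det ?A = 0"
    then obtain w where w: "w \<in> carrier_vec r" "w \<noteq> 0\<^sub>v r" "?A *\<^sub>v w = 0\<^sub>v r"
      using det_0_iff_vec_prod_zero_field[OF A] by blast
    have "constraint n l k r U \<omega> t \<bullet> w = 0" if t: "t \<in> I" for t
    proof -
      obtain i where i: "i < r" "t = ?h i" using t hI by auto
      have "(?A *\<^sub>v w) $ i = 0" using w(3) i(1) by simp
      then show ?thesis using A i row_constraint_mat[OF i(1), of I \<omega>] by simp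
    qed
    then have "w = 0\<^sub>v r" by (rule inj[OF w(1)])
    with w(2) show False by simp
  qed
  have "?A *\<^sub>v c = vec r (\<lambda>i. let t = ?h i in if t \<in> S then \<beta> t else - \<beta> t)"
  proof (rule eq_vecI)
    fix i assume "i < dim_vec (vec r (\<lambda>i. let t = ?h i in if t \<in> S then \<beta> t else - \<beta> t))"
    then have i: "i < r" by simp
    have t: "?h i \<in> I" using hI i by blast
    have "(?A *\<^sub>v c) $ i = constraint n l k r U \<omega> (?h i) \<bullet> c"
      using A i row_constraint_mat[OF i, of I \<omega>] by simp
    also have "\<dots> = (if ?h i \<in> S then \<beta> (?h i) else - \<beta> (?h i))"
      using act[OF t] t by (auto simp: S abs_if split: if_splits)
    finally show "(?A *\<^sub>v c) $ i = vec r (\<lambda>i. let t = ?h i in if t \<in> S then \<beta> t else - \<beta> t) $ i"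
      using i by (simp add: Let_def)
  qed (use A in simp)
  then have "vertex_point n l k r U \<beta> I S \<omega> = (1 / det ?A) \<cdot>\<^sub>v (adj_mat ?A *\<^sub>v (?A *\<^sub>v c))"
    by (simp add: vertex_point_def)
  also have "adj_mat ?A *\<^sub>v (?A *\<^sub>v c) = (adj_mat ?A * ?A) *\<^sub>v c"
    using adj_mat[OF A] A c by (intro assoc_mult_mat_vec[symmetric]) auto
  also have "\<dots> = (det ?A \<cdot>\<^sub>m 1\<^sub>m r) *\<^sub>v c" using adj_mat[OF A] by simp
  also have "\<dots> = det ?A \<cdot>\<^sub>v c" using c by (intro eq_vecI) auto
  finally show ?thesis using det by (simp add: smult_smult_assoc)
qed

lemma constraint_cong:
  assumes "\<And>i. t < k \<Longrightarrow> i < l \<Longrightarrow> \<omega> (t, i) = \<omega>' (t, i)"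
  shows "constraint n l k r U \<omega> t = constraint n l k r U \<omega>' t"
  using KR_column_cong[of l \<omega> t \<omega>' n] assms by (simp add: constraint_def)

lemma vertex_point_cong:
  assumes fin: "finite I" "card I = r"
    and eq: "\<And>t i. t \<in> I \<Longrightarrow> t < k \<Longrightarrow> i < l \<Longrightarrow> \<omega> (t, i) = \<omega>' (t, i)"
  shows "vertex_point n l k r U \<beta> I S \<omega> = vertex_point n l k r U \<beta> I S \<omega>'"
proof -
  have "constraint n l k r U \<omega> (sorted_list_of_set I ! i) = constraint n l k r U \<omega>' (sorted_list_of_set I ! i)" if "i < r" for i
  proof (rule constraint_cong)
    have "sorted_list_of_set I ! i \<in> I"
      using that fin by (metis length_sorted_list_of_set nth_mem set_sorted_list_of_set)
    then show "sorted_list_of_set I ! i < k \<Longrightarrow> j < l \<Longrightarrow> \<omega> (sorted_list_of_set I ! i, j) = \<omega>' (sorted_list_of_set I ! i, j)" for j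
      by (rule eq)
  qed
  then have "constraint_mat n l k r U I \<omega> = constraint_mat n l k r U I \<omega>'"
    unfolding constraint_mat_def by (intro cong_mat) auto
  then show ?thesis by (simp add: vertex_point_def)
qed

lemma measurable_constraint:
  assumes vl: "vector_law n \<nu>" and i: "i < r"
  shows "(\<lambda>\<omega>. constraint n l k r U \<omega> t $ i) \<in> borel_measurable (KR_space l k \<nu>)"
proof (cases "t < k")
  case True
  have "(\<lambda>\<omega>. KR_column n l t \<omega> \<bullet> col U i) \<in> borel_measurable (KR_space l k \<nu>)"
    unfolding KR_space_def using True U i by (intro measurable_KR_column_scalar_prod[OF vl] col_carrier_vec) auto
  moreover have "constraint n l k r U \<omega> t $ i = KR_column n l t \<omega> \<bullet> col U i" for \<omega>
    using True U i comm_scalar_prod[OF KR_column_carrier, of "col U i" n l t \<omega>] by (simp add: constraint_def)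
  ultimately show ?thesis by simp
qed (simp add: constraint_def)

lemma measurable_vertex_point:
  assumes vl: "vector_law n \<nu>" and i: "i < r"
  shows "(\<lambda>\<omega>. vertex_point n l k r U \<beta> I S \<omega> $ i) \<in> borel_measurable (KR_space l k \<nu>)"
proof -
  let ?A = "\<lambda>\<omega>. constraint_mat n l k r U I \<omega>"
  let ?b = "\<lambda>j. let t = sorted_list_of_set I ! j in if t \<in> S then \<beta> t else - \<beta> t"
  have ent: "(\<lambda>\<omega>. ?A \<omega> $$ (a, b)) \<in> borel_measurable (KR_space l k \<nu>)" if "a < r" "b < r" for a b
    using that measurable_constraint[OF vl, of b] by (simp add: constraint_mat_def)
  have "vertex_point n l k r U \<beta> I S \<omega> $ i = (1 / det (?A \<omega>)) * (\<Sum>j<r. adj_mat (?A \<omega>) $$ (i, j) * ?b j)" for \<omega>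
    using adj_mat(1)[OF constraint_mat_carrier, of I \<omega>] i
    by (simp add: vertex_point_def scalar_prod_def atLeast0LessThan)
  moreover have "(\<lambda>\<omega>. (1 / det (?A \<omega>)) * (\<Sum>j<r. adj_mat (?A \<omega>) $$ (i, j) * ?b j)) \<in> borel_measurable (KR_space l k \<nu>)"
    using i by (intro borel_measurable_times borel_measurable_divide borel_measurable_const borel_measurable_sum
        borel_measurable_det[OF constraint_mat_carrier ent] borel_measurable_adj_mat[OF constraint_mat_carrier ent]) auto
  ultimately show ?thesis by simp
qed

lemma measurable_vertex_image:
  assumes vl: "vector_law n \<nu>" and q: "q < n ^ l"
  shows "(\<lambda>\<omega>. (U *\<^sub>v vertex_point n l k r U \<beta> I S \<omega>) $ q) \<in> borel_measurable (KR_space l k \<nu>)"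
proof -
  have "(U *\<^sub>v vertex_point n l k r U \<beta> I S \<omega>) $ q = (\<Sum>i<r. U $$ (q, i) * vertex_point n l k r U \<beta> I S \<omega> $ i)" for \<omega>
    using U q carrier_vecD[OF vertex_point_carrier, of \<beta> I S \<omega>] by (simp add: scalar_prod_def atLeast0LessThan)
  then show ?thesis
    using measurable_vertex_point[OF vl] by (auto intro!: borel_measurable_sum borel_measurable_times)
qed

end

section \<open>The injectivity event\<close>

lemma sq_norm2_smult: "sq_norm2 (a \<cdot>\<^sub>v v) = a\<^sup>2 * sq_norm2 v"
  using sq_norm2_eq_sum[of v "dim_vec v"] sq_norm2_eq_sum[of "a \<cdot>\<^sub>v v" "dim_vec v"]
  by (simp add: power_mult_distrib sum_distrib_left)

text \<open>Labels of possible failures: active constraints \<open>I\<close>, those active at their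
  upper end \<open>S\<close>, and columns \<open>J\<close> outside \<open>I\<close> with weak
  response. \<open>S\<close> ranges over all sets of constraint indices, so the count is bounded by
  a plain product of powers of 2.\<close>

definition vertex_data :: "nat \<Rightarrow> nat \<Rightarrow> (nat set \<times> nat set \<times> nat set) set" where
  "vertex_data k r = {(I, S, J). I \<subseteq> {..<k + r} \<and> card I = r \<and> S \<subseteq> {..<k + r} \<and>
     J \<subseteq> {..<k} \<and> J \<inter> I = {} \<and> r \<le> card J}"

lemma finite_card_vertex_data:
  "finite (vertex_data k r)" "card (vertex_data k r) \<le> 2 ^ (3 * k + 2 * r)"
proof -
  have sub: "vertex_data k r \<subseteq> Pow {..<k + r} \<times> Pow {..<k + r} \<times> Pow {..<k}"
    by (auto simp: vertex_data_def)
  have fin: "finite (Pow {..<k + r} \<times> Pow {..<k + r} \<times> Pow {..<k})" by simp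
  show "finite (vertex_data k r)" using sub fin by (rule finite_subset)
  have "card (vertex_data k r) \<le> card (Pow {..<k + r} \<times> Pow {..<k + r} \<times> Pow {..<k})"
    by (rule card_mono[OF fin sub])
  also have "\<dots> = 2 ^ (3 * k + 2 * r)"
    by (simp add: card_cartesian_product card_Pow power_add[symmetric])
  finally show "card (vertex_data k r) \<le> 2 ^ (3 * k + 2 * r)" .
qed

lemma ex_vertex_data:
  assumes U: "U \<in> carrier_mat (n ^ l) r" and r: "0 < r" and \<alpha>: "0 < \<alpha>"
    and b: "\<And>c i. c \<in> carrier_vec r \<Longrightarrow> sq_norm2 (U *\<^sub>v c) \<le> 1 \<Longrightarrow> i < r \<Longrightarrow> \<bar>c $ i\<bar> \<le> b i"
    and c1: "c1 \<in> carrier_vec r"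
    and bad: "sq_norm2 ((KR_matrix n l (4 * r) \<omega>)\<^sup>T *\<^sub>v (U *\<^sub>v c1)) < \<alpha> * sq_norm2 (U *\<^sub>v c1)"
  defines "k \<equiv> 4 * r"
  defines "\<beta> \<equiv> \<lambda>t. if t < k then sqrt (2 * \<alpha>) else b (t - k)"
  shows "\<exists>(I, S, J) \<in> vertex_data k r. 1 \<le> sq_norm2 (U *\<^sub>v vertex_point n l k r U \<beta> I S \<omega>) \<and>
    (\<forall>j\<in>J. (KR_column n l j \<omega> \<bullet> (U *\<^sub>v vertex_point n l k r U \<beta> I S \<omega>))\<^sup>2 \<le> 2 * \<alpha>)"
proof -
  have k: "0 < k" using r by (simp add: k_def)
  let ?x = "U *\<^sub>v c1"
  have xc: "?x \<in> carrier_vec (n ^ l)" by (rule mult_mat_vec_carrier[OF U c1])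
  have x0: "0 < sq_norm2 ?x"
  proof -
    have "0 < \<alpha> * sq_norm2 ?x" using bad sq_norm2_nonneg by (rule order_le_less_trans[rotated])
    then show ?thesis using \<alpha> by (simp add: zero_less_mult_iff)
  qed
  define \<rho> where "\<rho> = 1 / sqrt (sq_norm2 ?x)"
  have \<rho>2: "\<rho>\<^sup>2 = 1 / sq_norm2 ?x" using x0 by (simp add: \<rho>_def power_divide)
  \<comment> \<open>Scaling to an image of norm 1 places the failing vector inside the box, where
    the vertex search can start.\<close>
  define c0 where "c0 = \<rho> \<cdot>\<^sub>v c1"
  have c0: "c0 \<in> carrier_vec r" using c1 by (simp add: c0_def)
  define y where "y = U *\<^sub>v c0"
  have y: "y = \<rho> \<cdot>\<^sub>v ?x" unfolding y_def c0_def by (rule mult_mat_vec[OF U c1])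
  have y1: "sq_norm2 y = 1" unfolding y sq_norm2_smult \<rho>2 using x0 by simp
  let ?q = "\<lambda>j. (KR_column n l j \<omega> \<bullet> y)\<^sup>2"
  have q: "?q j = \<rho>\<^sup>2 * (KR_column n l j \<omega> \<bullet> ?x)\<^sup>2" for j
    unfolding y scalar_prod_smult_distrib[OF KR_column_carrier xc] by (simp add: power_mult_distrib)
  have "(\<Sum>j<k. ?q j) = \<rho>\<^sup>2 * (\<Sum>j<k. (KR_column n l j \<omega> \<bullet> ?x)\<^sup>2)"
    by (simp add: q sum_distrib_left)
  also have "\<dots> < \<rho>\<^sup>2 * (real k * (\<alpha> * sq_norm2 ?x))"
  proof (rule mult_strict_left_mono)
    have "(\<Sum>j<k. (KR_column n l j \<omega> \<bullet> ?x)\<^sup>2) / real k < \<alpha> * sq_norm2 ?x"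
      using bad sq_norm2_KR_matrix[OF xc k, of \<omega>] by (simp add: k_def)
    then show "(\<Sum>j<k. (KR_column n l j \<omega> \<bullet> ?x)\<^sup>2) < real k * (\<alpha> * sq_norm2 ?x)"
      using k by (simp add: pos_divide_less_eq mult_ac)
  qed (use \<rho>2 x0 in simp)
  also have "\<dots> = real k * \<alpha>" using x0 by (simp add: \<rho>2)
  finally have sum_lt: "(\<Sum>j<k. ?q j) < real k * \<alpha>" .
  \<comment> \<open>Markov's inequality over the columns: the mean of \<open>?q\<close> is below
    \<alpha>, so fewer than half of the values exceed \<open>2 * \<alpha>\<close>.\<close>
  define J1 where "J1 = {j. j < k \<and> ?q j \<le> 2 * \<alpha>}"
  have finJ1: "finite J1" by (simp add: J1_def)
  define N where "N = card ({..<k} - J1)"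
  have "2 * \<alpha> \<le> ?q j" if "j \<in> {..<k} - J1" for j
    using that unfolding J1_def by (simp add: not_le less_imp_le)
  then have "real N * (2 * \<alpha>) \<le> (\<Sum>j\<in>{..<k} - J1. ?q j)"
    unfolding N_def by (rule sum_bounded_below)
  also have "\<dots> \<le> (\<Sum>j<k. ?q j)" by (rule sum_mono2) simp_all
  also note sum_lt
  finally have "2 * real N * \<alpha> < real k * \<alpha>" by (simp only: mult_ac)
  then have "2 * real N < real k" using \<alpha> by (simp only: mult_less_cancel_right_pos)
  moreover have "J1 \<subseteq> {..<k}" unfolding J1_def by blast
  then have "N = k - card J1" unfolding N_def using finJ1 by (simp add: card_Diff_subset)
  ultimately have cardJ1: "2 * r \<le> card J1" unfolding k_def by linarith
  define T where "T = J1 \<union> {k..<k + r}"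
  let ?g = "constraint n l k r U \<omega>"
  have "\<exists>c I. c \<in> carrier_vec r \<and> I \<subseteq> T \<and> card I = r \<and> sq_norm2 (U *\<^sub>v c0) \<le> sq_norm2 (U *\<^sub>v c) \<and>
    (\<forall>t\<in>T. \<bar>?g t \<bullet> c\<bar> \<le> \<beta> t) \<and> (\<forall>t\<in>I. \<bar>?g t \<bullet> c\<bar> = \<beta> t) \<and>
    (\<forall>w\<in>carrier_vec r. (\<forall>t\<in>I. ?g t \<bullet> w = 0) \<longrightarrow> w = 0\<^sub>v r)"
  proof (rule ex_vertex[OF _ _ _ U c0])
    show "finite T" using finJ1 by (simp add: T_def)
    show "?g t \<in> carrier_vec r" for t by (rule constraint_carrier[OF U])
    show "\<exists>t\<in>T. ?g t = unit_vec r i" if "i < r" for i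
      using that by (intro bexI[of _ "k + i"]) (auto simp: constraint_def T_def)
    fix t assume "t \<in> T"
    then consider "t \<in> J1" | "k \<le> t" "t < k + r" by (auto simp: T_def)
    then show "\<bar>?g t \<bullet> c0\<bar> \<le> \<beta> t"
    proof cases
      case 1
      then have "t < k" "?q t \<le> 2 * \<alpha>" by (auto simp: J1_def)
      moreover from this(2) have "sqrt (?q t) \<le> sqrt (2 * \<alpha>)" by (rule real_sqrt_le_mono)
      ultimately show ?thesis using constraint_scalar_prod[OF U _ c0, of t k \<omega>] by (simp add: \<beta>_def y_def)
    next
      case 2
      then have tk: "t - k < r" by simp
      have "\<bar>c0 $ (t - k)\<bar> \<le> b (t - k)" using y1 by (intro b[OF c0 _ tk]) (simp add: y_def)
      moreover have "?g t \<bullet> c0 = c0 $ (t - k)" using 2 tk c0 by (simp add: constraint_def)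
      ultimately show ?thesis using 2 by (simp add: \<beta>_def)
    qed
  qed
  then obtain c I where c: "c \<in> carrier_vec r" and I: "I \<subseteq> T" "card I = r"
    and norm: "sq_norm2 (U *\<^sub>v c0) \<le> sq_norm2 (U *\<^sub>v c)" and feas: "\<forall>t\<in>T. \<bar>?g t \<bullet> c\<bar> \<le> \<beta> t"
    and act: "\<forall>t\<in>I. \<bar>?g t \<bullet> c\<bar> = \<beta> t"
    and inj: "\<forall>w\<in>carrier_vec r. (\<forall>t\<in>I. ?g t \<bullet> w = 0) \<longrightarrow> w = 0\<^sub>v r"
    by (elim exE conjE) (rule that)
  have TU: "T \<subseteq> {..<k + r}" unfolding T_def J1_def by auto
  have finI: "finite I" using finite_subset[OF I(1)] finite_subset[OF TU] by simp
  define S where "S = {t \<in> I. ?g t \<bullet> c = \<beta> t}"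
  have vp: "vertex_point n l k r U \<beta> I S \<omega> = c"
  proof (rule vertex_point_unique[OF U finI I(2) c])
    show "\<bar>?g t \<bullet> c\<bar> = \<beta> t" if "t \<in> I" for t using act that by (rule bspec)
    show "w = 0\<^sub>v r" if "w \<in> carrier_vec r" "\<And>t. t \<in> I \<Longrightarrow> ?g t \<bullet> w = 0" for w
      using inj[THEN bspec, OF that(1)] that(2) by simp
  qed (rule S_def)
  \<comment> \<open>Of the at least \<open>2 * r\<close> weak columns at most \<open>r\<close> are
    active at the vertex; only the others are independent of it.\<close>
  define J where "J = J1 - I"
  have "card J1 - card I \<le> card J" unfolding J_def by (rule diff_card_le_card_Diff[OF finI])
  then have "r \<le> card J" using cardJ1 I(2) by simp
  then have "(I, S, J) \<in> vertex_data k r"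
    using I TU by (auto simp: vertex_data_def S_def J_def J1_def)
  moreover have "1 \<le> sq_norm2 (U *\<^sub>v c)" using norm y1 by (simp add: y_def)
  moreover have "(KR_column n l j \<omega> \<bullet> (U *\<^sub>v c))\<^sup>2 \<le> 2 * \<alpha>" if "j \<in> J" for j
  proof -
    have j: "j < k" "j \<in> T" using that by (auto simp: J_def J1_def T_def)
    have "\<bar>KR_column n l j \<omega> \<bullet> (U *\<^sub>v c)\<bar> \<le> sqrt (2 * \<alpha>)"
      using bspec[OF feas j(2)] constraint_scalar_prod[OF U j(1) c, of \<omega>] j(1) by (simp add: \<beta>_def)
    then have "\<bar>KR_column n l j \<omega> \<bullet> (U *\<^sub>v c)\<bar>\<^sup>2 \<le> (sqrt (2 * \<alpha>))\<^sup>2" by (intro power_mono) auto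
    then show ?thesis using \<alpha> by simp
  qed
  ultimately show ?thesis by (intro bexI[of _ "(I, S, J)"]) (simp_all add: vp)
qed

text \<open>Both sides of the inequality are continuous in the coordinates, so the countably many
  rational points decide it for all.\<close>

lemma injectivity_event_measurable:
  assumes vl: "vector_law n \<nu>" and U: "U \<in> carrier_mat (n ^ l) r" and k: "0 < k"
  shows "{\<omega> \<in> space (KR_space l k \<nu>). \<forall>c\<in>carrier_vec r. \<alpha> * sq_norm2 (U *\<^sub>v c) \<le> sq_norm2 ((KR_matrix n l k \<omega>)\<^sup>T *\<^sub>v (U *\<^sub>v c))}
    \<in> sets (KR_space l k \<nu>)"
proof -
  let ?P = "KR_space l k \<nu>"
  define f where "f \<omega> c = (\<Sum>j<k. (KR_column n l j \<omega> \<bullet> (U *\<^sub>v vec r c))\<^sup>2) / real k - \<alpha> * sq_norm2 (U *\<^sub>v vec r c)" for \<omega> c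
  have carr: "U *\<^sub>v vec r c \<in> carrier_vec (n ^ l)" for c by (rule mult_mat_vec_carrier[OF U]) simp
  have f: "0 \<le> f \<omega> c \<longleftrightarrow> \<alpha> * sq_norm2 (U *\<^sub>v vec r c) \<le> sq_norm2 ((KR_matrix n l k \<omega>)\<^sup>T *\<^sub>v (U *\<^sub>v vec r c))" for \<omega> c
    by (simp add: f_def sq_norm2_KR_matrix[OF carr k])
  define Q where "Q = PiE {..<r} (\<lambda>_. \<rat> :: real set)"
  have "countable Q" unfolding Q_def by (intro countable_PiE) (auto intro: countable_rat)
  have meas: "(\<lambda>\<omega>. f \<omega> c) \<in> borel_measurable ?P" for c
    unfolding f_def KR_space_def
    by (intro borel_measurable_diff borel_measurable_divide borel_measurable_const borel_measurable_sum
        borel_measurable_power measurable_KR_column_scalar_prod[OF vl _ carr]) auto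
  have dense: "0 \<le> f \<omega> c" if Q: "\<And>c. c \<in> Q \<Longrightarrow> 0 \<le> f \<omega> c" for \<omega> c
  proof -
    \<comment> \<open>Rational points below \<open>c\<close>, coordinatewise within
      \<open>1 / Suc m\<close>.\<close>
    define a where "a m i = (if i < r then of_int \<lfloor>c i * real (Suc m)\<rfloor> / real (Suc m) else undefined)" for m i
    have aQ: "a m \<in> Q" for m unfolding Q_def a_def by (intro PiE_I) (simp_all add: Rats_divide del: of_nat_Suc)
    have lim: "(\<lambda>m. a m i) \<longlonglongrightarrow> c i" if i: "i < r" for i
    proof (rule real_tendsto_sandwich)
      show "\<forall>\<^sub>F m in sequentially. c i - 1 / real (Suc m) \<le> a m i"
      proof (rule always_eventually, rule allI)
        fix m
        have "c i * real (Suc m) - 1 \<le> of_int \<lfloor>c i * real (Suc m)\<rfloor>" by linarith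
        then have "(c i * real (Suc m) - 1) / real (Suc m) \<le> of_int \<lfloor>c i * real (Suc m)\<rfloor> / real (Suc m)"
          by (rule divide_right_mono) simp
        then show "c i - 1 / real (Suc m) \<le> a m i" using i by (simp add: a_def diff_divide_distrib del: of_nat_Suc)
      qed
      show "\<forall>\<^sub>F m in sequentially. a m i \<le> c i"
      proof (rule always_eventually, rule allI)
        fix m
        have "of_int \<lfloor>c i * real (Suc m)\<rfloor> / real (Suc m) \<le> (c i * real (Suc m)) / real (Suc m)"
          by (rule divide_right_mono) auto
        then show "a m i \<le> c i" using i by (simp add: a_def del: of_nat_Suc)
      qed
      have "(\<lambda>m. c i - 1 / real (Suc m)) \<longlonglongrightarrow> c i - 0"
        by (intro tendsto_diff tendsto_const LIMSEQ_Suc[OF lim_const_over_n])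
      then show "(\<lambda>m. c i - 1 / real (Suc m)) \<longlonglongrightarrow> c i" by simp
    qed simp
    have Uq: "(U *\<^sub>v vec r d) $ q = (\<Sum>i<r. U $$ (q, i) * d i)" if "q < n ^ l" for d q
      using U that by (simp add: scalar_prod_def atLeast0LessThan)
    have limU: "(\<lambda>m. (U *\<^sub>v vec r (a m)) $ q) \<longlonglongrightarrow> (U *\<^sub>v vec r c) $ q" if "q < n ^ l" for q
      unfolding Uq[OF that] by (intro tendsto_sum tendsto_mult tendsto_const lim) simp
    have col: "KR_column n l j \<omega> \<bullet> (U *\<^sub>v vec r d) = (\<Sum>q<n ^ l. KR_column n l j \<omega> $ q * (U *\<^sub>v vec r d) $ q)" for j d
      using U by (simp add: scalar_prod_def atLeast0LessThan)
    have "(\<lambda>m. f \<omega> (a m)) \<longlonglongrightarrow> f \<omega> c"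
      unfolding f_def col sq_norm2_eq_sum[OF carr] using k
      by (intro tendsto_diff tendsto_divide tendsto_sum tendsto_power tendsto_mult tendsto_const limU) simp_all
    then show ?thesis by (rule LIMSEQ_le_const) (intro exI allI impI Q aQ)
  qed
  have vecc: "vec r (\<lambda>i. c $ i) = c" if "c \<in> carrier_vec r" for c :: "real vec"
    using that by (intro eq_vecI) auto
  have "(\<forall>c\<in>carrier_vec r. \<alpha> * sq_norm2 (U *\<^sub>v c) \<le> sq_norm2 ((KR_matrix n l k \<omega>)\<^sup>T *\<^sub>v (U *\<^sub>v c)))
      \<longleftrightarrow> (\<forall>c\<in>Q. 0 \<le> f \<omega> c)" (is "?L \<longleftrightarrow> ?R") for \<omega>
  proof
    assume L: ?L
    show ?R
    proof
      fix c
      show "0 \<le> f \<omega> c" by (rule iffD2[OF f bspec[OF L vec_carrier]])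
    qed
  next
    assume R: ?R
    show ?L
    proof
      fix c :: "real vec" assume c: "c \<in> carrier_vec r"
      have "0 \<le> f \<omega> (\<lambda>i. c $ i)" by (rule dense) (rule bspec[OF R])
      from iffD1[OF f this]
      show "\<alpha> * sq_norm2 (U *\<^sub>v c) \<le> sq_norm2 ((KR_matrix n l k \<omega>)\<^sup>T *\<^sub>v (U *\<^sub>v c))"
        by (simp only: vecc[OF c])
    qed
  qed
  then have "{\<omega> \<in> space ?P. \<forall>c\<in>carrier_vec r. \<alpha> * sq_norm2 (U *\<^sub>v c) \<le> sq_norm2 ((KR_matrix n l k \<omega>)\<^sup>T *\<^sub>v (U *\<^sub>v c))}
      = {\<omega> \<in> space ?P. \<forall>c\<in>Q. 0 \<le> f \<omega> c}" by (simp only:)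
  also have "\<dots> \<in> sets ?P"
  proof (rule sets.sets_Collect_countable_All'[OF _ \<open>countable Q\<close>])
    show "{\<omega> \<in> space ?P. 0 \<le> f \<omega> c} \<in> sets ?P" for c
      by (rule borel_measurable_le[OF borel_measurable_const meas])
  qed
  finally show ?thesis .
qed

lemma KR_matrix_OSI:
  assumes vl: "vector_law n \<nu>" and iso: "isotropic n \<nu>" and r: "0 < r" and \<alpha>: "0 < \<alpha>" "\<alpha> \<le> 1"
    and p: "\<And>x j. x \<in> carrier_vec (n ^ l) \<Longrightarrow> 1 \<le> sq_norm2 x \<Longrightarrow> emeasure (PiM ({j} \<times> {..<l}) (\<lambda>_. \<nu>))
      {\<omega> \<in> space (PiM ({j} \<times> {..<l}) (\<lambda>_. \<nu>)). (KR_column n l j \<omega> \<bullet> x)\<^sup>2 \<le> 2 * \<alpha>} \<le> ennreal ((1 / 2) ^ 19)"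
  shows "OSI (KR_space l (4 * r) \<nu>) (n ^ l) (4 * r) (KR_matrix n l (4 * r)) r \<alpha>"
  unfolding OSI_def
proof (intro conjI ballI allI impI)
  let ?k = "4 * r" and ?P = "KR_space l (4 * r) \<nu>"
  have k: "0 < ?k" using r by simp
  show "random_matrix ?P (n ^ l) ?k (KR_matrix n l ?k)" by (rule random_matrix_KR[OF vl])
  show "integrable ?P (\<lambda>w. sq_norm2 ((KR_matrix n l ?k w)\<^sup>T *\<^sub>v x))"
    "(LINT w|?P. sq_norm2 ((KR_matrix n l ?k w)\<^sup>T *\<^sub>v x)) = sq_norm2 x" if "x \<in> carrier_vec (n ^ l)" for x
    by (rule KR_matrix_expectation[OF vl iso k that])+
  fix V assume V: "subspace_of_dim (n ^ l) r V"
  interpret P: prob_space ?P using random_matrix_KR[OF vl, of l ?k] by (simp add: random_matrix_def)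
  obtain U b where U: "U \<in> carrier_mat (n ^ l) r" and VU: "V = (\<lambda>c. U *\<^sub>v c) ` carrier_vec r"
    and b: "\<And>c i. c \<in> carrier_vec r \<Longrightarrow> sq_norm2 (U *\<^sub>v c) \<le> 1 \<Longrightarrow> i < r \<Longrightarrow> \<bar>c $ i\<bar> \<le> b i"
    using subspace_coordinates[OF V] by blast
  define \<beta> where "\<beta> t = (if t < ?k then sqrt (2 * \<alpha>) else b (t - ?k))" for t
  let ?X = "\<lambda>I S \<omega>. U *\<^sub>v vertex_point n l ?k r U \<beta> I S \<omega>"
  define E where "E = (\<lambda>(I, S, J). {\<omega> \<in> space ?P. 1 \<le> sq_norm2 (?X I S \<omega>) \<and> (\<forall>j\<in>J. (KR_column n l j \<omega> \<bullet> ?X I S \<omega>)\<^sup>2 \<le> 2 * \<alpha>)})"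
  let ?G = "{\<omega> \<in> space ?P. \<forall>c\<in>carrier_vec r. \<alpha> * sq_norm2 (U *\<^sub>v c) \<le> sq_norm2 ((KR_matrix n l ?k \<omega>)\<^sup>T *\<^sub>v (U *\<^sub>v c))}"
  have Gsets: "?G \<in> sets ?P" by (rule injectivity_event_measurable[OF vl U k])
  have Eprob: "E z \<in> sets ?P \<and> emeasure ?P (E z) \<le> ennreal ((1 / 2) ^ (19 * r))" if z: "z \<in> vertex_data ?k r" for z
  proof -
    obtain I S J where zI: "z = (I, S, J)" by (cases z) auto
    have I: "I \<subseteq> {..<?k + r}" "card I = r" and J: "J \<subseteq> {..<?k}" "J \<inter> I = {}" "r \<le> card J"
      using z by (auto simp: zI vertex_data_def)
    have finI: "finite I" using I(1) finite_subset by blast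
    have Xc: "?X I S \<omega> \<in> carrier_vec (n ^ l)" for \<omega>
      by (rule mult_mat_vec_carrier[OF U vertex_point_carrier[OF U]])
    have Xa: "?X I S \<omega> = ?X I S \<omega>'" if "\<And>j i. j < ?k \<Longrightarrow> j \<notin> J \<Longrightarrow> i < l \<Longrightarrow> \<omega> (j, i) = \<omega>' (j, i)" for \<omega> \<omega>'
    proof -
      have "vertex_point n l ?k r U \<beta> I S \<omega> = vertex_point n l ?k r U \<beta> I S \<omega>'"
        by (rule vertex_point_cong[OF U finI I(2)], rule that) (use J(2) in auto)
      then show ?thesis by simp
    qed
    \<comment> \<open>The vertex reads only the columns in \<open>I\<close>, and \<open>J\<close> is
      disjoint from \<open>I\<close>; this is the adaptedness hypothesis.\<close>
    note sb = KR_columns_small_ball_adapted[OF vl J(1) Xc measurable_vertex_image[OF U vl] Xa p]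
    have "emeasure ?P (E z) \<le> ennreal ((1 / 2) ^ 19) ^ card J"
      unfolding zI E_def prod.case by (rule sb(2))
    also have "\<dots> = ennreal (((1 / 2) ^ 19) ^ card J)" by (rule ennreal_power) simp
    also have "\<dots> \<le> ennreal (((1 / 2) ^ 19) ^ r)"
      using J(3) by (intro ennreal_leI power_decreasing power_le_one) auto
    finally have "emeasure ?P (E z) \<le> ennreal ((1 / 2) ^ (19 * r))" by (simp only: power_mult)
    moreover have "E z \<in> sets ?P" unfolding zI E_def prod.case by (rule sb(1))
    ultimately show ?thesis by simp
  qed
  have sub: "space ?P - ?G \<subseteq> (\<Union>z\<in>vertex_data ?k r. E z)"
  proof
    fix \<omega> assume \<omega>: "\<omega> \<in> space ?P - ?G"
    then obtain c1 where c1: "c1 \<in> carrier_vec r"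
      "sq_norm2 ((KR_matrix n l ?k \<omega>)\<^sup>T *\<^sub>v (U *\<^sub>v c1)) < \<alpha> * sq_norm2 (U *\<^sub>v c1)" by (auto simp: not_le)
    have "\<exists>(I, S, J) \<in> vertex_data ?k r. 1 \<le> sq_norm2 (?X I S \<omega>) \<and> (\<forall>j\<in>J. (KR_column n l j \<omega> \<bullet> ?X I S \<omega>)\<^sup>2 \<le> 2 * \<alpha>)"
      unfolding \<beta>_def by (rule ex_vertex_data[OF U r \<alpha>(1) b c1])
    then show "\<omega> \<in> (\<Union>z\<in>vertex_data ?k r. E z)" using \<omega> by (auto simp: E_def)
  qed
  have "emeasure ?P (space ?P - ?G) \<le> emeasure ?P (\<Union>z\<in>vertex_data ?k r. E z)"
    using Eprob finite_card_vertex_data by (intro emeasure_mono sub sets.finite_UN) auto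
  also have "\<dots> \<le> (\<Sum>z\<in>vertex_data ?k r. emeasure ?P (E z))"
    using Eprob finite_card_vertex_data by (intro emeasure_subadditive_finite) auto
  also have "\<dots> \<le> (\<Sum>z\<in>vertex_data ?k r. ennreal ((1 / 2) ^ (19 * r)))"
    using Eprob by (intro sum_mono) auto
  also have "\<dots> = ennreal (real (card (vertex_data ?k r)) * (1 / 2) ^ (19 * r))"
    by (simp add: ennreal_mult ennreal_of_nat_eq_real_of_nat)
  \<comment> \<open>With \<open>k = 4 * r\<close> the exponent \<open>3 * k + 2 * r\<close> is
    \<open>14 * r\<close>.\<close>
  also have "\<dots> \<le> ennreal (2 ^ (14 * r) * (1 / 2) ^ (19 * r))"
  proof (intro ennreal_leI mult_right_mono)
    have "real (card (vertex_data ?k r)) \<le> real (2 ^ (14 * r))"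
      using finite_card_vertex_data(2)[of ?k r] by (intro of_nat_mono) simp
    then show "real (card (vertex_data ?k r)) \<le> 2 ^ (14 * r)" by simp
  qed simp
  also have "(2::real) ^ (14 * r) * (1 / 2) ^ (19 * r) = (1 / 32) ^ r"
  proof -
    have "(2::real) ^ (14 * r) * (1 / 2) ^ (19 * r) = (2 ^ 14 * (1 / 2) ^ 19) ^ r"
      by (simp only: power_mult power_mult_distrib)
    also have "(2::real) ^ 14 * (1 / 2) ^ 19 = 1 / 32" by (simp add: power_divide)
    finally show ?thesis .
  qed
  finally have "P.prob (space ?P - ?G) \<le> (1 / 32) ^ r"
    by (simp add: P.emeasure_eq_measure)
  \<comment> \<open>The worst case is \<open>r = 1\<close>, where the failure probability 1/32 is
    still below 1/20.\<close>
  also have "\<dots> \<le> (1 / 32) ^ 1" using r by (intro power_decreasing) auto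
  finally have "19 / 20 \<le> P.prob ?G" using P.prob_compl[OF Gsets] by simp
  then show "19 / 20 \<le> P.prob {w \<in> space ?P. \<forall>x\<in>V. \<alpha> * sq_norm2 x \<le> sq_norm2 ((KR_matrix n l ?k w)\<^sup>T *\<^sub>v x)}"
    by (simp add: VU)
qed (use assms in auto)

section \<open>Choice of the constants\<close>

lemma small_ball_mono: "small_ball n A \<nu> \<Longrightarrow> A \<le> A' \<Longrightarrow> small_ball n A' \<nu>"
  unfolding small_ball_def by (meson less_imp_le mult_right_mono order_trans real_sqrt_le_mono)

text \<open>\<alpha> is \<open>z\<close> to the power \<open>- 8 * l\<close>, so its eighth root in
  \<open>kron_sample_small_ball\<close> is \<open>1 / z^l\<close>, set against
  \<open>(6 * a)^l\<close> from the moments. Every factor thus contributes the fixed small number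
  \<open>6 * a / z\<close>.\<close>

lemma small_ball_KR_injective:
  assumes vl: "vector_law n \<nu>" and iso: "isotropic n \<nu>" and sb: "small_ball n A \<nu>"
    and n: "0 < n" and r: "0 < r" and l: "0 < l"
  shows "KR_injective 4 n l \<nu> r ((2 ^ 92 * A) powi (- 2 * int l))"
proof -
  have A: "1 / 4 \<le> A" by (rule small_ball_isotropic_lower_bound[OF vl iso sb n])
  define a where "a = A powr (1 / 4)"
  have a: "0 < a" using A by (simp add: a_def)
  have "a ^ 4 = A powr (1 / 4 * 4)" unfolding a_def by (subst powr_powr[symmetric], subst powr_numeral) auto
  then have a4: "a ^ 4 = A" using A by simp
  \<comment> \<open>\<open>2^23\<close> is such that already for \<open>l = 1\<close> the bound
    \<open>2 * 6 / 2^23\<close> is below \<open>(1 / 2)^19\<close>; its fourth power is the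
    \<open>2^92\<close> of the statement.\<close>
  define z where "z = 2 ^ 23 * a"
  have z: "0 < z" using a by (simp add: z_def)
  have z4: "z ^ 4 = 2 ^ 92 * A" unfolding z_def power_mult_distrib a4 by simp
  define \<alpha> where "\<alpha> = (2 ^ 92 * A) powi (- 2 * int l)"
  have \<alpha>_eq: "\<alpha> = (1 / z ^ l) ^ 8"
  proof -
    have "\<alpha> = 1 / (2 ^ 92 * A) ^ (2 * l)"
      unfolding \<alpha>_def by (simp add: power_int_def nat_mult_distrib power_one_over inverse_eq_divide)
    also have "\<dots> = (1 / z ^ l) ^ 8"
      unfolding z4[symmetric] by (simp add: power_one_over power_mult[symmetric] mult_ac)
    finally show ?thesis .
  qed
  have \<alpha>0: "0 < \<alpha>" unfolding \<alpha>_eq using z by simp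
  \<comment> \<open>The lower bound 1/4 on \<open>A\<close>, a consequence of isotropy, gives
    \<open>z >= 1\<close>.\<close>
  have \<alpha>1: "\<alpha> \<le> 1"
  proof -
    have "1 \<le> z ^ 4" unfolding z4 using A by simp
    then have "1 \<le> z" using z power_less_one_iff[of z 4] by (meson not_le less_imp_le zero_less_numeral)
    then have "1 \<le> z ^ l" by (rule one_le_power)
    then show ?thesis unfolding \<alpha>_eq using z by (intro power_le_one) auto
  qed
  have nm: "neg_moment n (6 * a) \<nu>"
    unfolding a_def by (rule small_ball_neg_moment[OF vl sb]) (use A in simp)
  have num: "(6 * a) ^ l * (2 * (2 * \<alpha>)) powr (1 / 8) \<le> (1 / 2) ^ 19"
  proof -
    have "\<alpha> = (1 / z ^ l) powr 8" unfolding \<alpha>_eq using z by (simp add: powr_numeral)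
    then have "\<alpha> powr (1 / 8) = 1 / z ^ l" using z by (simp only: powr_powr) simp
    then have eq: "(2 * (2 * \<alpha>)) powr (1 / 8) = 4 powr (1 / 8) * (1 / z ^ l)"
      using \<alpha>0 powr_mult[of 4 \<alpha> "1 / 8"] by simp
    have "4 powr (1 / 8) \<le> (4::real) powr (1 / 2)" by (intro powr_mono) auto
    also have "(4::real) powr (1 / 2) = 2" by (simp add: powr_half_sqrt)
    finally have "(2 * (2 * \<alpha>)) powr (1 / 8) \<le> 2 * (1 / z ^ l)"
      unfolding eq by (rule mult_right_mono) (use z in simp)
    then have "(6 * a) ^ l * (2 * (2 * \<alpha>)) powr (1 / 8) \<le> (6 * a) ^ l * (2 * (1 / z ^ l))"
      using a by (intro mult_left_mono) auto
    also have "\<dots> = 2 * (6 * a / z) ^ l" by (simp add: power_divide)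
    also have "\<dots> = 2 * (6 / 2 ^ 23) ^ l"
    proof -
      have "6 * a / z = 6 / 2 ^ 23" unfolding z_def using a by simp
      then show ?thesis by (simp only:)
    qed
    also have "\<dots> \<le> 2 * (6 / 2 ^ 23) ^ 1"
      using l by (intro mult_left_mono power_decreasing) auto
    also have "\<dots> \<le> (1 / 2 :: real) ^ 19" by (simp add: power_divide)
    finally show ?thesis .
  qed
  have "OSI (KR_space l (4 * r) \<nu>) (n ^ l) (4 * r) (KR_matrix n l (4 * r)) r \<alpha>"
  proof (rule KR_matrix_OSI[OF vl iso r \<alpha>0 \<alpha>1])
    fix x j assume x: "x \<in> carrier_vec (n ^ l)" "1 \<le> sq_norm2 x"
    have "emeasure (PiM ({j} \<times> {..<l}) (\<lambda>_. \<nu>)) {\<omega> \<in> space (PiM ({j} \<times> {..<l}) (\<lambda>_. \<nu>)). (KR_column n l j \<omega> \<bullet> x)\<^sup>2 \<le> 2 * \<alpha>}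
        \<le> ennreal ((6 * a) ^ l * (2 * (2 * \<alpha>)) powr (1 / 8))"
      using kron_sample_small_ball[OF vl nm _ _ distinct_column_index, of "2 * \<alpha>" x l j] a \<alpha>0 x
      by (simp add: set_column_index KR_column_def)
    also have "\<dots> \<le> ennreal ((1 / 2) ^ 19)" by (rule ennreal_leI[OF num])
    finally show "emeasure (PiM ({j} \<times> {..<l}) (\<lambda>_. \<nu>)) {\<omega> \<in> space (PiM ({j} \<times> {..<l}) (\<lambda>_. \<nu>)). (KR_column n l j \<omega> \<bullet> x)\<^sup>2 \<le> 2 * \<alpha>}
        \<le> ennreal ((1 / 2) ^ 19)" .
  qed
  then show ?thesis unfolding KR_injective_def \<alpha>_def[symmetric] by (intro exI[of _ "4 * r"]) simp
qed

theorem theorem5p2: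
  shows "\<exists>C K :: real. C > 0 \<and> K > 0 \<and>
    (\<forall>(d0 :: nat) (l :: nat) (r :: nat) (\<nu> :: (nat \<Rightarrow> real) measure).
       1 \<le> d0 \<longrightarrow> 1 \<le> l \<longrightarrow> 1 \<le> r \<longrightarrow> vector_law d0 \<nu> \<longrightarrow>
         (\<forall>M :: real. isotropic d0 \<nu> \<and> indep_bounded_densities d0 M \<nu> \<longrightarrow>
            KR_injective K d0 l \<nu> r ((C * M) powi (- 2 * int l))) \<and>
         (isotropic d0 \<nu> \<and> log_concave d0 \<nu> \<or> uniform_on_sphere d0 \<nu> \<longrightarrow>
            KR_injective K d0 l \<nu> r ((C * 1) powi (- 2 * int l))))"
\<comment> \<open>90601 is the largest of the small ball constants 300, 240 and 90601, the last one
  belonging to the sphere; 4 is the ratio of \<open>k\<close> to \<open>r\<close>.\<close>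
proof (rule exI[of _ "2 ^ 92 * 90601"], rule exI[of _ 4], intro conjI allI impI)
  fix d0 l r :: nat and \<nu> :: "(nat \<Rightarrow> real) measure"
  assume pos: "1 \<le> d0" "1 \<le> l" "1 \<le> r" and vl: "vector_law d0 \<nu>"
  have main: "KR_injective 4 d0 l \<nu> r ((2 ^ 92 * 90601 * M) powi (- 2 * int l))"
    if "isotropic d0 \<nu>" "small_ball d0 (90601 * M) \<nu>" for M
    using small_ball_KR_injective[OF vl that, of r l] pos by (simp add: mult.assoc)
  show "KR_injective 4 d0 l \<nu> r ((2 ^ 92 * 90601 * M) powi (- 2 * int l))"
    if ib: "isotropic d0 \<nu> \<and> indep_bounded_densities d0 M \<nu>" for M
  proof (rule main)
    show "isotropic d0 \<nu>" using ib by (rule conjunct1)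
    \<comment> \<open>Enlarging 300 to 90601 requires \<open>0 <= M\<close>, which the first
      coordinate provides since its density lies between 0 and \<open>M\<close>.\<close>
    have "bounded_law M (distr \<nu> borel (\<lambda>x. x 0))"
      by (rule indep_bounded_laws[OF vl conjunct2[OF ib]]) (use pos in simp)
    then have "0 \<le> M" unfolding bounded_law_def by simp
    then have "300 * M \<le> 90601 * M" by simp
    then show "small_ball d0 (90601 * M) \<nu>"
      by (rule small_ball_mono[OF indep_bounded_densities_small_ball[OF vl conjunct2[OF ib]]])
  qed
  show "KR_injective 4 d0 l \<nu> r ((2 ^ 92 * 90601 * 1) powi (- 2 * int l))"
    if "isotropic d0 \<nu> \<and> log_concave d0 \<nu> \<or> uniform_on_sphere d0 \<nu>"
    using that
  proof
    assume lc: "isotropic d0 \<nu> \<and> log_concave d0 \<nu>"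
    have "small_ball d0 (90601 * 1) \<nu>"
      by (rule small_ball_mono[OF log_concave_small_ball[OF vl conjunct1[OF lc] conjunct2[OF lc]]]) simp
    then show ?thesis by (rule main[OF conjunct1[OF lc]])
  next
    assume us: "uniform_on_sphere d0 \<nu>"
    have "small_ball d0 (90601 * 1) \<nu>" using uniform_on_sphere_small_ball[OF us] by simp
    then show ?thesis by (rule main[OF uniform_on_sphere_isotropic[OF us]])
  qed
qed simp_all

end
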